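(* For every $r$-tuple of partitions $(\lambda^{(1)}|\cdots|\lambda^{(r)})$, $$\mathcal{S}_{(\lambda^{(1)}|\cdots|\lambda^{(r)})}(X_1|\cdots|X_r)=\sum_{\sigma\in\mathcal{L}(\lambda^{(1)}|\cdots|\lambda^{(r)})}x^{\sigma}.$$
   Context: Isobaric divided differences: for variables $x,y$, $\xi_{x,y}(f)=\frac{xf(x,y)-yf(y,x)}{x-y}$, and $\xi_i=\xi_{x_i,x_{i+1}}$ on $\mathbb{Q}[x_1,\dots,x_n]$. Key polynomials: for $\alpha\in\mathbb{Z}_{\ge0}^n$, $\mathcal{K}_\alpha(x_1,\dots,x_n)$ are the unique polynomials with $\mathcal{K}_\alpha=x^\alpha$ if $\alpha_1\ge\cdots\ge\alpha_n$, and $\mathcal{K}_{s_i\alpha}=\xi_i\mathcal{K}_\alpha$ whenever $\alpha_i>\alpha_{i+1}$ ($s_i\alpha$ swaps entries $i,i+1$). Compositions are finite sequences of nonnegative integers, $*$ is concatenation, $0^m$ is a string of $m$ zeros; for a partition $\lambda$, $\ell(\lambda)$ is its number of nonzero parts and $\mathrm{rev}(\lambda)=(\lambda_{\ell(\lambda)},\dots,\lambda_1)$. For $n_i\ge\ell(\lambda^{(i)})$ put $\mathcal{S}^{(n_1|\cdots|n_r)}_{(\lambda^{(1)}|\cdots|\lambda^{(r)})}=\mathcal{K}_{\gamma}(x_{1,1},\dots,x_{1,n_1},\dots,x_{r,1},\dots,x_{r,n_r})$ with $\gamma=(0^{n_1-\ell(\lambda^{(1)})}*\mathrm{rev}(\lambda^{(1)}))*\cdots*(0^{n_r-\ell(\lambda^{(r)})}*\mathrm{rev}(\lambda^{(r)}))$.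 The multi-symmetric Schur function $\mathcal{S}_{(\lambda^{(1)}|\cdots|\lambda^{(r)})}(X_1|\cdots|X_r)$, $X_i=\{x_{i,1},x_{i,2},\dots\}$, is the limit of these polynomials as $n_1,\dots,n_r\to\infty$ (each monomial coefficient eventually stabilizes). Diagrams: for a composition $\mu=(\mu_1,\dots,\mu_n)$, $dg'(\mu)=\{(i,j):1\le i\le n,1\le j\le\mu_i\}$ (column $i$ has height $\mu_i$) and $\widehat{dg}(\mu)=dg'(\mu)\cup\{(i,0):1\le i\le n\}$ (basement row). Two distinct boxes attack if they are in the same row, or they are in consecutive rows and the box in the lower row is strictly to the right of the box in the upper row. For a labeling $\tau$ of $\widehat{dg}(\mu)$ by a totally ordered set, a co-inversion triple is a triple of boxes $(u,v,w)$ with $u=(i,j)$, $j\ge1$, $w=(i,j-1)$ the box directly below $u$, and either (Type 1) $v=(i',j-1)$ with $i'>i$ and $\mu_{i'}<\mu_i$, or (Type 2) $v=(i',j)$ with $i'<i$ and $\mu_{i'}\le\mu_i$, such that $\tau(u)<\tau(v)<\tau(w)$ or $\tau(v)<\tau(w)<\tau(u)$ or $\tau(w)<\tau(u)<\tau(v)$. Alphabet: labels $k_j$ ($k\ge1$, $1\le j\le r$) and basement symbols $\omega_j+k$ ($k\ge0$, $1\le j\le r$), totally ordered so that within index $j$: $a_j<b_j$ iff $a<b$, every $a_j<\omega_j+k$, $\omega_j+k<\omega_j+k'$ iff $k<k'$; and every element with index $j$ is smaller than every element with index $j'>j$. Let $\mathcal{L}(\lambda^{(1)}|\cdots|\lambda^{(r)})$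 be the set of maps $\sigma$ from $dg'(\mathrm{rev}(\lambda^{(1)})*\cdots*\mathrm{rev}(\lambda^{(r)}))$ to $\{k_j\}$ such that the extension $\sigma^\star$ to $\widehat{dg}$, defined on basement boxes by $\sigma^\star(\ell(\lambda^{(1)})+\cdots+\ell(\lambda^{(i-1)})+j,0)=\omega_i+j-1$ ($1\le j\le\ell(\lambda^{(i)})$), is non-attacking (attacking boxes have distinct labels), weakly decreasing upwards in each column, and has no co-inversion triples. The weight is $x^\sigma=\prod_{j}\prod_{k}x_{j,k}^{|\sigma^{-1}(k_j)|}$. *)

theory Defs
  imports
    Complex_Main
    "HOL-Library.Poly_Mapping"
    "HOL-Library.FuncSet"
    "HOL-Combinatorics.Transposition"
begin

(* Columns of diagrams, entries of compositions, the r alphabets and the variables inside each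
   alphabet are all numbered from 0, following list indexing.  Rows of diagrams are numbered
   from 1, row 0 being the basement. *)

section \<open>Polynomials\<close>

text \<open>Polynomials over the rationals in variables of type \<open>'v\<close>: a map from monomials (finitely
  supported exponent vectors) to coefficients.\<close>

type_synonym 'v mpoly = "('v \<Rightarrow>\<^sub>0 nat) \<Rightarrow>\<^sub>0 rat"

definition var :: "'v \<Rightarrow> 'v mpoly" where
  "var v = Poly_Mapping.single (Poly_Mapping.single v 1) 1"

definition coeff :: "'v mpoly \<Rightarrow> ('v \<Rightarrow>\<^sub>0 nat) \<Rightarrow> rat" where
  "coeff f m = Poly_Mapping.lookup f m"

definition subst :: "('v \<Rightarrow> 'w mpoly) \<Rightarrow> 'v mpoly \<Rightarrow> 'w mpoly" where
  "subst \<phi> f = (\<Sum>m\<in>Poly_Mapping.keys f. Poly_Mapping.single 0 (coeff f m) *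
     (\<Prod>v\<in>Poly_Mapping.keys m. \<phi> v ^ Poly_Mapping.lookup m v))"

section \<open>Isobaric divided differences and key polynomials\<close>

text \<open>For \<open>x \<noteq> y\<close> the quotient of \<open>x f(x,y) - y f(y,x)\<close> by \<open>x - y\<close> exists and is unique.\<close>

definition xi_vars :: "'v \<Rightarrow> 'v \<Rightarrow> 'v mpoly \<Rightarrow> 'v mpoly" where
  "xi_vars x y f = (THE g. (var x - var y) * g =
     var x * f - var y * subst (\<lambda>v. var (transpose x y v)) f)"

definition xi :: "nat \<Rightarrow> nat mpoly \<Rightarrow> nat mpoly" where
  "xi i = xi_vars i (Suc i)"

definition swap_entries :: "nat \<Rightarrow> nat list \<Rightarrow> nat list" where
  "swap_entries i \<alpha> = \<alpha>[i := \<alpha> ! Suc i, Suc i := \<alpha> ! i]"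

definition is_key_family :: "(nat list \<Rightarrow> nat mpoly) \<Rightarrow> bool" where
  "is_key_family K \<longleftrightarrow>
     (\<forall>\<alpha>. sorted_wrt (\<ge>) \<alpha> \<longrightarrow> K \<alpha> = (\<Prod>i<length \<alpha>. var i ^ (\<alpha> ! i))) \<and>
     (\<forall>\<alpha> i. Suc i < length \<alpha> \<and> \<alpha> ! i > \<alpha> ! Suc i \<longrightarrow> K (swap_entries i \<alpha>) = xi i (K \<alpha>))"

definition key_poly :: "nat list \<Rightarrow> nat mpoly" where
  "key_poly = (THE K. is_key_family K)"

section \<open>Multi-symmetric Schur functions\<close>

text \<open>A partition is a weakly decreasing list; trailing zeros are allowed and ignored.\<close>

definition is_partition :: "nat list \<Rightarrow> bool" where
  "is_partition lam \<longleftrightarrow> sorted_wrt (\<ge>) lam"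

definition plength :: "nat list \<Rightarrow> nat" where
  "plength lam = length (filter (\<lambda>p. p \<noteq> 0) lam)"

definition prev :: "nat list \<Rightarrow> nat list" where
  "prev lam = rev (take (plength lam) lam)"

text \<open>The pair \<open>(j, k)\<close> stands for the \<open>k\<close>-th variable of the \<open>j\<close>-th alphabet.  A formal power
  series is its coefficient function.\<close>

type_synonym mvar = "nat \<times> nat"
type_synonym series = "(mvar \<Rightarrow>\<^sub>0 nat) \<Rightarrow> rat"

definition padded_comp :: "nat list list \<Rightarrow> nat list \<Rightarrow> nat list" where
  "padded_comp lams ns =
     concat (map2 (\<lambda>lam n. replicate (n - plength lam) 0 @ prev lam) lams ns)"

definition block_vars :: "nat list \<Rightarrow> mvar list" where
  "block_vars ns = concat (map (\<lambda>j. map (Pair j) [0..<ns ! j]) [0..<length ns])"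

definition multi_schur_poly :: "nat list list \<Rightarrow> nat list \<Rightarrow> mvar mpoly" where
  "multi_schur_poly lams ns =
     subst (\<lambda>p. var (block_vars ns ! p)) (key_poly (padded_comp lams ns))"

definition stable_coeff :: "nat \<Rightarrow> (nat list \<Rightarrow> mvar mpoly) \<Rightarrow> (mvar \<Rightarrow>\<^sub>0 nat) \<Rightarrow> rat \<Rightarrow> bool" where
  "stable_coeff r F m c \<longleftrightarrow>
     (\<exists>N. \<forall>ns. length ns = r \<and> (\<forall>n\<in>set ns. N \<le> n) \<longrightarrow> coeff (F ns) m = c)"

definition multi_schur :: "nat list list \<Rightarrow> series" where
  "multi_schur lams = (\<lambda>m. THE c. stable_coeff (length lams) (multi_schur_poly lams) m c)"

section \<open>Diagrams, attacking boxes and co-inversion triples\<close>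

type_synonym box = "nat \<times> nat"  \<comment> \<open>(column, row)\<close>

definition dg :: "nat list \<Rightarrow> box set" where
  "dg \<mu> = {(i, j). i < length \<mu> \<and> 1 \<le> j \<and> j \<le> \<mu> ! i}"

definition dg_hat :: "nat list \<Rightarrow> box set" where
  "dg_hat \<mu> = dg \<mu> \<union> {(i, 0) | i. i < length \<mu>}"

fun attack :: "box \<Rightarrow> box \<Rightarrow> bool" where
  "attack (i, j) (i', j') \<longleftrightarrow> (i, j) \<noteq> (i', j') \<and>
     (j = j' \<or> (j = Suc j' \<and> i < i') \<or> (j' = Suc j \<and> i' < i))"

definition non_attacking :: "nat list \<Rightarrow> (box \<Rightarrow> 'a) \<Rightarrow> bool" where
  "non_attacking \<mu> \<tau> \<longleftrightarrow> (\<forall>u\<in>dg_hat \<mu>. \<forall>v\<in>dg_hat \<mu>. attack u v \<longrightarrow> \<tau> u \<noteq> \<tau> v)"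

definition column_decreasing :: "nat list \<Rightarrow> (box \<Rightarrow> 'a::linorder) \<Rightarrow> bool" where
  "column_decreasing \<mu> \<tau> \<longleftrightarrow> (\<forall>(i, j)\<in>dg \<mu>. \<tau> (i, j) \<le> \<tau> (i, j - 1))"

definition coinversion_triple ::
    "nat list \<Rightarrow> (box \<Rightarrow> 'a::linorder) \<Rightarrow> box \<Rightarrow> box \<Rightarrow> box \<Rightarrow> bool" where
  "coinversion_triple \<mu> \<tau> u v w \<longleftrightarrow>
     u \<in> dg_hat \<mu> \<and> v \<in> dg_hat \<mu> \<and> w \<in> dg_hat \<mu> \<and>
     (\<exists>i j i'. 1 \<le> j \<and> u = (i, j) \<and> w = (i, j - 1) \<and>
        (v = (i', j - 1) \<and> i < i' \<and> \<mu> ! i' < \<mu> ! i \<or>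
         v = (i', j) \<and> i' < i \<and> \<mu> ! i' \<le> \<mu> ! i)) \<and>
     (\<tau> u < \<tau> v \<and> \<tau> v < \<tau> w \<or> \<tau> v < \<tau> w \<and> \<tau> w < \<tau> u \<or> \<tau> w < \<tau> u \<and> \<tau> u < \<tau> v)"

section \<open>The alphabet\<close>

text \<open>\<open>Lab j k\<close> is the label \<open>k\<^sub>j\<close>, corresponding to the variable \<open>(j, k)\<close>;
  \<open>Base j k\<close> is the basement symbol \<open>\<omega>\<^sub>j + k\<close>.\<close>

datatype entry = Lab nat nat | Base nat nat

instantiation entry :: linorder
begin

fun less_entry :: "entry \<Rightarrow> entry \<Rightarrow> bool" where
  "Lab j a < Lab j' b \<longleftrightarrow> j < j' \<or> j = j' \<and> a < b"
| "Lab j a < Base j' b \<longleftrightarrow> j < j' \<or> j = j'"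
| "Base j a < Lab j' b \<longleftrightarrow> j < j'"
| "Base j a < Base j' b \<longleftrightarrow> j < j' \<or> j = j' \<and> a < b"

definition less_eq_entry :: "entry \<Rightarrow> entry \<Rightarrow> bool" where
  "less_eq_entry x y \<longleftrightarrow> x < y \<or> x = y"

instance
proof
  fix x y z :: entry
  show "x < y \<longleftrightarrow> x \<le> y \<and> \<not> y \<le> x"
    by (cases x; cases y) (auto simp: less_eq_entry_def)
  show "x \<le> x"
    by (simp add: less_eq_entry_def)
  show "x \<le> z" if "x \<le> y" "y \<le> z"
    using that by (cases x; cases y; cases z) (auto simp: less_eq_entry_def)
  show "x = y" if "x \<le> y" "y \<le> x"
    using that by (cases x; cases y) (auto simp: less_eq_entry_def)
  show "x \<le> y \<or> y \<le> x"
    by (cases x; cases y) (auto simp: less_eq_entry_def)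
qed

end

section \<open>The labelings and their generating function\<close>

definition shape :: "nat list list \<Rightarrow> nat list" where
  "shape lams = concat (map prev lams)"

text \<open>The basement row, read from left to right.\<close>

definition basement :: "nat list list \<Rightarrow> entry list" where
  "basement lams =
     concat (map (\<lambda>i. map (Base i) [0..<plength (lams ! i)]) [0..<length lams])"

fun extend :: "nat list list \<Rightarrow> (box \<Rightarrow> entry) \<Rightarrow> box \<Rightarrow> entry" where
  "extend lams \<sigma> (i, j) = (if j = 0 then basement lams ! i else \<sigma> (i, j))"

definition labelings :: "nat list list \<Rightarrow> (box \<Rightarrow> entry) set" where
  "labelings lams =
     {\<sigma> \<in> dg (shape lams) \<rightarrow>\<^sub>E {Lab j k | j k. j < length lams}.
        non_attacking (shape lams) (extend lams \<sigma>) \<and>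
        column_decreasing (shape lams) (extend lams \<sigma>) \<and>
        (\<nexists>u v w. coinversion_triple (shape lams) (extend lams \<sigma>) u v w)}"

text \<open>The product ranges over the variables with nonzero exponent.\<close>

definition weight :: "nat list list \<Rightarrow> (box \<Rightarrow> entry) \<Rightarrow> mvar mpoly" where
  "weight lams \<sigma> =
     (\<Prod>(j, k)\<in>{(j, k). Lab j k \<in> \<sigma> ` dg (shape lams)}.
        var (j, k) ^ card {b \<in> dg (shape lams). \<sigma> b = Lab j k})"

text \<open>The formal sum of a possibly infinite family of polynomials in which each monomial occurs in
  only finitely many members.\<close>

definition series_sum :: "'i set \<Rightarrow> ('i \<Rightarrow> mvar mpoly) \<Rightarrow> series" where
  "series_sum A F = (\<lambda>m. \<Sum>a\<in>{a \<in> A. coeff (F a) m \<noteq> 0}. coeff (F a) m)"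

end

(* Read a filling box by box, row by row upwards and from left to right in each row, and record the
   label that each column currently carries.  The columns become particles on the line of labels.
   A particle may move weakly to the left, to an unoccupied site, and it may jump over particles of
   higher priority only; priority is the order in which the columns end, so taller columns have
   higher priority and, among columns of equal height, those further to the right.  This rule
   encodes the non-attacking condition, the monotonicity of columns and the absence of co-inversion
   triples, all at once.  For arbitrary starting positions let Z be the generating function of the
   process.

   By induction on the sequence of actions one controls the symmetry of Z in two adjacent variables
   x_a, x_b, according to which particles occupy the sites a and b.  If alpha_i > alpha_(i+1) this
   shows that xi_i Z(id) = Z(id) + Z(s_i), where id and s_i are the starting positions of the
   columns.  A second induction shows that Z(id) + Z(s_i) is the generating function belonging to
   s_i alpha.  So the generating functions of the fillings with basement 1, ..., n form the (unique)
   key family.  Finally, columns of height zero never obstruct anything, and if a monomial is fixed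
   and the alphabets are large, relabelling the basement gives the bijection with the labelings. *)

theory Submission
  imports Defs
begin

section \<open>Moving particles and symmetry in two adjacent variables\<close>

text \<open>Both inductions run over the remaining actions, and a move changes the positions but not
  the rest of the schedule. Hence arbitrary positions are needed, although only the identity and its
  adjacent transpositions matter in the end. The first induction closes because the actions are
  cyclic: two particles on the sites \<open>a\<close> and \<open>b\<close> act alternately. With the
  one of higher priority at \<open>b\<close> and the other at \<open>a\<close>, the former is stuck,
  whereas in the opposite arrangement the one of lower priority can jump over its partner. This
  asymmetry yields two different sets of relations, which turn into each other as the turn passes.
  The second induction cannot keep its two particles adjacent. A third particle between them, in
  position and in priority, can be jumped over by the shorter column only; this forces a case
  distinction that is void at the start. Removal is an action of its own because a column of height
  h still obstructs, through its top box, the columns to its left in row h + 1. Division by x_a -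
  x_b is avoided throughout: divided differences are handled through their characterization by
  symmetric polynomials.\<close>

text \<open>\<open>p\<close> gives the positions of the active particles \<open>A\<close>; \<open>rk\<close> gives their priorities.\<close>

definition may_move :: "(nat \<Rightarrow> nat) \<Rightarrow> nat set \<Rightarrow> (nat \<Rightarrow> nat) \<Rightarrow> nat \<Rightarrow> nat \<Rightarrow> bool" where
  "may_move rk A p c u \<longleftrightarrow> u \<le> p c \<and>
     (\<forall>d\<in>A - {c}. p d \<noteq> u \<and> (rk d < rk c \<longrightarrow> \<not> (u \<le> p d \<and> p d \<le> p c)))"

text \<open>The last occurrence of a particle in the list does not move it but removes it.  The values of
  \<open>p\<close> at inactive particles are irrelevant.\<close>

fun process_sum ::
    "(nat \<Rightarrow> 'r::comm_ring_1) \<Rightarrow> (nat \<Rightarrow> nat) \<Rightarrow> nat list \<Rightarrow> (nat \<Rightarrow> nat) \<Rightarrow> 'r" where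
  "process_sum x rk [] p = 1"
| "process_sum x rk (c # R) p =
     (if c \<in> set R
      then \<Sum>u | may_move rk (set R) p c u. x u * process_sum x rk R (p(c := u))
      else process_sum x rk R p)"

text \<open>First occurrences are compared, so this tells which of two particles acts next. It is
  also true if \<open>c\<close> occurs and \<open>d\<close> does not.\<close>

fun acts_before :: "nat \<Rightarrow> nat \<Rightarrow> nat list \<Rightarrow> bool" where
  "acts_before c d [] \<longleftrightarrow> False"
| "acts_before c d (e # R) \<longleftrightarrow> e = c \<or> e \<noteq> d \<and> acts_before c d R"

text \<open>This is all that the symmetry argument needs to know about reading a diagram row by row:
  between two actions of one particle every other remaining particle has its turn, and particles are
  removed in increasing order of rank.\<close>

fun cyclic_schedule :: "(nat \<Rightarrow> nat) \<Rightarrow> nat list \<Rightarrow> bool" where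
  "cyclic_schedule rk [] \<longleftrightarrow> True"
| "cyclic_schedule rk (c # R) \<longleftrightarrow> cyclic_schedule rk R \<and>
     (if c \<in> set R then \<forall>d\<in>set R - {c}. acts_before d c R else \<forall>d\<in>set R. rk c < rk d)"

lemma finite_may_move [simp]: "finite {u. may_move rk A p c u}"
  by (rule finite_subset[of _ "{..p c}"]) (auto simp: may_move_def)

lemma process_sum_cong:
  "(\<And>c. c \<in> set L \<Longrightarrow> p c = q c) \<Longrightarrow> process_sum x rk L p = process_sum x rk L q"
proof (induction L arbitrary: p q)
  case Nil
  then show ?case by simp
next
  case (Cons c R)
  have m: "may_move rk (set R) p c = may_move rk (set R) q c"
    using Cons.prems by (auto simp: may_move_def fun_eq_iff)
  have "process_sum x rk R (p(c := u)) = process_sum x rk R (q(c := u))" for u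
    by (rule Cons.IH) (use Cons.prems in auto)
  moreover have "process_sum x rk R p = process_sum x rk R q"
    by (rule Cons.IH) (use Cons.prems in auto)
  ultimately show ?case
    by (simp add: m)
qed

text \<open>Each particle, when removed, has a rank strictly below those of all remaining
  ones.\<close>

lemma cyclic_schedule_inj: "cyclic_schedule rk L \<Longrightarrow> inj_on rk (set L)"
proof (induction L)
  case (Cons c R)
  show ?case
  proof (cases "c \<in> set R")
    case True
    then show ?thesis using Cons by (simp add: insert_absorb)
  next
    case False
    then have "rk c \<notin> rk ` set R" using Cons.prems by auto
    then show ?thesis using Cons False by (simp add: inj_on_insert)
  qed
qed simp

text \<open>Isolates the influence of a single obstacle, so that configurations differing in one or
  two particles can be compared.\<close>

lemma may_move_upd_other:
  assumes "c \<noteq> d" "c \<in> A"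
  shows "may_move rk A (p(c := v)) d u \<longleftrightarrow>
    may_move rk (A - {c}) p d u \<and> v \<noteq> u \<and> (rk c < rk d \<longrightarrow> \<not> (u \<le> v \<and> v \<le> p d))"
proof -
  have A: "A - {d} = insert c (A - {c} - {d})" using assms by blast
  have "(\<forall>e\<in>A - {d}. P e) \<longleftrightarrow> P c \<and> (\<forall>e\<in>A - {c} - {d}. P e)" for P
    unfolding A by blast
  moreover have "(p(c := v)) d = p d" "(p(c := v)) c = v" using assms by auto
  moreover have "(\<forall>e\<in>A - {c} - {d}. (p(c := v)) e \<noteq> u \<and> (rk e < rk d \<longrightarrow> \<not> (u \<le> (p(c := v)) e \<and> (p(c := v)) e \<le> p d)))
     \<longleftrightarrow> (\<forall>e\<in>A - {c} - {d}. p e \<noteq> u \<and> (rk e < rk d \<longrightarrow> \<not> (u \<le> p e \<and> p e \<le> p d)))"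
    by (rule ball_cong) auto
  ultimately show ?thesis
    unfolding may_move_def by (simp only: simp_thms) blast
qed

lemma upd_avoids:
  "(\<And>d. d \<in> A \<Longrightarrow> d \<noteq> c \<Longrightarrow> p d \<noteq> v) \<Longrightarrow> u \<noteq> v \<Longrightarrow> v \<notin> (p(c := u)) ` A"
  by auto

text \<open>An abstract ring with an endomorphism exchanging \<open>x a\<close> and
  \<open>x b\<close> suffices, since no quotient is ever formed. Polynomials enter later by
  interpretation.\<close>

locale variable_swap =
  fixes x :: "nat \<Rightarrow> 'r::comm_ring_1" and s :: "'r \<Rightarrow> 'r" and a b :: nat
  assumes s_add: "s (f + g) = s f + s g"
    and s_mult: "s (f * g) = s f * s g"
    and s_one: "s 1 = 1"
    and s_a: "s (x a) = x b" and s_b: "s (x b) = x a"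
    and s_other: "u \<noteq> a \<Longrightarrow> u \<noteq> b \<Longrightarrow> s (x u) = x u"
    and b_def: "b = Suc a"
begin

lemma s_zero: "s 0 = 0"
  using s_add[of 0 0] by simp

lemma s_diff: "s (f - g) = s f - s g"
  using s_add[of "f - g" g] by (simp add: algebra_simps)

lemma s_sum: "s (sum f A) = (\<Sum>i\<in>A. s (f i))"
  by (induction A rule: infinite_finite_induct) (auto simp: s_zero s_add)

lemma sym_weighted_sum:
  assumes "\<And>u. u \<in> A \<Longrightarrow> u \<noteq> a \<and> u \<noteq> b \<and> s (f u) = f u"
  shows "s (\<Sum>u\<in>A. x u * f u) = (\<Sum>u\<in>A. x u * f u)"
  using assms by (auto simp: s_sum s_mult s_other intro!: sum.cong)

text \<open>Divided differences in \<open>x a\<close>, \<open>x b\<close> are linear over elements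
  fixed by \<open>s\<close>, such as the weights \<open>x u\<close> here. The witness is the
  weighted sum of the individual witnesses.\<close>

lemma xi_pair_weighted_sum:
  assumes "\<And>u. u \<in> A \<Longrightarrow> u \<noteq> a \<and> u \<noteq> b \<and> (\<exists>D. s D = D \<and> g u = f u + x b * D)"
  shows "\<exists>D. s D = D \<and> (\<Sum>u\<in>A. x u * g u) = (\<Sum>u\<in>A. x u * f u) + x b * D"
proof -
  obtain D where D: "\<And>u. u \<in> A \<Longrightarrow> s (D u) = D u \<and> g u = f u + x b * D u"
    using assms by metis
  show ?thesis
  proof (intro exI conjI)
    show "s (\<Sum>u\<in>A. x u * D u) = (\<Sum>u\<in>A. x u * D u)"
      by (rule sym_weighted_sum) (use assms D in auto)
    show "(\<Sum>u\<in>A. x u * g u) = (\<Sum>u\<in>A. x u * f u) + x b * (\<Sum>u\<in>A. x u * D u)"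
      unfolding sum_distrib_left sum.distrib[symmetric]
      by (rule sum.cong) (auto simp: D algebra_simps)
  qed
qed

text \<open>The sites are adjacent, so a position other than \<open>a\<close> lies weakly to the
  right of both or of neither.\<close>

lemma may_move_a_iff_b:
  assumes "p c \<noteq> a" "\<And>d. d \<in> A - {c} \<Longrightarrow> p d \<noteq> a \<and> p d \<noteq> b"
  shows "may_move rk A p c a \<longleftrightarrow> may_move rk A p c b"
proof -
  have *: "(a \<le> q) = (b \<le> q)" if "q \<noteq> a" for q using that b_def by linarith
  show ?thesis
    unfolding may_move_def
    by (rule conj_cong[OF *[OF assms(1)] ball_cong[OF refl]]) (use assms(2) * in blast)
qed

abbreviation Z where "Z \<equiv> process_sum x"

text \<open>The invariants, where \<open>\<xi>\<close> is the isobaric divided difference in \<open>x a\<close>, \<open>x b\<close>.  A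
  polynomial \<open>g\<close> equals \<open>\<xi> f\<close> iff \<open>g\<close> is symmetric and \<open>g - f\<close> is \<open>x b\<close> times a symmetric
  polynomial; so \<open>inv1\<close> says that \<open>\<xi>\<close> moves a lone particle from \<open>a\<close> to \<open>b\<close>.  If both sites are
  occupied, the relations depend on which of the two particles is the next one to act.\<close>

definition inv0 :: "(nat \<Rightarrow> nat) \<Rightarrow> nat list \<Rightarrow> bool" where
  "inv0 rk L \<longleftrightarrow> (\<forall>p. a \<notin> p ` set L \<and> b \<notin> p ` set L \<longrightarrow> s (Z rk L p) = Z rk L p)"

definition inv1 :: "(nat \<Rightarrow> nat) \<Rightarrow> nat list \<Rightarrow> bool" where
  "inv1 rk L \<longleftrightarrow> (\<forall>p c. c \<in> set L \<and> a \<notin> p ` (set L - {c}) \<and> b \<notin> p ` (set L - {c}) \<longrightarrow>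
     s (Z rk L (p(c := b))) = Z rk L (p(c := b)) \<and>
     (\<exists>D. s D = D \<and> Z rk L (p(c := b)) = Z rk L (p(c := a)) + x b * D))"

definition inv2 :: "(nat \<Rightarrow> nat) \<Rightarrow> nat list \<Rightarrow> bool" where
  "inv2 rk L \<longleftrightarrow> (\<forall>p l h. l \<in> set L \<and> h \<in> set L \<and> rk l < rk h \<and>
       a \<notin> p ` (set L - {l, h}) \<and> b \<notin> p ` (set L - {l, h}) \<longrightarrow>
     (let f1 = Z rk L (p(l := a, h := b)); f2 = Z rk L (p(l := b, h := a)) in
       (acts_before h l L \<longrightarrow> (\<exists>D. s D = D \<and> f1 = x b * D) \<and> s (f1 + f2) = f1 + f2) \<and>
       (acts_before l h L \<longrightarrow> s f1 = f1 \<and> s (x a * f2 + x b * f1) = x a * f2 + x b * f1)))"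

section \<open>Induction steps for the three invariants\<close>

lemma inv0D: "inv0 rk L \<Longrightarrow> a \<notin> p ` set L \<Longrightarrow> b \<notin> p ` set L \<Longrightarrow> s (Z rk L p) = Z rk L p"
  unfolding inv0_def by blast

lemma inv1D:
  assumes "inv1 rk L" "c \<in> set L" "a \<notin> p ` (set L - {c})" "b \<notin> p ` (set L - {c})"
  shows "s (Z rk L (p(c := b))) = Z rk L (p(c := b))"
    and "\<exists>D. s D = D \<and> Z rk L (p(c := b)) = Z rk L (p(c := a)) + x b * D"
  using assms unfolding inv1_def by blast+

lemma inv2D:
  assumes "inv2 rk L" "l \<in> set L" "h \<in> set L" "rk l < rk h"
    "a \<notin> p ` (set L - {l, h})" "b \<notin> p ` (set L - {l, h})"
  shows "acts_before h l L \<Longrightarrow> \<exists>D. s D = D \<and> Z rk L (p(l := a, h := b)) = x b * D"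
    and "acts_before h l L \<Longrightarrow>
      s (Z rk L (p(l := a, h := b)) + Z rk L (p(l := b, h := a))) =
      Z rk L (p(l := a, h := b)) + Z rk L (p(l := b, h := a))"
    and "acts_before l h L \<Longrightarrow> s (Z rk L (p(l := a, h := b))) = Z rk L (p(l := a, h := b))"
    and "acts_before l h L \<Longrightarrow>
      s (x a * Z rk L (p(l := b, h := a)) + x b * Z rk L (p(l := a, h := b))) =
      x a * Z rk L (p(l := b, h := a)) + x b * Z rk L (p(l := a, h := b))"
  using assms unfolding inv2_def Let_def by blast+

text \<open>The sites \<open>a\<close> and \<open>b\<close> are open to the moving particle together
  or not at all. If they are, their joint contribution is \<open>x a * f + x b * g\<close> with
  \<open>g\<close> symmetric and \<open>g = f + x b * D\<close>, that is,
  \<open>(x a + x b) * g - x a * x b * D\<close>.\<close>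

lemma inv0_step:
  assumes "inv0 rk R" "inv1 rk R"
  shows "inv0 rk (c # R)"
  unfolding inv0_def
proof (intro allI impI, elim conjE)
  fix p assume ab: "a \<notin> p ` set (c # R)" "b \<notin> p ` set (c # R)"
  show "s (Z rk (c # R) p) = Z rk (c # R) p"
  proof (cases "c \<in> set R")
    case False
    then show ?thesis using inv0D[OF assms(1), of p] ab by auto
  next
    case True
    define M where "M = {u. may_move rk (set R) p c u}"
    define N where "N = M - {a, b}"
    have fin: "finite M" by (simp add: M_def)
    have pc: "p c \<noteq> a" "p c \<noteq> b" using ab by auto
    have nab: "p d \<noteq> a \<and> p d \<noteq> b" if "d \<in> set R" for d using ab that by auto
    have aM: "a \<in> M \<longleftrightarrow> b \<in> M"
      unfolding M_def mem_Collect_eq by (rule may_move_a_iff_b) (use pc nab in auto)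
    have N: "s (\<Sum>u\<in>N. x u * Z rk R (p(c := u))) = (\<Sum>u\<in>N. x u * Z rk R (p(c := u)))"
    proof (rule sym_weighted_sum)
      fix u assume "u \<in> N"
      then show "u \<noteq> a \<and> u \<noteq> b \<and> s (Z rk R (p(c := u))) = Z rk R (p(c := u))"
        using inv0D[OF assms(1), of "p(c := u)"] ab by (auto simp: N_def)
    qed
    have Zeq: "Z rk (c # R) p = (\<Sum>u\<in>M. x u * Z rk R (p(c := u)))"
      using True by (simp add: M_def)
    show ?thesis
    proof (cases "a \<in> M")
      case False
      then have "M = N" using aM by (auto simp: N_def)
      then show ?thesis using N Zeq by simp
    next
      case aT: True
      then have "M = insert a (insert b N)" using aM by (auto simp: N_def)
      then have eq: "Z rk (c # R) p = x a * Z rk R (p(c := a)) + x b * Z rk R (p(c := b))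
          + (\<Sum>u\<in>N. x u * Z rk R (p(c := u)))"
      proof -
        have "finite N" "a \<notin> insert b N" "b \<notin> N" using fin b_def by (auto simp: N_def)
        then show ?thesis
          unfolding Zeq \<open>M = insert a (insert b N)\<close> by (simp add: add.assoc)
      qed
      have "a \<notin> p ` (set R - {c})" "b \<notin> p ` (set R - {c})" using ab by auto
      note I = inv1D[OF assms(2) True this]
      then obtain D where D: "s D = D" "Z rk R (p(c := b)) = Z rk R (p(c := a)) + x b * D" by blast
      have A: "Z rk R (p(c := a)) = Z rk R (p(c := b)) - x b * D" using D by simp
      show ?thesis
        unfolding eq s_add N s_mult s_a s_b A s_diff I(1) D(1) by (simp add: algebra_simps)
    qed
  qed
qed

text \<open>If the lone particle acts, starting from \<open>b\<close> instead of \<open>a\<close>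
  adds just the option of staying at \<open>b\<close>. If another one acts, the two configurations
  offer the same moves except into whichever of the two sites is free; the resulting pairs of
  neighbours are controlled by \<open>inv2\<close>, with \<open>c\<close> next to act by
  cyclicity.\<close>

lemma inv1_step:
  assumes cs: "cyclic_schedule rk (d # R)" and I0: "inv0 rk R" and I1: "inv1 rk R" and I2: "inv2 rk R"
  shows "inv1 rk (d # R)"
  unfolding inv1_def
proof (intro allI impI, elim conjE)
  fix p c assume c: "c \<in> set (d # R)"
    and ab: "a \<notin> p ` (set (d # R) - {c})" "b \<notin> p ` (set (d # R) - {c})"
  let ?pa = "p(c := a)" and ?pb = "p(c := b)"
  have nab: "p e \<noteq> a \<and> p e \<noteq> b" if "e \<in> set R" "e \<noteq> c" for e using ab that by auto
  have abR: "a \<notin> p ` (set R - {c})" "b \<notin> p ` (set R - {c})" using ab by auto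
  show "s (Z rk (d # R) ?pb) = Z rk (d # R) ?pb \<and>
     (\<exists>D. s D = D \<and> Z rk (d # R) ?pb = Z rk (d # R) ?pa + x b * D)"
  proof (cases "d \<in> set R")
    case dR: False
    show ?thesis
    proof (cases "c = d")
      case True
      \<comment> \<open>The particle \<open>c\<close> is being removed, so its position stops
        mattering and the witness is 0.\<close>
      have "Z rk R ?pa = Z rk R ?pb" by (rule process_sum_cong) (use dR True in auto)
      moreover have "s (Z rk R ?pb) = Z rk R ?pb"
        by (rule inv0D[OF I0]) (use dR True ab in auto)
      ultimately show ?thesis using dR s_zero by auto
    next
      case False
      then have "c \<in> set R" using c by auto
      from inv1D[OF I1 this abR] show ?thesis using dR by simp
    qed
  next
    case dR: True
    show ?thesis
    proof (cases "c = d")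
      case True
      define N where "N = {u. may_move rk (set R) ?pa c u} - {a}"
      have N_less: "u < a" if "u \<in> N" for u using that by (auto simp: N_def may_move_def)
      have Ma: "{u. may_move rk (set R) ?pa c u} = insert a N"
        using nab by (force simp: N_def may_move_def)
      have Mb: "{u. may_move rk (set R) ?pb c u} = insert b (insert a N)"
      proof -
        have 1: "may_move rk (set R) ?pb c b" using nab by (force simp: may_move_def)
        have 2: "may_move rk (set R) ?pb c u \<longleftrightarrow> may_move rk (set R) ?pa c u" if "u \<noteq> b" for u
          unfolding may_move_def using that nab b_def
          by (auto simp: le_Suc_eq)
        have "may_move rk (set R) ?pb c u \<longleftrightarrow> u = b \<or> may_move rk (set R) ?pa c u" for u
          using 1 2[of u] by (cases "u = b") auto
        then show ?thesis unfolding Ma[symmetric] by blast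
      qed
      have fin: "finite N" by (simp add: N_def)
      have sN: "s (\<Sum>u\<in>N. x u * Z rk R (p(c := u))) = (\<Sum>u\<in>N. x u * Z rk R (p(c := u)))"
      proof (rule sym_weighted_sum)
        fix u assume "u \<in> N"
        then have "u < a" by (rule N_less)
        then have u: "u \<noteq> a" "u \<noteq> b" using b_def by auto
        have "a \<notin> (p(c := u)) ` set R" "b \<notin> (p(c := u)) ` set R"
          by (rule upd_avoids; use nab u in blast)+
        from inv0D[OF I0 this] show "u \<noteq> a \<and> u \<noteq> b \<and> s (Z rk R (p(c := u))) = Z rk R (p(c := u))"
          using u by simp
      qed
      have aN: "a \<notin> N" "b \<notin> insert a N" using N_less b_def by fastforce+
      have Za: "Z rk (d # R) ?pa = x a * Z rk R (p(c := a)) + (\<Sum>u\<in>N. x u * Z rk R (p(c := u)))"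
        using dR True Ma aN fin by simp
      \<comment> \<open>The extra term is staying at \<open>b\<close>; so the witness is
        \<open>Z rk R (p(c := b))\<close>, symmetric by hypothesis.\<close>
      have Zb: "Z rk (d # R) ?pb = x b * Z rk R (p(c := b)) + Z rk (d # R) ?pa"
        unfolding Za using dR True Mb aN fin by simp
      have cR: "c \<in> set R" using dR True by simp
      note I = inv1D[OF I1 cR abR]
      then obtain D where D: "s D = D" "Z rk R (p(c := b)) = Z rk R (p(c := a)) + x b * D" by blast
      have A: "Z rk R (p(c := a)) = Z rk R (p(c := b)) - x b * D" using D by simp
      have "s (Z rk (d # R) ?pb) = Z rk (d # R) ?pb"
        unfolding Zb Za A s_add s_mult s_diff s_a s_b I(1) D(1) sN by (simp add: algebra_simps)
      then show ?thesis using Zb I(1) by (metis add.commute)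
    next
      case False
      then have cR: "c \<in> set R" using c by auto
      have pd: "p d \<noteq> a" "p d \<noteq> b" using nab[OF dR] False by auto
      have bef: "acts_before c d R" using cs dR cR False by auto
      define Ma where "Ma = {u. may_move rk (set R) ?pa d u}"
      define Mb where "Mb = {u. may_move rk (set R) ?pb d u}"
      define N where "N = Ma - {a, b}"
      have aMa: "a \<notin> Ma" using cR False by (auto simp: Ma_def may_move_def)
      have bMb: "b \<notin> Mb" using cR False by (auto simp: Mb_def may_move_def)
      have Neq: "N = Mb - {a, b}"
      proof -
        have "may_move rk (set R) ?pa d u \<longleftrightarrow> may_move rk (set R) ?pb d u" if "u \<noteq> a" "u \<noteq> b" for u
        proof -
          have "(u \<le> a \<and> a \<le> p d) = (u \<le> b \<and> b \<le> p d)" using that pd b_def by linarith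
          then show ?thesis
            unfolding may_move_upd_other[OF False cR] using that by simp
        qed
        then show ?thesis unfolding N_def Ma_def Mb_def by blast
      qed
      have finN: "finite N" by (simp add: N_def Ma_def)
      have twist: "p(c := v, d := u) = p(d := u, c := v)" for u v
        using False by (rule fun_upd_twist)
      let ?R = "\<lambda>q. \<Sum>u\<in>N. x u * Z rk R (q(d := u))"
      have tw: "?R ?pa = (\<Sum>u\<in>N. x u * Z rk R (p(d := u, c := a)))"
               "?R ?pb = (\<Sum>u\<in>N. x u * Z rk R (p(d := u, c := b)))"
        unfolding twist by (rule refl)+
      have I1': "s (Z rk R (p(d := u, c := b))) = Z rk R (p(d := u, c := b)) \<and>
         (\<exists>D. s D = D \<and> Z rk R (p(d := u, c := b)) = Z rk R (p(d := u, c := a)) + x b * D)"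
        if "u \<in> N" for u
      proof -
        have "a \<notin> (p(d := u)) ` (set R - {c})" "b \<notin> (p(d := u)) ` (set R - {c})"
          using that nab by (auto simp: N_def)
        then show ?thesis using inv1D[OF I1 cR] by blast
      qed
      have Rb: "s (?R ?pb) = ?R ?pb"
        unfolding tw by (rule sym_weighted_sum) (use I1' in \<open>auto simp: N_def\<close>)
      have "\<exists>D. s D = D \<and> ?R ?pb = ?R ?pa + x b * D"
        unfolding tw by (rule xi_pair_weighted_sum) (use I1' in \<open>auto simp: N_def\<close>)
      then obtain D where D: "s D = D" "?R ?pb = ?R ?pa + x b * D" by blast
      have Zae: "Z rk (d # R) ?pa = (\<Sum>u\<in>Ma. x u * Z rk R (?pa(d := u)))"
        and Zbe: "Z rk (d # R) ?pb = (\<Sum>u\<in>Mb. x u * Z rk R (?pb(d := u)))"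
        using dR by (simp_all add: Ma_def Mb_def)
      have abcd: "a \<notin> p ` (set R - {c, d})" "b \<notin> p ` (set R - {c, d})"
        "a \<notin> p ` (set R - {d, c})" "b \<notin> p ` (set R - {d, c})" using ab by auto
      have rkne: "rk c \<noteq> rk d"
        using inj_onD[OF cyclic_schedule_inj[OF cs], of c d] cR dR False by auto
      show ?thesis
      proof (cases "rk d < rk c")
        case dc: True
        \<comment> \<open>Since \<open>d\<close> may jump over \<open>c\<close>, the obstacle
          \<open>c\<close> only occupies its own site.\<close>
        have iff: "b \<in> Ma \<longleftrightarrow> a \<in> Mb"
        proof -
          have "may_move rk (set R - {c}) p d a \<longleftrightarrow> may_move rk (set R - {c}) p d b"
            by (rule may_move_a_iff_b) (use pd nab in auto)
          then show ?thesis
            unfolding Ma_def Mb_def mem_Collect_eq may_move_upd_other[OF False cR]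
            using dc b_def by auto
        qed
        note I = inv2D[OF I2 dR cR dc abcd(3,4)]
        obtain S1 where S1: "s S1 = S1" "Z rk R (p(d := a, c := b)) = x b * S1"
          using I(1) bef by blast
        have f1: "?pb(d := a) = p(d := a, c := b)" and f2: "?pa(d := b) = p(d := b, c := a)"
          by (rule twist)+
        show ?thesis
        proof (cases "b \<in> Ma")
          case False
          then have "Ma = N" "Mb = N" using aMa bMb iff Neq by (auto simp: N_def)
          then show ?thesis using Rb D unfolding Zae Zbe by auto
        next
          case True
          then have "Ma = insert b N" "Mb = insert a N" using aMa bMb iff Neq by (auto simp: N_def)
          moreover have "a \<notin> N" "b \<notin> N" by (auto simp: N_def)
          ultimately have Za: "Z rk (d # R) ?pa = x b * Z rk R (p(d := b, c := a)) + ?R ?pa"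
            and Zb: "Z rk (d # R) ?pb = x a * (x b * S1) + ?R ?pb"
            unfolding Zae Zbe using finN f1 f2 S1 by simp_all
          define S where "S = Z rk R (p(d := a, c := b)) + Z rk R (p(d := b, c := a))"
          have S: "s S = S" using I(2) bef S_def by simp
          have Z2: "Z rk R (p(d := b, c := a)) = S - x b * S1" using S1 S_def by simp
          have "s (Z rk (d # R) ?pb) = Z rk (d # R) ?pb"
            unfolding Zb s_add s_mult s_a s_b S1 Rb by (simp add: algebra_simps)
          \<comment> \<open>The moves into the free site change the difference by
            \<open>x a * x b * S1 - x b * (S - x b * S1)\<close>, which is
            \<open>x b * ((x a + x b) * S1 - S)\<close>.\<close>
          moreover have "s (D + (x a + x b) * S1 - S) = D + (x a + x b) * S1 - S"
            unfolding s_add s_diff s_mult s_a s_b S1 S D by (simp add: algebra_simps)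
          moreover have "Z rk (d # R) ?pb = Z rk (d # R) ?pa + x b * (D + (x a + x b) * S1 - S)"
            unfolding Za Zb Z2 D(2) by (simp add: algebra_simps)
          ultimately show ?thesis by blast
        qed
      next
        case False
        then have cd: "rk c < rk d" using rkne by simp
        \<comment> \<open>To reach \<open>a\<close>, the particle \<open>d\<close> would have to
          jump over \<open>c\<close> at \<open>b\<close>, which has lower priority. Hence only the
          configuration with \<open>c\<close> at \<open>a\<close> can gain a term, and that term is
          \<open>x b\<close> times something symmetric.\<close>
        have aMb: "a \<notin> Mb"
        proof
          assume "a \<in> Mb"
          then have "a \<le> p d" "\<not> (a \<le> b \<and> b \<le> p d)"
            using cd cR \<open>c \<noteq> d\<close> by (auto simp: Mb_def may_move_def)
          then show False using pd b_def by linarith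
        qed
        then have MbN: "Mb = N" using bMb Neq by auto
        note I = inv2D[OF I2 cR dR cd abcd(1,2)]
        show ?thesis
        proof (cases "b \<in> Ma")
          case False
          then have "Ma = N" using aMa by (auto simp: N_def)
          then show ?thesis using Rb D MbN unfolding Zae Zbe by auto
        next
          case True
          then have "Ma = insert b N" using aMa by (auto simp: N_def)
          moreover have "b \<notin> N" by (auto simp: N_def)
          ultimately have Za: "Z rk (d # R) ?pa = x b * Z rk R (?pa(d := b)) + ?R ?pa"
            unfolding Zae using finN by simp
          have Zb: "Z rk (d # R) ?pb = ?R ?pb" unfolding Zbe MbN ..
          have "Z rk (d # R) ?pb = Z rk (d # R) ?pa + x b * (D - Z rk R (?pa(d := b)))"
            unfolding Za Zb D(2) by (simp add: algebra_simps)
          moreover have "s (D - Z rk R (?pa(d := b))) = D - Z rk R (?pa(d := b))"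
            unfolding s_diff using I(3) bef D(1) by simp
          ultimately show ?thesis using Rb Zb by auto
        qed
      qed
    qed
  qed
qed

text \<open>The relations for \<open>h\<close> next follow from those for \<open>l\<close> next and
  vice versa. If \<open>h\<close> acts, it is stuck in the first arrangement, which produces the
  factor \<open>x b\<close>; the weighted sum \<open>x a * f2 + x b * f1\<close> of the later stage
  becomes the plain sum of the earlier one. If \<open>l\<close> acts, its stay at \<open>a\<close>
  multiplies \<open>x b * E\<close> by \<open>x a\<close>, which restores symmetry.\<close>

lemma inv2_step:
  assumes cs: "cyclic_schedule rk (e # R)" and I0: "inv0 rk R" and I1: "inv1 rk R" and I2: "inv2 rk R"
  shows "inv2 rk (e # R)"
  unfolding inv2_def Let_def
proof (intro allI impI, elim conjE)
  fix p l h assume l: "l \<in> set (e # R)" and h: "h \<in> set (e # R)" and lh: "rk l < rk h"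
    and ab: "a \<notin> p ` (set (e # R) - {l, h})" "b \<notin> p ` (set (e # R) - {l, h})"
  let ?L = "e # R"
  let ?p1 = "p(l := a, h := b)" and ?p2 = "p(l := b, h := a)"
  let ?goal = "(acts_before h l ?L \<longrightarrow> (\<exists>D. s D = D \<and> Z rk ?L ?p1 = x b * D) \<and>
        s (Z rk ?L ?p1 + Z rk ?L ?p2) = Z rk ?L ?p1 + Z rk ?L ?p2) \<and>
      (acts_before l h ?L \<longrightarrow> s (Z rk ?L ?p1) = Z rk ?L ?p1 \<and>
        s (x a * Z rk ?L ?p2 + x b * Z rk ?L ?p1) = x a * Z rk ?L ?p2 + x b * Z rk ?L ?p1)"
  have ne: "l \<noteq> h" using lh by auto
  have nab: "p d \<noteq> a \<and> p d \<noteq> b" if "d \<in> set R" "d \<noteq> l" "d \<noteq> h" for d using ab that by auto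
  have abR: "a \<notin> p ` (set R - {l, h})" "b \<notin> p ` (set R - {l, h})" using ab by auto
  consider "e \<noteq> l" "e \<noteq> h" | "e = l" | "e = h" by blast
  then show ?goal
  proof cases
    case 1
    then have lR: "l \<in> set R" and hR: "h \<in> set R" using l h by auto
    show ?thesis
    proof (cases "e \<in> set R")
      case False
      then show ?thesis using 1 inv2D[OF I2 lR hR lh abR] by simp
    next
      case eR: True
      define M where "M = {u. may_move rk (set R) ?p1 e u}"
      have pe: "p e \<noteq> a" "p e \<noteq> b" using nab[OF eR 1] by auto
      have h': "h \<in> set R - {l}" using hR ne by simp
      have *: "may_move rk (set R) (p(l := v, h := w)) e u \<longleftrightarrow>
        may_move rk (set R - {l} - {h}) p e u \<and>
        (w \<noteq> u \<and> (rk h < rk e \<longrightarrow> \<not> (u \<le> w \<and> w \<le> p e))) \<and>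
        (v \<noteq> u \<and> (rk l < rk e \<longrightarrow> \<not> (u \<le> v \<and> v \<le> p e)))" for u v w
      proof -
        have "p(l := v, h := w) = p(h := w, l := v)" using ne by (rule fun_upd_twist)
        then show ?thesis
          using may_move_upd_other[OF 1(1)[symmetric] lR, of rk "p(h := w)" v u]
            may_move_upd_other[OF 1(2)[symmetric] h', of rk p w u] 1
            by (simp only: fun_upd_other simp_thms not_False_eq_True) blast
      qed
      have Mab: "a \<notin> M" "b \<notin> M" unfolding M_def mem_Collect_eq * by simp_all
      have M2: "{u. may_move rk (set R) ?p2 e u} = M"
      proof -
        have "may_move rk (set R) ?p1 e u \<longleftrightarrow> may_move rk (set R) ?p2 e u" for u
        proof (cases "u = a \<or> u = b")
          case True
          then show ?thesis unfolding * by blast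
        next
          case False
          \<comment> \<open>Neither end of the jump of \<open>e\<close> is \<open>a\<close> or
            \<open>b\<close>, so the jump passes over both sites or over neither; it does not matter
            which partner sits where.\<close>
          have eq: "(u \<le> a \<and> a \<le> p e) = (u \<le> b \<and> b \<le> p e)" using pe False b_def by linarith
          show ?thesis unfolding * using eq False by blast
        qed
        then show ?thesis unfolding M_def by blast
      qed
      have Z1: "Z rk ?L ?p1 = (\<Sum>u\<in>M. x u * Z rk R (p(e := u, l := a, h := b)))"
        and Z2: "Z rk ?L ?p2 = (\<Sum>u\<in>M. x u * Z rk R (p(e := u, l := b, h := a)))"
      proof -
        have t: "p(l := v, h := w, e := u) = p(e := u, l := v, h := w)" for u v w
          using 1 by (auto simp: fun_eq_iff)
        show "Z rk ?L ?p1 = (\<Sum>u\<in>M. x u * Z rk R (p(e := u, l := a, h := b)))"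
          "Z rk ?L ?p2 = (\<Sum>u\<in>M. x u * Z rk R (p(e := u, l := b, h := a)))"
          using eR by (simp_all add: t M2 del: fun_upd_apply) (simp only: M_def)
      qed
      have abu: "a \<notin> (p(e := u)) ` (set R - {l, h})" "b \<notin> (p(e := u)) ` (set R - {l, h})"
        if "u \<in> M" for u
        using that nab Mab by auto
      note I = inv2D[OF I2 lR hR lh abu]
      show ?thesis
      proof (intro conjI impI)
        assume "acts_before h l ?L"
        then have bef: "acts_before h l R" using 1 by auto
        have "\<exists>D. s D = D \<and> Z rk ?L ?p1 = (\<Sum>u\<in>M. x u * 0) + x b * D"
          unfolding Z1 by (rule xi_pair_weighted_sum) (use I(1) bef Mab in auto)
        then show "\<exists>D. s D = D \<and> Z rk ?L ?p1 = x b * D" by simp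
        have "Z rk ?L ?p1 + Z rk ?L ?p2 = (\<Sum>u\<in>M. x u *
          (Z rk R (p(e := u, l := a, h := b)) + Z rk R (p(e := u, l := b, h := a))))"
          unfolding Z1 Z2 by (simp add: sum.distrib algebra_simps)
        also have "s \<dots> = \<dots>" by (rule sym_weighted_sum) (use I(2) bef Mab in auto)
        finally show "s (Z rk ?L ?p1 + Z rk ?L ?p2) = Z rk ?L ?p1 + Z rk ?L ?p2" 
          unfolding Z1 Z2 by (simp add: sum.distrib algebra_simps)
      next
        assume "acts_before l h ?L"
        then have bef: "acts_before l h R" using 1 by auto
        show "s (Z rk ?L ?p1) = Z rk ?L ?p1"
          unfolding Z1 by (rule sym_weighted_sum) (use I(3) bef Mab in auto)
        have eq: "x a * Z rk ?L ?p2 + x b * Z rk ?L ?p1 = (\<Sum>u\<in>M. x u *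
          (x a * Z rk R (p(e := u, l := b, h := a)) + x b * Z rk R (p(e := u, l := a, h := b))))"
          unfolding Z1 Z2 by (simp add: sum.distrib sum_distrib_left algebra_simps)
        show "s (x a * Z rk ?L ?p2 + x b * Z rk ?L ?p1) = x a * Z rk ?L ?p2 + x b * Z rk ?L ?p1"
          unfolding eq by (rule sym_weighted_sum) (use I(4) bef Mab in auto)
      qed
    qed
  next
    case 2
    have hR: "h \<in> set R" using h 2 ne by auto
    have nbef: "\<not> acts_before h l ?L" "acts_before l h ?L" using 2 ne by auto
    have abh: "a \<notin> (p(l := u)) ` (set R - {h})" "b \<notin> (p(l := u)) ` (set R - {h})"
      if "l \<in> set R \<longrightarrow> u \<noteq> a \<and> u \<noteq> b" for u
      using that nab by auto
    show ?thesis
    proof (cases "l \<in> set R")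
      case False
      \<comment> \<open>After the removal of \<open>l\<close> the particle \<open>h\<close> is
        alone, and the claim reduces to \<open>inv1\<close>.\<close>
      have e1: "Z rk ?L ?p1 = Z rk R (p(h := b))" and e2: "Z rk ?L ?p2 = Z rk R (p(h := a))"
        using 2 False by (auto intro!: process_sum_cong)
      have abh': "a \<notin> p ` (set R - {h})" "b \<notin> p ` (set R - {h})" using nab False by auto
      note I = inv1D[OF I1 hR abh']
      then obtain D where D: "s D = D" "Z rk R (p(h := b)) = Z rk R (p(h := a)) + x b * D" by blast
      have A: "Z rk R (p(h := a)) = Z rk R (p(h := b)) - x b * D" using D by simp
      have "s (x a * Z rk ?L ?p2 + x b * Z rk ?L ?p1) = x a * Z rk ?L ?p2 + x b * Z rk ?L ?p1"
        unfolding e1 e2 A s_add s_mult s_diff s_a s_b I(1) D(1) by (simp add: algebra_simps)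
      moreover have "s (Z rk ?L ?p1) = Z rk ?L ?p1" unfolding e1 by (rule I(1))
      ultimately show ?thesis using nbef by blast
    next
      case lR: True
      have bef: "acts_before h l R" using cs 2 lR hR ne by auto
      define N where "N = {u. may_move rk (set R) ?p1 l u} - {a}"
      have N_less: "u < a" if "u \<in> N" for u using that ne by (auto simp: N_def may_move_def)
      have M1: "{u. may_move rk (set R) ?p1 l u} = insert a N"
        using nab lh ne b_def by (force simp: N_def may_move_def)
      \<comment> \<open>From \<open>b\<close> the particle \<open>l\<close> can jump over
        \<open>h\<close> at \<open>a\<close>, so the sites below \<open>a\<close> are the same in
        both arrangements.\<close>
      have M2: "{u. may_move rk (set R) ?p2 l u} = insert b N"
      proof -
        have 1: "may_move rk (set R) ?p2 l b" using nab ne lh b_def by (force simp: may_move_def)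
        have 2: "\<not> may_move rk (set R) ?p2 l a" using hR ne by (auto simp: may_move_def)
        have eq: "may_move rk (set R) ?p2 l u \<longleftrightarrow> may_move rk (set R) ?p1 l u" if "u \<noteq> a" "u \<noteq> b" for u
        proof -
          have *: "d \<in> set R - {l} \<Longrightarrow> d \<noteq> h \<Longrightarrow> (p d \<le> b) = (p d \<le> a)" for d
            using nab[of d] b_def by auto
          have **: "u \<le> b \<longleftrightarrow> u \<le> a" using that b_def by auto
          show ?thesis unfolding may_move_def using that ne lh * **
            by (simp add: Ball_def)
        qed
        have aN: "a \<notin> N" "b \<notin> N" using N_less b_def by fastforce+
        have "may_move rk (set R) ?p2 l u \<longleftrightarrow> u = b \<or> u \<in> N" for u
        proof -
          consider "u = a" | "u = b" | "u \<noteq> a" "u \<noteq> b" by blast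
          then show ?thesis
          proof cases
            case 3
            then have "may_move rk (set R) ?p2 l u \<longleftrightarrow> u \<in> {u. may_move rk (set R) ?p1 l u}"
              using eq[of u] by simp
            then show ?thesis using 3 unfolding M1 by simp
          qed (use 1 2 aN b_def in auto)
        qed
        then show ?thesis by blast
      qed
      have aN: "a \<notin> N" "b \<notin> N" using N_less b_def by fastforce+
      have fin: "finite N" by (simp add: N_def)
      have t: "p(l := v, h := w, l := u) = p(l := u, h := w)" for u v w
        using ne by (auto simp: fun_eq_iff)
      have Z1: "Z rk ?L ?p1 = x a * Z rk R ?p1 + (\<Sum>u\<in>N. x u * Z rk R (p(l := u, h := b)))"
        using 2 lR M1 aN fin by (simp add: t del: fun_upd_apply)
      have Z2: "Z rk ?L ?p2 = x b * Z rk R ?p2 + (\<Sum>u\<in>N. x u * Z rk R (p(l := u, h := a)))"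
        using 2 lR M2 aN fin by (simp add: t del: fun_upd_apply)
      let ?X = "\<Sum>u\<in>N. x u * Z rk R (p(l := u, h := b))"
      let ?Xa = "\<Sum>u\<in>N. x u * Z rk R (p(l := u, h := a))"
      have uN: "l \<in> set R \<longrightarrow> u \<noteq> a \<and> u \<noteq> b" if "u \<in> N" for u using aN that by auto
      note I = inv1D[OF I1 hR abh, OF uN uN]
      have X: "s ?X = ?X"
        by (rule sym_weighted_sum) (use I(1) aN in auto)
      have "\<exists>D. s D = D \<and> ?X = ?Xa + x b * D"
        by (rule xi_pair_weighted_sum) (use I(2) aN in auto)
      then obtain D where D: "s D = D" "?X = ?Xa + x b * D" by blast
      have Xa: "?Xa = ?X - x b * D" using D by simp
      note J = inv2D[OF I2 lR hR lh abR]
      obtain E where E: "s E = E" "Z rk R ?p1 = x b * E" using J(1) bef by blast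
      define S where "S = Z rk R ?p1 + Z rk R ?p2"
      have S: "s S = S" using J(2) bef S_def by simp
      have Z2': "Z rk R ?p2 = S - x b * E" using S_def E by simp
      have "s (Z rk ?L ?p1) = Z rk ?L ?p1"
        unfolding Z1 E s_add s_mult s_a s_b X by (simp add: algebra_simps)
      moreover have "s (x a * Z rk ?L ?p2 + x b * Z rk ?L ?p1) = x a * Z rk ?L ?p2 + x b * Z rk ?L ?p1"
        unfolding Z1 Z2 Z2' E Xa s_add s_diff s_mult s_a s_b X D(1) S by (simp add: algebra_simps)
      ultimately show ?thesis using nbef by blast
    qed
  next
    case 3
    have lR: "l \<in> set R" using l 3 ne by auto
    \<comment> \<open>Removal follows the ranks: \<open>h\<close> cannot leave before
      \<open>l\<close>.\<close>
    have hR: "h \<in> set R" using cs 3 lR lh by (auto split: if_splits dest: less_asym')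
    have nbef: "\<not> acts_before l h ?L" "acts_before h l ?L" using 3 ne by auto
    have bef: "acts_before l h R" using cs 3 lR hR ne by auto
    define N where "N = {u. may_move rk (set R) ?p2 h u} - {a}"
    have N_less: "u < a" if "u \<in> N" for u using that ne by (auto simp: N_def may_move_def)
    have M1: "{u. may_move rk (set R) ?p1 h u} = {b}"
    proof -
      have "may_move rk (set R) ?p1 h b" using nab ne lh b_def by (force simp: may_move_def)
      moreover have "u = b" if m: "may_move rk (set R) ?p1 h u" for u
      proof -
        have "u \<le> b" using m by (simp add: may_move_def)
        moreover have "a \<noteq> u \<and> \<not> (u \<le> a \<and> a \<le> b)" 
          using m ne lR lh unfolding may_move_def by auto
        ultimately show ?thesis using b_def by auto
      qed
      ultimately show ?thesis by auto
    qed
    have M2: "{u. may_move rk (set R) ?p2 h u} = insert a N"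
      using nab lh ne b_def by (force simp: N_def may_move_def)
    have aN: "a \<notin> N" "b \<notin> N" using N_less b_def by fastforce+
    have fin: "finite N" by (simp add: N_def)
    have Z1: "Z rk ?L ?p1 = x b * Z rk R ?p1"
      using 3 hR M1 by simp
    have Z2: "Z rk ?L ?p2 = x a * Z rk R ?p2 + (\<Sum>u\<in>N. x u * Z rk R (p(h := u, l := b)))"
    proof -
      have t: "p(l := v, h := u) = p(h := u, l := v)" for u v
        using ne by (auto simp: fun_eq_iff)
      show ?thesis using 3 hR M2 aN fin by (simp add: t del: fun_upd_apply)
    qed
    let ?X = "\<Sum>u\<in>N. x u * Z rk R (p(h := u, l := b))"
    have X: "s ?X = ?X"
    proof (rule sym_weighted_sum)
      fix u assume u: "u \<in> N"
      then have "a \<notin> (p(h := u)) ` (set R - {l})" "b \<notin> (p(h := u)) ` (set R - {l})"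
        using nab aN by auto
      from inv1D(1)[OF I1 lR this] show "u \<noteq> a \<and> u \<noteq> b \<and>
        s (Z rk R (p(h := u, l := b))) = Z rk R (p(h := u, l := b))"
        using u aN by auto
    qed
    note J = inv2D[OF I2 lR hR lh abR]
    have j: "s (Z rk R ?p1) = Z rk R ?p1" using J(3) bef by simp
    \<comment> \<open>The bracket is exactly the combination that is symmetric when \<open>l\<close>
      is next.\<close>
    have "Z rk ?L ?p1 + Z rk ?L ?p2 = (x a * Z rk R ?p2 + x b * Z rk R ?p1) + ?X"
      unfolding Z1 Z2 by (simp add: algebra_simps)
    then have "s (Z rk ?L ?p1 + Z rk ?L ?p2) = Z rk ?L ?p1 + Z rk ?L ?p2"
      using J(4)[OF bef] X by (simp only: s_add[of "x a * Z rk R ?p2 + x b * Z rk R ?p1"])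
    then show ?thesis using nbef Z1 j by blast
  qed
qed

lemma invariants:
  "cyclic_schedule rk L \<Longrightarrow> inv0 rk L \<and> inv1 rk L \<and> inv2 rk L"
proof (induction L)
  case Nil
  then show ?case by (simp add: inv0_def inv1_def inv2_def s_one)
next
  case (Cons c R)
  then show ?case using inv0_step inv1_step inv2_step by auto
qed

text \<open>From \<open>f' = x b * D\<close> and the symmetry of \<open>f + f'\<close> one gets
  \<open>s f = f + f' - x a * D\<close>. The conclusion is the cleared-denominator form of the
  divided difference of \<open>f\<close> being \<open>f + f'\<close>.\<close>

theorem xi_process_sum:
  assumes "cyclic_schedule rk L" "l \<in> set L" "h \<in> set L" "rk l < rk h" "acts_before h l L"
    "a \<notin> p ` (set L - {l, h})" "b \<notin> p ` (set L - {l, h})"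
  defines "f \<equiv> process_sum x rk L (p(l := b, h := a))"
    and "f' \<equiv> process_sum x rk L (p(l := a, h := b))"
  shows "(x a - x b) * (f + f') = x a * f - x b * s f"
proof -
  note I = inv2D[OF conjunct2[OF conjunct2[OF invariants[OF assms(1)]]] assms(2-4,6,7)]
  obtain D where D: "s D = D" "f' = x b * D" using I(1) assms(5) f'_def by blast
  have "s (f' + f) = f' + f" using I(2) assms(5) f_def f'_def by simp
  then have "s f = f' + f - s f'" by (simp add: s_add algebra_simps)
  moreover have "s f' = x a * D" by (simp add: D s_mult s_b)
  ultimately have sf: "s f = x b * D + f - x a * D" by (simp only: D(2))
  show ?thesis unfolding sf D(2) by (simp add: algebra_simps)
qed

end

section \<open>Exchanging two adjacent columns\<close>

text \<open>The schedules of \<open>\<alpha>\<close> and of \<open>s\<^sub>i \<alpha>\<close>, up to renaming: in each round the taller column \<open>t\<close> acts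
  immediately before the shorter column \<open>s\<close> in the first and immediately after it in the second.\<close>

inductive round_swap :: "(nat \<Rightarrow> nat) \<Rightarrow> nat \<Rightarrow> nat \<Rightarrow> nat list \<Rightarrow> nat list \<Rightarrow> bool" for rk s t where
  last: "s \<notin> set R \<Longrightarrow> t \<in> set R \<Longrightarrow> (\<And>d. d \<in> set R \<Longrightarrow> rk s < rk d) \<Longrightarrow>
    round_swap rk s t (t # s # R) (s # t # R)"
| pair: "round_swap rk s t R R' \<Longrightarrow> round_swap rk s t (t # s # R) (s # t # R')"
| other: "round_swap rk s t R R' \<Longrightarrow> e \<noteq> s \<Longrightarrow> e \<noteq> t \<Longrightarrow> (e \<notin> set R \<Longrightarrow> rk e < rk s) \<Longrightarrow>
    round_swap rk s t (e # R) (e # R')"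

lemma round_swap_set: "round_swap rk s t L L' \<Longrightarrow> set L' = set L \<and> s \<in> set L \<and> t \<in> set L"
  by (induction rule: round_swap.induct) auto

text \<open>Only intermediate ranks distinguish the two columns: a particle ranked below both blocks
  both, one ranked above both blocks neither, and a medium one blocks \<open>t\<close> but not
  \<open>s\<close>.\<close>

definition medium_between ::
    "(nat \<Rightarrow> nat) \<Rightarrow> nat set \<Rightarrow> nat \<Rightarrow> nat \<Rightarrow> (nat \<Rightarrow> nat) \<Rightarrow> nat \<Rightarrow> nat \<Rightarrow> bool" where
  "medium_between rk A s t p i j \<longleftrightarrow>
     (\<exists>k\<in>A - {s, t}. rk s < rk k \<and> rk k < rk t \<and> i < p k \<and> p k < j)"

lemma sum_Sigma_pairs:
  fixes f :: "nat \<Rightarrow> nat \<Rightarrow> 'r::comm_ring_1"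
  assumes "finite {u. P u}" "\<And>u. finite {v. Q u v}"
  shows "(\<Sum>u | P u. x u * (\<Sum>v | Q u v. x v * f u v)) = (\<Sum>(u, v) | P u \<and> Q u v. x u * x v * f u v)"
proof -
  have "{(u, v). P u \<and> Q u v} = Sigma {u. P u} (\<lambda>u. {v. Q u v})" by auto
  then show ?thesis
    using assms by (simp add: sum.Sigma sum_distrib_left mult.assoc)
qed

text \<open>With the schedule \<open>L'\<close>, \<open>s\<close> stays to the left of \<open>t\<close> forever.  With \<open>L\<close>
  the two may start in either order, but \<open>t\<close> cannot jump over a particle of intermediate priority;
  once such a particle separates the two, the second order contributes nothing.\<close>

lemma process_sum_round_swap:
  assumes "round_swap rk s t L L'" "rk s < rk t" "inj_on rk (set L)" "i < j"
    "\<And>d. d \<in> set L \<Longrightarrow> d \<noteq> s \<Longrightarrow> d \<noteq> t \<Longrightarrow> p d \<noteq> i \<and> p d \<noteq> j"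
  shows "process_sum x rk L' (p(s := i, t := j)) = process_sum x rk L (p(s := i, t := j)) +
    (if medium_between rk (set L) s t p i j then 0 else process_sum x rk L (p(s := j, t := i)))"
  using assms
proof (induction arbitrary: p i j rule: round_swap.induct)
  case (last R)
  have st: "s \<noteq> t" using last.prems by auto
  define T where "T w = {w'. may_move rk (set R) (p(t := w)) t w'}" for w
  have Tiff: "w' \<in> T w \<longleftrightarrow> w' \<le> w \<and> (\<forall>d\<in>set R - {t}. p d \<noteq> w' \<and> (rk d < rk t \<longrightarrow> \<not> (w' \<le> p d \<and> p d \<le> w)))" for w w'
    unfolding T_def may_move_def by simp
  have Tle: "w' \<le> w" if "w' \<in> T w" for w w' using that by (simp add: Tiff)
  have finT: "finite (T w)" for w by (simp add: T_def)
  let ?f = "\<lambda>w. x w * process_sum x rk R (p(t := w))"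
  have c1: "process_sum x rk R (p(s := v, t := w)) = process_sum x rk R (p(t := w))" for v w
    by (rule process_sum_cong) (use last.hyps in auto)
  have mm: "may_move rk (insert s (set R)) (p(s := v, t := w)) t w' \<longleftrightarrow>
      w' \<in> T w \<and> v \<noteq> w' \<and> \<not> (w' \<le> v \<and> v \<le> w)" for v w w'
  proof -
    have "p(s := v, t := w) = (p(t := w))(s := v)" using st by (rule fun_upd_twist)
    moreover have "insert s (set R) - {s} = set R" using last.hyps by auto
    ultimately show ?thesis
      using may_move_upd_other[OF st, of "insert s (set R)" rk "p(t := w)" v w'] last.prems
      by (simp add: T_def)
  qed
  \<comment> \<open>Here \<open>s\<close> is gone before \<open>t\<close> acts and does not obstruct
    it.\<close>
  have L': "process_sum x rk (s # t # R) (p(s := i, t := j)) = sum ?f (T j)"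
  proof -
    have "may_move rk (set R) (p(s := i, t := j)) t w' \<longleftrightarrow> w' \<in> T j" for w'
      unfolding Tiff may_move_def using last.hyps by auto
    then have "{w'. may_move rk (set R) (p(s := i, t := j)) t w'} = T j" by blast
    then show ?thesis using last.hyps st by (simp add: c1)
  qed
  have L: "process_sum x rk (t # s # R) (p(s := v, t := w)) =
      sum ?f {w' \<in> T w. v \<noteq> w' \<and> \<not> (w' \<le> v \<and> v \<le> w)}" for v w
    using last.hyps st by (simp add: c1 Collect_cong[OF mm] del: fun_upd_apply)
  have L1: "process_sum x rk (t # s # R) (p(s := i, t := j)) = sum ?f {w' \<in> T j. i < w'}"
    unfolding L by (rule sum.cong) (use \<open>i < j\<close> in auto)
  have L2: "process_sum x rk (t # s # R) (p(s := j, t := i)) = sum ?f (T i)"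
    unfolding L by (rule sum.cong) (use \<open>i < j\<close> in \<open>auto dest: Tle\<close>)
  have pd: "p d \<noteq> i \<and> p d \<noteq> j" if "d \<in> set R - {t}" for d
    using last.prems(4)[of d] that last.hyps by auto
  show ?case
  proof (cases "medium_between rk (set (t # s # R)) s t p i j")
    case True
    then obtain k where k: "k \<in> set R - {t}" "rk k < rk t" "i < p k" "p k < j"
      by (auto simp: medium_between_def)
    have "i < w'" if "w' \<in> T j" for w'
    proof -
      have "\<not> (w' \<le> p k \<and> p k \<le> j)" using that k unfolding Tiff by blast
      then show ?thesis using k by linarith
    qed
    then have "{w' \<in> T j. i < w'} = T j" by blast
    then show ?thesis unfolding L' L1 using True by simp
  next
    case False
    \<comment> \<open>All remaining particles rank above \<open>s\<close>, so those that could stop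
      \<open>t\<close> between \<open>j\<close> and \<open>i\<close> are medium, and there are none.
      The moves of \<open>t\<close> lost in the first arrangement are thus those available in the
      second.\<close>
    have "w' \<in> T j \<and> w' \<le> i \<longleftrightarrow> w' \<in> T i" for w'
    proof -
      have "(p d \<noteq> w' \<and> (rk d < rk t \<longrightarrow> \<not> (w' \<le> p d \<and> p d \<le> j))) \<longleftrightarrow>
        (p d \<noteq> w' \<and> (rk d < rk t \<longrightarrow> \<not> (w' \<le> p d \<and> p d \<le> i)))"
        if d: "d \<in> set R - {t}" for d
      proof -
        have "rk s < rk d" using last.hyps d by auto
        then have "rk d < rk t \<Longrightarrow> \<not> (i < p d \<and> p d < j)"
          using False d last.hyps by (auto simp: medium_between_def)
        then show ?thesis using pd[OF d] \<open>i < j\<close> by linarith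
      qed
      then show ?thesis unfolding Tiff using \<open>i < j\<close> by auto
    qed
    then have Ti: "T i = {w' \<in> T j. \<not> i < w'}" unfolding not_less by blast
    have "T j = {w' \<in> T j. i < w'} \<union> T i" "{w' \<in> T j. i < w'} \<inter> T i = {}"
      unfolding Ti by blast+
    then have "sum ?f (T j) = sum ?f {w' \<in> T j. i < w'} + sum ?f (T i)"
      using finT by (metis (no_types, lifting) finite_Un sum.union_disjoint)
    then show ?thesis unfolding L' L1 L2 using False by simp
  qed
next
  case (pair R R')
  note RR = round_swap_set[OF pair.hyps]
  have st: "s \<noteq> t" using pair.prems by auto
  define S where "S v = {v'. may_move rk (set R - {t}) (p(s := v)) s v'}" for v
  define T where "T w = {w'. may_move rk (set R - {s}) (p(t := w)) t w'}" for w
  define O' where "O' = set R - {s, t}"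
  have Siff: "v' \<in> S v \<longleftrightarrow> v' \<le> v \<and> (\<forall>d\<in>O'. p d \<noteq> v' \<and> (rk d < rk s \<longrightarrow> \<not> (v' \<le> p d \<and> p d \<le> v)))" for v v'
    unfolding S_def may_move_def O'_def by auto
  have Tiff: "w' \<in> T w \<longleftrightarrow> w' \<le> w \<and> (\<forall>d\<in>O'. p d \<noteq> w' \<and> (rk d < rk t \<longrightarrow> \<not> (w' \<le> p d \<and> p d \<le> w)))" for w w'
    unfolding T_def may_move_def O'_def by auto
  have Sle: "v' \<le> v" if "v' \<in> S v" for v v' using that by (simp add: Siff)
  have Tle: "w' \<le> w" if "w' \<in> T w" for w w' using that by (simp add: Tiff)
  have finST: "finite (S v)" "finite (T v)" for v by (simp_all add: S_def T_def)
  have mt: "may_move rk (set R) (p(s := v, t := w)) t w' \<longleftrightarrow>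
      w' \<in> T w \<and> v \<noteq> w' \<and> \<not> (w' \<le> v \<and> v \<le> w)" for v w w'
  proof -
    have "p(s := v, t := w) = (p(t := w))(s := v)" using st by (rule fun_upd_twist)
    then show ?thesis
      using may_move_upd_other[OF st, of "set R" rk "p(t := w)" v w'] pair.prems RR
      by (simp add: T_def)
  qed
  have ms: "may_move rk (set R) (p(s := v, t := w)) s v' \<longleftrightarrow> v' \<in> S v \<and> w \<noteq> v'" for v w v'
    using may_move_upd_other[OF st[symmetric], of "set R" rk "p(s := v)" w v'] pair.prems RR
    by (simp add: S_def)
  let ?W = "\<lambda>v w. process_sum x rk R (p(s := v, t := w))"
  let ?W' = "\<lambda>v w. process_sum x rk R' (p(s := v, t := w))"
  let ?M = "\<lambda>v w. medium_between rk (set R) s t p v w"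
  have u1: "p(s := v, t := w, s := v') = p(s := v', t := w)" for v w v'
    using st by (auto simp: fun_eq_iff)
  have u2: "p(s := v, t := w, t := w') = p(s := v, t := w')" for v w w'
    by (auto simp: fun_eq_iff)
  have setR: "insert t (set R) = set R" "insert s (set R) = set R" using RR by auto
  \<comment> \<open>\<open>s\<close> acts first and then blocks \<open>t\<close>, so the new
    positions are again ordered as \<open>v < w\<close>.\<close>
  have L': "process_sum x rk (s # t # R') (p(s := i, t := j)) =
     (\<Sum>(v, w) | v \<in> S i \<and> w \<in> T j \<and> v < w. x v * x w * ?W' v w)"
  proof -
    have "process_sum x rk (s # t # R') (p(s := i, t := j)) =
      (\<Sum>v | v \<in> S i \<and> j \<noteq> v. x v * (\<Sum>w | w \<in> T j \<and> v \<noteq> w \<and> \<not> (w \<le> v \<and> v \<le> j). x w * ?W' v w))"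
      using RR st by (simp add: setR Collect_cong[OF ms] u1 u2 Collect_cong[OF mt] del: fun_upd_apply)
    also have "\<dots> = (\<Sum>(v, w) | (v \<in> S i \<and> j \<noteq> v) \<and> (w \<in> T j \<and> v \<noteq> w \<and> \<not> (w \<le> v \<and> v \<le> j)).
        x v * x w * ?W' v w)"
      by (rule sum_Sigma_pairs) (use finST in simp_all)
    also have "\<dots> = (\<Sum>(v, w) | v \<in> S i \<and> w \<in> T j \<and> v < w. x v * x w * ?W' v w)"
      by (rule sum.cong) (use \<open>i < j\<close> in \<open>auto dest: Sle Tle\<close>)
    finally show ?thesis .
  qed
  have L: "process_sum x rk (t # s # R) (p(s := v0, t := w0)) =
     (\<Sum>(w, v) | (w \<in> T w0 \<and> v0 \<noteq> w \<and> \<not> (w \<le> v0 \<and> v0 \<le> w0)) \<and> (v \<in> S v0 \<and> w \<noteq> v).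
        x w * x v * ?W v w)" for v0 w0
  proof -
    have "process_sum x rk (t # s # R) (p(s := v0, t := w0)) =
      (\<Sum>w | w \<in> T w0 \<and> v0 \<noteq> w \<and> \<not> (w \<le> v0 \<and> v0 \<le> w0). x w * (\<Sum>v | v \<in> S v0 \<and> w \<noteq> v. x v * ?W v w))"
      using RR st by (simp add: setR Collect_cong[OF ms] u1 u2 Collect_cong[OF mt] del: fun_upd_apply)
    also have "\<dots> = (\<Sum>(w, v) | (w \<in> T w0 \<and> v0 \<noteq> w \<and> \<not> (w \<le> v0 \<and> v0 \<le> w0)) \<and> (v \<in> S v0 \<and> w \<noteq> v).
        x w * x v * ?W v w)"
      by (rule sum_Sigma_pairs) (use finST in simp_all)
    finally show ?thesis .
  qed
  have swp: "(\<Sum>(w, v) | Q w v. x w * x v * g v w) = (\<Sum>(v, w) | Q w v. x v * x w * g v w)"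
    for Q and g :: "nat \<Rightarrow> nat \<Rightarrow> 'a"
    by (rule sum.reindex_bij_witness[of _ prod.swap prod.swap]) (auto simp: mult.commute)
  have L1: "process_sum x rk (t # s # R) (p(s := i, t := j)) =
     (\<Sum>(v, w) | v \<in> S i \<and> w \<in> T j \<and> i < w. x v * x w * ?W v w)"
    unfolding L
    by (subst swp, rule sum.cong) (use \<open>i < j\<close> in \<open>auto dest: Sle Tle\<close>)
  have L2: "process_sum x rk (t # s # R) (p(s := j, t := i)) =
     (\<Sum>(v, w) | w \<in> T i \<and> v \<in> S j \<and> v \<noteq> w. x v * x w * ?W v w)"
    unfolding L
    by (subst swp, rule sum.cong) (use \<open>i < j\<close> in \<open>auto dest: Sle Tle\<close>)
  have pd: "p d \<noteq> i" "p d \<noteq> j" if "d \<in> O'" for d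
    using pair.prems(4)[of d] that by (auto simp: O'_def)
  have inj: "inj_on rk (set R)" using pair.prems(2) setR by simp
  have IH: "?W' v w = ?W v w + (if ?M v w then 0 else ?W w v)"
    if "v \<in> S i" "w \<in> T j" "v < w" for v w
    by (rule pair.IH) (use that pair.prems inj in \<open>auto simp: Siff Tiff O'_def\<close>)
  define P where "P = {(v, w). v \<in> S i \<and> w \<in> T j \<and> v < w}"
  have finP: "finite P" by (rule finite_subset[of _ "S i \<times> T j"]) (auto simp: P_def finST)
  have Miff: "?M v w \<longleftrightarrow> (\<exists>k\<in>O'. rk s < rk k \<and> rk k < rk t \<and> v < p k \<and> p k < w)" for v w
    by (simp add: medium_between_def O'_def)
  have Meq: "medium_between rk (set (t # s # R)) s t p i j = ?M i j"
    using setR by (simp add: medium_between_def)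
  have tot: "(\<Sum>(v, w) \<in> P. x v * x w * ?W' v w) = (\<Sum>(v, w) \<in> P. x v * x w * ?W v w) +
      (\<Sum>(v, w) | (v, w) \<in> P \<and> \<not> ?M v w. x v * x w * ?W w v)"
  proof -
    have "(\<Sum>(v, w) \<in> P. x v * x w * ?W' v w) =
      (\<Sum>(v, w) \<in> P. x v * x w * ?W v w + (if ?M v w then 0 else x v * x w * ?W w v))"
      by (rule sum.cong) (auto simp: P_def IH algebra_simps)
    also have "\<dots> = (\<Sum>(v, w) \<in> P. x v * x w * ?W v w) +
      (\<Sum>z\<in>P. if ?M (fst z) (snd z) then 0 else x (fst z) * x (snd z) * ?W (snd z) (fst z))"
      by (simp add: sum.distrib split_def)
    also have "(\<Sum>z\<in>P. if ?M (fst z) (snd z) then 0 else x (fst z) * x (snd z) * ?W (snd z) (fst z)) =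
      (\<Sum>z\<in>{z\<in>P. \<not> ?M (fst z) (snd z)}. x (fst z) * x (snd z) * ?W (snd z) (fst z))"
      by (subst sum.inter_filter[OF finP]) (rule sum.cong, auto)
    also have "{z\<in>P. \<not> ?M (fst z) (snd z)} = {(v, w). (v, w) \<in> P \<and> \<not> ?M v w}" by auto
    finally show ?thesis by (simp add: split_def del: fun_upd_apply)
  qed
  show ?case
  proof (cases "?M i j")
    case True
    then obtain k where k: "k \<in> O'" "rk s < rk k" "rk k < rk t" "i < p k" "p k < j"
      unfolding Miff by blast
    \<comment> \<open>\<open>t\<close> cannot pass \<open>k\<close>, so \<open>k\<close> separates
      the new positions as well, and the second term vanishes before and after the round.\<close>
    have kw: "p k < w" if "w \<in> T j" for w
    proof -
      have "\<not> (w \<le> p k \<and> p k \<le> j)" using that k unfolding Tiff by blast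
      then show ?thesis using k by linarith
    qed
    have Peq: "P = {(v, w). v \<in> S i \<and> w \<in> T j \<and> i < w}"
      unfolding P_def using kw \<open>i < p k\<close> by (auto dest: Sle intro: less_trans)
    have P0: "{(v, w). (v, w) \<in> P \<and> \<not> ?M v w} = {}"
    proof -
      have "?M v w" if "(v, w) \<in> P" for v w
      proof -
        have "v \<le> i" "w \<in> T j" using that by (auto simp: P_def dest: Sle)
        then show ?thesis unfolding Miff using k kw by (meson le_less_trans)
      qed
      then show ?thesis by auto
    qed
    show ?thesis
      unfolding Meq L' L1 P_def[symmetric] Peq[symmetric] tot P0 using True by simp
  next
    case False
    have tri: "rk d < rk s \<or> (rk s < rk d \<and> rk d < rk t) \<or> rk t < rk d" if "d \<in> O'" for d
    proof -
      have "rk d \<noteq> rk s" "rk d \<noteq> rk t"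
        using that inj RR by (auto simp: O'_def dest: inj_onD)
      then show ?thesis by linarith
    qed
    have med: "rk s < rk d \<Longrightarrow> rk d < rk t \<Longrightarrow> p d < i \<or> j < p d" if "d \<in> O'" for d
      using False that pd[OF that] unfolding Miff by (meson linorder_neqE_nat)
    \<comment> \<open>The conditions on \<open>v\<close> and on \<open>w\<close> do not match
      separately. Jointly, low particles must avoid the whole range from \<open>v\<close> to
      \<open>j\<close> on either side, and for medium ones the stretch from \<open>i\<close> to
      \<open>j\<close> is empty anyway.\<close>
    have E1: "v \<in> S i \<and> w \<in> T j \<longleftrightarrow> w \<in> T i \<and> v \<in> S j" if "v < w" "w \<le> i" for v w
    proof -
      have "(p d \<noteq> v \<and> (rk d < rk s \<longrightarrow> \<not> (v \<le> p d \<and> p d \<le> i))) \<and>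
         (p d \<noteq> w \<and> (rk d < rk t \<longrightarrow> \<not> (w \<le> p d \<and> p d \<le> j))) \<longleftrightarrow>
         (p d \<noteq> w \<and> (rk d < rk t \<longrightarrow> \<not> (w \<le> p d \<and> p d \<le> i))) \<and>
         (p d \<noteq> v \<and> (rk d < rk s \<longrightarrow> \<not> (v \<le> p d \<and> p d \<le> j)))" if d: "d \<in> O'" for d
        using tri[OF d] med[OF d] pd[OF d] \<open>v < w\<close> \<open>w \<le> i\<close> \<open>i < j\<close> \<open>rk s < rk t\<close> by linarith
      then have "(\<forall>d\<in>O'. (p d \<noteq> v \<and> (rk d < rk s \<longrightarrow> \<not> (v \<le> p d \<and> p d \<le> i))) \<and>
         (p d \<noteq> w \<and> (rk d < rk t \<longrightarrow> \<not> (w \<le> p d \<and> p d \<le> j)))) \<longleftrightarrow>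
         (\<forall>d\<in>O'. (p d \<noteq> w \<and> (rk d < rk t \<longrightarrow> \<not> (w \<le> p d \<and> p d \<le> i))) \<and>
         (p d \<noteq> v \<and> (rk d < rk s \<longrightarrow> \<not> (v \<le> p d \<and> p d \<le> j))))"
        by (rule ball_cong[OF refl])
      moreover have "v \<le> i" "v \<le> j" "w \<le> j" using that \<open>i < j\<close> by auto
      ultimately show ?thesis unfolding Siff Tiff ball_conj_distrib using that by (simp only: simp_thms)
    qed
    \<comment> \<open>\<open>s\<close> and \<open>t\<close> exchange their targets. Together with
      \<open>\<not> ?M v w\<close>, both sides require that no medium particle lies from
      \<open>v\<close> to \<open>j\<close>; low particles obstruct \<open>s\<close> and
      \<open>t\<close> alike.\<close>
    have E2: "v \<in> S i \<and> w \<in> T j \<and> \<not> ?M v w \<longleftrightarrow> v \<in> T i \<and> w \<in> S j" if "v < w" for v w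
    proof (cases "v \<le> i \<and> w \<le> j")
      case vw: True
      have "(p d \<noteq> v \<and> (rk d < rk s \<longrightarrow> \<not> (v \<le> p d \<and> p d \<le> i))) \<and>
         (p d \<noteq> w \<and> (rk d < rk t \<longrightarrow> \<not> (w \<le> p d \<and> p d \<le> j))) \<and>
         \<not> (rk s < rk d \<and> rk d < rk t \<and> v < p d \<and> p d < w) \<longleftrightarrow>
         (p d \<noteq> v \<and> (rk d < rk t \<longrightarrow> \<not> (v \<le> p d \<and> p d \<le> i))) \<and>
         (p d \<noteq> w \<and> (rk d < rk s \<longrightarrow> \<not> (w \<le> p d \<and> p d \<le> j)))" if d: "d \<in> O'" for d
        using tri[OF d] med[OF d] pd[OF d] \<open>v < w\<close> vw \<open>i < j\<close> \<open>rk s < rk t\<close> by linarith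
      then have "(\<forall>d\<in>O'. (p d \<noteq> v \<and> (rk d < rk s \<longrightarrow> \<not> (v \<le> p d \<and> p d \<le> i))) \<and>
         (p d \<noteq> w \<and> (rk d < rk t \<longrightarrow> \<not> (w \<le> p d \<and> p d \<le> j))) \<and>
         \<not> (rk s < rk d \<and> rk d < rk t \<and> v < p d \<and> p d < w)) \<longleftrightarrow>
         (\<forall>d\<in>O'. (p d \<noteq> v \<and> (rk d < rk t \<longrightarrow> \<not> (v \<le> p d \<and> p d \<le> i))) \<and>
         (p d \<noteq> w \<and> (rk d < rk s \<longrightarrow> \<not> (w \<le> p d \<and> p d \<le> j))))"
        by (rule ball_cong[OF refl])
      then show ?thesis unfolding Siff Tiff Miff ball_conj_distrib using vw by blast
    qed (auto dest: Sle Tle)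
    let ?g = "\<lambda>(v, w). x v * x w * ?W v w"
    \<comment> \<open>\<open>P1\<close> collects the moves from the first arrangement under
      \<open>L\<close>; \<open>P2a\<close> and \<open>P2b\<close> collect those from the second,
      according to whether \<open>s\<close> ends to the left or to the right of
      \<open>t\<close>.\<close>
    define P1 where "P1 = {(v, w). v \<in> S i \<and> w \<in> T j \<and> i < w}"
    define P2a where "P2a = {(v, w). w \<in> T i \<and> v \<in> S j \<and> v < w}"
    define P2b where "P2b = {(v, w). w \<in> T i \<and> v \<in> S j \<and> w < v}"
    have fin: "finite P1" "finite P2a" "finite P2b"
      by (rule finite_subset[of _ "S i \<times> T j"]; auto simp: P1_def finST)
         (rule finite_subset[of _ "S j \<times> T i"]; auto simp: P2a_def P2b_def finST)+
    have "P = P1 \<union> P2a"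
    proof -
      have "v \<in> S i \<and> w \<in> T j \<and> v < w \<longleftrightarrow>
        v \<in> S i \<and> w \<in> T j \<and> i < w \<or> w \<in> T i \<and> v \<in> S j \<and> v < w" for v w
      proof (cases "i < w")
        case True
        then show ?thesis by (auto dest: Sle Tle)
      next
        case False
        then show ?thesis using E1[of v w] by auto
      qed
      then show ?thesis unfolding P_def P1_def P2a_def by auto
    qed
    moreover have "P1 \<inter> P2a = {}" by (auto simp: P1_def P2a_def dest: Tle)
    ultimately have s1: "sum ?g P = sum ?g P1 + sum ?g P2a"
      using fin by (simp add: sum.union_disjoint)
    have s2: "(\<Sum>(v, w) | (v, w) \<in> P \<and> \<not> ?M v w. x v * x w * ?W w v) = sum ?g P2b"
    proof -
      have "{(v, w). (v, w) \<in> P \<and> \<not> ?M v w} = {(v, w). v \<in> T i \<and> w \<in> S j \<and> v < w}"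
        using E2 unfolding P_def by blast
      then show ?thesis
        by (simp only: P2b_def)
          (rule sum.reindex_bij_witness[of _ prod.swap prod.swap]; auto simp: mult.commute)
    qed
    have "{(v, w). w \<in> T i \<and> v \<in> S j \<and> v \<noteq> w} = P2a \<union> P2b" "P2a \<inter> P2b = {}"
      by (auto simp: P2a_def P2b_def)
    then have s3: "process_sum x rk (t # s # R) (p(s := j, t := i)) = sum ?g P2a + sum ?g P2b"
      unfolding L2 using fin by (simp add: sum.union_disjoint)
    show ?thesis
      unfolding Meq L' L1 s3 P_def[symmetric] P1_def[symmetric] tot s1 s2
      using False by (simp add: add.assoc)
  qed
next
  case (other R R' e)
  note RR = round_swap_set[OF other.hyps(1)]
  have st: "s \<noteq> t" using other.prems by auto
  have inj: "inj_on rk (set R)" using other.prems(2) by (auto intro: inj_on_subset)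
  have est: "e \<noteq> s" "e \<noteq> t" using other.hyps by auto
  let ?L = "e # R"
  let ?M = "\<lambda>p. medium_between rk (set R) s t p i j"
  show ?case
  proof (cases "e \<in> set R")
    case False
    \<comment> \<open>The removed particle ranks below \<open>s\<close>, hence was not medium, and
      its disappearance opens no gap.\<close>
    then have "rk e < rk s" by (rule other.hyps)
    then have M: "medium_between rk (set ?L) s t p i j = ?M p"
      by (auto simp: medium_between_def)
    have "process_sum x rk R' (p(s := i, t := j)) = process_sum x rk R (p(s := i, t := j)) +
      (if ?M p then 0 else process_sum x rk R (p(s := j, t := i)))"
      by (rule other.IH) (use other.prems inj in auto)
    then show ?thesis using False RR unfolding M by (simp del: fun_upd_apply)
  next
    case True
    have M: "medium_between rk (set ?L) s t p i j = ?M p"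
      using True by (simp add: medium_between_def insert_absorb)
    have tR': "t \<in> set R - {s}" using st RR by simp
    have *: "may_move rk (set R) (p(s := v, t := w)) e u \<longleftrightarrow>
        may_move rk (set R - {s} - {t}) p e u \<and>
        (w \<noteq> u \<and> (rk t < rk e \<longrightarrow> \<not> (u \<le> w \<and> w \<le> p e))) \<and>
        (v \<noteq> u \<and> (rk s < rk e \<longrightarrow> \<not> (u \<le> v \<and> v \<le> p e)))" for u v w
    proof -
      have "p(s := v, t := w) = p(t := w, s := v)" using st by (rule fun_upd_twist)
      then show ?thesis
        using may_move_upd_other[OF est(1)[symmetric], of "set R" rk "p(t := w)" v u] RR
          may_move_upd_other[OF est(2)[symmetric] tR', of rk p w u] est
        by (simp only: fun_upd_other simp_thms not_False_eq_True) blast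
    qed
    define A where "A = {u. may_move rk (set R) (p(s := i, t := j)) e u}"
    define B where "B = {u. may_move rk (set R) (p(s := j, t := i)) e u}"
    have fin: "finite A" "finite B" by (simp_all add: A_def B_def)
    have tw: "p(s := v, t := w, e := u) = p(e := u, s := v, t := w)" for u v w
      using est by (auto simp: fun_eq_iff)
    have ep: "p e \<noteq> i" "p e \<noteq> j" using other.prems(4)[of e] est by auto
    have rkne: "rk e \<noteq> rk s" "rk e \<noteq> rk t"
      using inj True RR est by (auto dest: inj_onD)
    have IH: "process_sum x rk R' (p(e := u, s := i, t := j)) =
        process_sum x rk R (p(e := u, s := i, t := j)) +
        (if ?M (p(e := u)) then 0 else process_sum x rk R (p(e := u, s := j, t := i)))"
      if "u \<in> A" for u
    proof (rule other.IH)
      have "u \<noteq> i" "u \<noteq> j" using that unfolding A_def mem_Collect_eq * by auto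
      then show "(p(e := u)) d \<noteq> i \<and> (p(e := u)) d \<noteq> j" if "d \<in> set R" "d \<noteq> s" "d \<noteq> t" for d
        using other.prems(4)[of d] that by auto
    qed (use other.prems inj in auto)
    \<comment> \<open>Only \<open>e\<close> of intermediate rank needs care. Inside the gap it
      cannot leave, being blocked by \<open>s\<close> at \<open>i\<close>. If it enters from the
      right, the second term vanishes; this matches the exchanged arrangement, where
      \<open>s\<close> at \<open>j\<close> blocks its entry.\<close>
    have key: "{u \<in> A. \<not> ?M (p(e := u))} = (if ?M p then {} else B)"
    proof -
      have Msplit: "?M q \<longleftrightarrow> (\<exists>k\<in>set R - {s, t, e}. rk s < rk k \<and> rk k < rk t \<and> i < q k \<and> q k < j)
          \<or> (rk s < rk e \<and> rk e < rk t \<and> i < q e \<and> q e < j)" for q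
        using True est by (auto simp: medium_between_def)
      have Mu: "?M (p(e := u)) \<longleftrightarrow> (\<exists>k\<in>set R - {s, t, e}. rk s < rk k \<and> rk k < rk t \<and> i < p k \<and> p k < j)
          \<or> (rk s < rk e \<and> rk e < rk t \<and> i < u \<and> u < j)" for u
        unfolding Msplit by auto
      have taut: "(P \<and> X \<and> Y) \<and> \<not> (E \<or> m) \<longleftrightarrow> \<not> (E \<or> m') \<and> P \<and> X' \<and> Y'"
        if "X \<and> Y \<and> \<not> m \<longleftrightarrow> \<not> m' \<and> X' \<and> Y'" "P" for P X Y E m m' X' Y'
        using that by blast
      have "u \<in> A \<and> \<not> ?M (p(e := u)) \<longleftrightarrow> \<not> ?M p \<and> u \<in> B" for u
      proof (cases "may_move rk (set R - {s} - {t}) p e u")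
        case False
        then show ?thesis unfolding A_def B_def mem_Collect_eq * by simp
      next
        case True
        then have "u \<le> p e" by (simp add: may_move_def)
        consider "rk e < rk s" "rk e < rk t" | "rk s < rk e" "rk e < rk t" | "rk s < rk e" "rk t < rk e"
          using rkne \<open>rk s < rk t\<close> by linarith
        then have "(j \<noteq> u \<and> (rk t < rk e \<longrightarrow> \<not> (u \<le> j \<and> j \<le> p e))) \<and>
          (i \<noteq> u \<and> (rk s < rk e \<longrightarrow> \<not> (u \<le> i \<and> i \<le> p e))) \<and>
          \<not> (rk s < rk e \<and> rk e < rk t \<and> i < u \<and> u < j) \<longleftrightarrow>
          \<not> (rk s < rk e \<and> rk e < rk t \<and> i < p e \<and> p e < j) \<and>
          (i \<noteq> u \<and> (rk t < rk e \<longrightarrow> \<not> (u \<le> i \<and> i \<le> p e))) \<and>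
          (j \<noteq> u \<and> (rk s < rk e \<longrightarrow> \<not> (u \<le> j \<and> j \<le> p e)))"
        proof cases
          case 1
          then show ?thesis by auto
        next
          case 2
          have "(j \<noteq> u) \<and> (i \<noteq> u \<and> \<not> (u \<le> i \<and> i \<le> p e)) \<and> \<not> (i < u \<and> u < j) \<longleftrightarrow>
            \<not> (i < p e \<and> p e < j) \<and> i \<noteq> u \<and> (j \<noteq> u \<and> \<not> (u \<le> j \<and> j \<le> p e))"
            using \<open>u \<le> p e\<close> ep \<open>i < j\<close> by linarith
          then show ?thesis using 2 by simp
        next
          case 3
          then show ?thesis by auto
        qed
        then show ?thesis
          unfolding A_def B_def mem_Collect_eq * Mu Msplit[of p] using True by (intro taut)
      qed
      then show ?thesis by auto
    qed
    have setR': "set R' = set R" using RR by simp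
    have e: "process_sum x rk (e # Q) (p(s := v, t := w)) =
       (\<Sum>u | may_move rk (set R) (p(s := v, t := w)) e u. x u * process_sum x rk Q (p(e := u, s := v, t := w)))"
      if "set Q = set R" for Q v w
      using True that by (simp add: tw del: fun_upd_apply)
    have "process_sum x rk (e # R') (p(s := i, t := j)) =
        (\<Sum>u\<in>A. x u * process_sum x rk R (p(e := u, s := i, t := j)) +
          (if ?M (p(e := u)) then 0 else x u * process_sum x rk R (p(e := u, s := j, t := i))))"
      unfolding e[OF setR'] A_def[symmetric]
      by (rule sum.cong) (auto simp: IH algebra_simps simp del: fun_upd_apply)
    also have "\<dots> = process_sum x rk (e # R) (p(s := i, t := j)) +
        (\<Sum>u\<in>A. if ?M (p(e := u)) then 0 else x u * process_sum x rk R (p(e := u, s := j, t := i)))"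
      unfolding e[OF refl] A_def[symmetric] by (simp add: sum.distrib)
    also have "(\<Sum>u\<in>A. if ?M (p(e := u)) then 0 else x u * process_sum x rk R (p(e := u, s := j, t := i))) =
       (\<Sum>u\<in>{u \<in> A. \<not> ?M (p(e := u))}. x u * process_sum x rk R (p(e := u, s := j, t := i)))"
      by (subst sum.inter_filter[OF fin(1)]) (rule sum.cong, auto)
    also have "\<dots> = (if ?M p then 0 else process_sum x rk (e # R) (p(s := j, t := i)))"
      unfolding key e[OF refl] B_def by simp
    finally show ?thesis unfolding M .
  qed
qed

section \<open>The sequence of actions of a composition\<close>

lemma process_sum_rename:
  assumes "inj \<pi>"
    "\<And>c d. c \<in> set L \<Longrightarrow> d \<in> set L \<Longrightarrow> rk (\<pi> c) < rk (\<pi> d) \<longleftrightarrow> rk' c < rk' d"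
  shows "process_sum x rk (map \<pi> L) p = process_sum x rk' L (p \<circ> \<pi>)"
  using assms(2)
proof (induction L arbitrary: p)
  case (Cons c R)
  have mem: "\<pi> c \<in> set (map \<pi> R) \<longleftrightarrow> c \<in> set R"
    using assms(1) by (auto dest: injD)
  have "may_move rk (set (map \<pi> R)) p (\<pi> c) = may_move rk' (set R) (p \<circ> \<pi>) c"
  proof (rule ext)
    fix u
    have "set (map \<pi> R) - {\<pi> c} = \<pi> ` (set R - {c})" using assms(1) by (auto dest: injD)
    then show "may_move rk (set (map \<pi> R)) p (\<pi> c) u = may_move rk' (set R) (p \<circ> \<pi>) c u"
      unfolding may_move_def using Cons.prems by auto
  qed
  moreover have "p(\<pi> c := u) \<circ> \<pi> = (p \<circ> \<pi>)(c := u)" for u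
    using assms(1) by (auto simp: fun_eq_iff dest: injD)
  ultimately show ?case
    unfolding list.map process_sum.simps mem by (simp only: Cons.IH[OF Cons.prems] list.set_intros)
qed simp

text \<open>The actions from column \<open>c\<close> of row \<open>j\<close> on; column \<open>c\<close> acts in the rows \<open>1, \<dots>, \<mu>\<^sub>c + 1\<close>.  Rows from
  \<open>B\<close> on are cut off, which only serves termination.\<close>

function actions :: "nat list \<Rightarrow> nat \<Rightarrow> nat \<Rightarrow> nat \<Rightarrow> nat list" where
  "actions \<mu> B j c =
     (if B \<le> j then []
      else if c < length \<mu> then
        (if j \<le> Suc (\<mu> ! c) then c # actions \<mu> B j (Suc c) else actions \<mu> B j (Suc c))
      else actions \<mu> B (Suc j) 0)"
  by auto
termination
  by (relation "measures [\<lambda>(\<mu>, B, j, c). B - j, \<lambda>(\<mu>, B, j, c). length \<mu> - c]") auto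

section \<open>Reading order and order of the actions\<close>

declare actions.simps [simp del]

lemma actions_stop: "B \<le> j \<Longrightarrow> actions \<mu> B j c = []"
  and actions_column: "j < B \<Longrightarrow> c < length \<mu> \<Longrightarrow> actions \<mu> B j c =
    (if j \<le> Suc (\<mu> ! c) then c # actions \<mu> B j (Suc c) else actions \<mu> B j (Suc c))"
  and actions_round: "j < B \<Longrightarrow> actions \<mu> B j (length \<mu>) = actions \<mu> B (Suc j) 0"
  by (subst actions.simps; simp)+

text \<open>Backward induction along the reading order; \<open>c = n\<close> is the position past
  the end of a row, which is identified with the start of the next row.\<close>

lemma position_induct [consumes 1, case_names stop round column]:
  fixes n B :: nat
  assumes "c \<le> n"
    and stop: "\<And>j c. c \<le> n \<Longrightarrow> B \<le> j \<Longrightarrow> P j c"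
    and round: "\<And>j. j < B \<Longrightarrow> P (Suc j) 0 \<Longrightarrow> P j n"
    and column: "\<And>j c. c < n \<Longrightarrow> j < B \<Longrightarrow> P j (Suc c) \<Longrightarrow> P j c"
  shows "P j c"
  using assms(1)
proof (induction "B - j" arbitrary: j c)
  case 0
  then show ?case by (intro stop) auto
next
  case (Suc k)
  have "j < B" using Suc.hyps(2) by simp
  moreover have "P (Suc j) 0" by (rule Suc.hyps(1)) (use Suc.hyps(2) in auto)
  ultimately have n: "P j n" by (rule round)
  show ?case
    using Suc.prems by (induction rule: inc_induct) (use n column \<open>j < B\<close> in auto)
qed

definition tall_bound :: "nat list \<Rightarrow> nat \<Rightarrow> bool" where
  "tall_bound \<mu> B \<longleftrightarrow> (\<forall>d<length \<mu>. Suc (\<mu> ! d) < B)"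

text \<open>A column to the left of \<open>c\<close> has already acted in row \<open>j\<close>, so
  its next chance is row \<open>Suc j\<close>; this turns \<open>j \<le> Suc (\<mu> ! d)\<close>
  into \<open>j \<le> \<mu> ! d\<close>.\<close>

lemma in_set_actions:
  assumes "tall_bound \<mu> B" "c \<le> length \<mu>"
  shows "d \<in> set (actions \<mu> B j c) \<longleftrightarrow>
    d < length \<mu> \<and> (if c \<le> d then j \<le> Suc (\<mu> ! d) else j \<le> \<mu> ! d)"
  using assms(2)
proof (induction j c rule: position_induct[where B = B])
  case (stop j c)
  then have "d < length \<mu> \<Longrightarrow> Suc (\<mu> ! d) < j"
    using assms(1) unfolding tall_bound_def by (metis less_le_trans)
  then show ?case using stop.hyps by (auto simp: actions_stop)
next
  case (round j)
  then show ?case by (auto simp: actions_round)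
next
  case (column j c)
  then show ?case by (auto simp: actions_column Suc_le_eq le_less)
qed

text \<open>The next actions follow the cyclic order of the columns, starting at
  \<open>c\<close>.\<close>

lemma acts_before_actions:
  assumes "tall_bound \<mu> B" "c \<le> length \<mu>" "d \<noteq> e"
    "d \<in> set (actions \<mu> B j c)" "e \<in> set (actions \<mu> B j c)"
  shows "acts_before d e (actions \<mu> B j c) \<longleftrightarrow>
    c \<le> d \<and> e < c \<or> (c \<le> d \<longleftrightarrow> c \<le> e) \<and> d < e"
  using assms(2,4,5)
proof (induction j c rule: position_induct[where B = B])
  case (stop j c)
  then show ?case by (simp add: actions_stop)
next
  case (round j)
  then have "d < length \<mu>" "e < length \<mu>" by (simp_all add: in_set_actions[OF assms(1)])
  then show ?case using round by (simp add: actions_round)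
next
  case (column j c)
  show ?case
  proof (cases "c = d \<or> c = e")
    case True
    then have "j \<le> Suc (\<mu> ! c)"
      using column.prems column.hyps by (auto simp: in_set_actions[OF assms(1)])
    then show ?thesis using True column.hyps assms(3) by (auto simp: actions_column)
  next
    case False
    let ?R = "actions \<mu> B j (Suc c)"
    have L: "actions \<mu> B j c = c # ?R \<or> actions \<mu> B j c = ?R"
      using column.hyps by (simp add: actions_column)
    then have m: "d \<in> set ?R" "e \<in> set ?R" using column.prems False by auto
    have "acts_before d e (actions \<mu> B j c) \<longleftrightarrow> acts_before d e ?R" using L False by auto
    also have "\<dots> \<longleftrightarrow> Suc c \<le> d \<and> e < Suc c \<or> (Suc c \<le> d \<longleftrightarrow> Suc c \<le> e) \<and> d < e"
      by (rule column.IH[OF m])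
    also have "\<dots> \<longleftrightarrow> c \<le> d \<and> e < c \<or> (c \<le> d \<longleftrightarrow> c \<le> e) \<and> d < e"
      using False by auto
    finally show ?thesis .
  qed
qed

text \<open>The lexicographic order on (height, column number), coded as a single number in base
  \<open>length \<mu>\<close>.\<close>

definition column_rank :: "nat list \<Rightarrow> nat \<Rightarrow> nat" where
  "column_rank \<mu> c = \<mu> ! c * length \<mu> + c"

lemma column_rank_less_iff:
  assumes "c < length \<mu>" "d < length \<mu>"
  shows "column_rank \<mu> c < column_rank \<mu> d \<longleftrightarrow> \<mu> ! c < \<mu> ! d \<or> \<mu> ! c = \<mu> ! d \<and> c < d"
proof -
  have less: "column_rank \<mu> c < column_rank \<mu> d"
    if "\<mu> ! c < \<mu> ! d" "c < length \<mu>" for c d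
  proof -
    have "column_rank \<mu> c < Suc (\<mu> ! c) * length \<mu>" using that by (simp add: column_rank_def)
    also have "\<dots> \<le> \<mu> ! d * length \<mu>" using that by (intro mult_le_mono1) simp
    finally show ?thesis by (simp add: column_rank_def)
  qed
  show ?thesis
    using less[of c d] less[of d c] assms by (cases "\<mu> ! c" "\<mu> ! d" rule: linorder_cases)
      (auto simp: column_rank_def)
qed

lemma cyclic_schedule_actions:
  assumes "tall_bound \<mu> B" "c \<le> length \<mu>"
  shows "cyclic_schedule (column_rank \<mu>) (actions \<mu> B j c)"
  using assms(2)
proof (induction j c rule: position_induct[where B = B])
  case (stop j c)
  then show ?case by (simp add: actions_stop)
next
  case (round j)
  then show ?case by (simp add: actions_round)
next
  case (column j c)
  let ?R = "actions \<mu> B j (Suc c)"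
  have mem: "d \<in> set ?R \<longleftrightarrow> d < length \<mu> \<and> (if Suc c \<le> d then j \<le> Suc (\<mu> ! d) else j \<le> \<mu> ! d)" for d
    by (rule in_set_actions) (use assms column.hyps in auto)
  show ?case
  proof (cases "j \<le> Suc (\<mu> ! c)")
    case False
    then show ?thesis using column by (simp add: actions_column)
  next
    case True
    have "acts_before d c ?R" if "c \<in> set ?R" "d \<in> set ?R - {c}" for d
      using acts_before_actions[of \<mu> B "Suc c" d c j] assms(1) column.hyps that by auto
    moreover have "column_rank \<mu> c < column_rank \<mu> d" if "c \<notin> set ?R" "d \<in> set ?R" for d
    proof -
      \<comment> \<open>The last action of \<open>c\<close> takes place in row
        \<open>\<mu> ! c + 1\<close>. Columns to its right that still act there are at least as
        tall; columns to its left that act later are strictly taller.\<close>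
      have "Suc (\<mu> ! c) = j" using that(1) True column.hyps by (auto simp: mem)
      moreover have "d \<noteq> c" using that by auto
      ultimately show ?thesis
        using that(2) column.hyps by (auto simp: mem column_rank_less_iff split: if_splits)
    qed
    ultimately show ?thesis using True column by (simp add: actions_column)
  qed
qed

section \<open>Compositions with two adjacent entries exchanged\<close>

lemma length_swap_entries [simp]: "length (swap_entries i \<alpha>) = length \<alpha>"
  by (simp add: swap_entries_def)

lemma nth_swap_entries:
  assumes "Suc i < length \<alpha>" "c < length \<alpha>"
  shows "swap_entries i \<alpha> ! c = \<alpha> ! transpose i (Suc i) c"
  using assms by (auto simp: swap_entries_def nth_list_update transpose_def)

lemma transpose_less [simp]: "Suc i < n \<Longrightarrow> transpose i (Suc i) c < n \<longleftrightarrow> c < n"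
  by (auto simp: transpose_def)

text \<open>The position between columns \<open>i\<close> and \<open>Suc i\<close> is skipped,
  because there the two schedules are out of step.\<close>

lemma position_induct_pair [consumes 3, case_names stop round pair column]:
  fixes n B i :: nat
  assumes "c \<le> n" "c \<noteq> Suc i" "Suc i < n"
    and stop: "\<And>j c. c \<le> n \<Longrightarrow> c \<noteq> Suc i \<Longrightarrow> B \<le> j \<Longrightarrow> P j c"
    and round: "\<And>j. j < B \<Longrightarrow> P (Suc j) 0 \<Longrightarrow> P j n"
    and pair: "\<And>j. j < B \<Longrightarrow> P j (Suc (Suc i)) \<Longrightarrow> P j i"
    and column: "\<And>j c. c < n \<Longrightarrow> c \<noteq> i \<Longrightarrow> c \<noteq> Suc i \<Longrightarrow> j < B \<Longrightarrow> P j (Suc c) \<Longrightarrow> P j c"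
  shows "P j c"
proof -
  have "P j (if c = Suc i then Suc (Suc i) else c)"
    using assms(1)
  proof (induction j c rule: position_induct[where B = B])
    case (column j c)
    then show ?case using assms(3) pair assms(7)[of c j] by (auto split: if_splits)
  qed (use assms(3) stop round in auto)
  then show ?thesis using assms(2) by simp
qed

text \<open>Once the shorter column is gone, only one of the two columns acts, and the renaming
  aligns the schedules completely.\<close>

lemma actions_swap_after_removal:
  assumes i: "Suc i < length \<alpha>" and gt: "\<alpha> ! i > \<alpha> ! Suc i"
    and "c \<le> length \<alpha>" "c \<noteq> Suc i" "if c \<le> i then Suc (\<alpha> ! Suc i) < j else \<alpha> ! Suc i < j"
  shows "map (transpose i (Suc i)) (actions (swap_entries i \<alpha>) B j c) = actions \<alpha> B j c"
  using assms(3,4,1,5)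
proof (induction j c rule: position_induct_pair[where B = B])
  case (stop j c)
  then show ?case by (simp add: actions_stop)
next
  case (round j)
  then show ?case
    using actions_round[of j B \<alpha>] actions_round[of j B "swap_entries i \<alpha>"] i by auto
next
  case (pair j)
  then show ?case using i gt by (auto simp: actions_column nth_swap_entries)
next
  case (column j c)
  then show ?case using i
    by (auto simp: actions_column nth_swap_entries transpose_apply_other split: if_splits)
qed

lemma round_swap_actions:
  assumes tb: "tall_bound \<alpha> B" and i: "Suc i < length \<alpha>" and gt: "\<alpha> ! i > \<alpha> ! Suc i"
    and "c \<le> length \<alpha>" "c \<noteq> Suc i" "if c \<le> i then j \<le> Suc (\<alpha> ! Suc i) else j \<le> \<alpha> ! Suc i"
  shows "round_swap (column_rank \<alpha>) (Suc i) i (actions \<alpha> B j c)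
    (map (transpose i (Suc i)) (actions (swap_entries i \<alpha>) B j c))"
  using assms(4,5,2,6)
proof (induction j c rule: position_induct_pair[where B = B])
  case (stop j c)
  have "Suc (\<alpha> ! Suc i) < B" using tb i by (simp add: tall_bound_def)
  then show ?case using stop by (simp split: if_splits)
next
  case (round j)
  then show ?case
    using actions_round[of j B \<alpha>] actions_round[of j B "swap_entries i \<alpha>"] i by auto
next
  case (pair j)
  let ?R = "actions \<alpha> B j (Suc (Suc i))"
  let ?R' = "actions (swap_entries i \<alpha>) B j (Suc (Suc i))"
  have j: "j \<le> Suc (\<alpha> ! Suc i)" using pair.prems by simp
  have L: "actions \<alpha> B j i = i # Suc i # ?R"
    and L': "map (transpose i (Suc i)) (actions (swap_entries i \<alpha>) B j i) =
      Suc i # i # map (transpose i (Suc i)) ?R'"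
    using pair.hyps i gt j by (auto simp: actions_column nth_swap_entries)
  have mem: "d \<in> set ?R \<longleftrightarrow>
    d < length \<alpha> \<and> (if Suc (Suc i) \<le> d then j \<le> Suc (\<alpha> ! d) else j \<le> \<alpha> ! d)" for d
    by (rule in_set_actions[OF tb]) (use i in simp)
  show ?case
  proof (cases "j \<le> \<alpha> ! Suc i")
    case True
    then show ?thesis unfolding L L' by (intro round_swap.pair pair.IH) auto
  next
    case False
    have "map (transpose i (Suc i)) ?R' = ?R"
      by (rule actions_swap_after_removal) (use i gt False in auto)
    \<comment> \<open>This is row \<open>\<alpha> ! Suc i + 1\<close>, where the shorter column is
      removed while the taller one still moves.\<close>
    moreover have "round_swap (column_rank \<alpha>) (Suc i) i (i # Suc i # ?R) (Suc i # i # ?R)"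
    proof (rule round_swap.last)
      show "column_rank \<alpha> (Suc i) < column_rank \<alpha> d" if "d \<in> set ?R" for d
        using that i j False by (subst column_rank_less_iff) (auto simp: mem split: if_splits)
    qed (use False j gt i in \<open>auto simp: mem\<close>)
    ultimately show ?thesis unfolding L L' by simp
  qed
next
  case (column j c)
  let ?R = "actions \<alpha> B j (Suc c)"
  have mem: "c \<in> set ?R \<longleftrightarrow> c < length \<alpha> \<and> j \<le> \<alpha> ! c"
    by (subst in_set_actions[OF tb]) (use column.hyps in auto)
  have IH: "round_swap (column_rank \<alpha>) (Suc i) i ?R
      (map (transpose i (Suc i)) (actions (swap_entries i \<alpha>) B j (Suc c)))"
    by (rule column.IH) (use column in \<open>auto split: if_splits\<close>)
  show ?case
  proof (cases "j \<le> Suc (\<alpha> ! c)")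
    case True
    have "round_swap (column_rank \<alpha>) (Suc i) i (c # ?R)
      (c # map (transpose i (Suc i)) (actions (swap_entries i \<alpha>) B j (Suc c)))"
    proof (rule round_swap.other[OF IH])
      assume "c \<notin> set ?R"
      then have "j = Suc (\<alpha> ! c)" using True column.hyps by (auto simp: mem)
      then show "column_rank \<alpha> c < column_rank \<alpha> (Suc i)"
        using column i by (subst column_rank_less_iff) (auto split: if_splits)
    qed (use column.hyps in auto)
    then show ?thesis using True column.hyps i
      by (simp add: actions_column nth_swap_entries transpose_apply_other)
  next
    case False
    then show ?thesis using IH column.hyps i
      by (simp add: actions_column nth_swap_entries transpose_apply_other)
  qed
qed

text \<open>The heights of the exchanged columns differ, so the tie-break by column number, which
  the transposition would reverse, never decides between them.\<close>

lemma column_rank_swap_entries: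
  assumes "Suc i < length \<alpha>" "\<alpha> ! i \<noteq> \<alpha> ! Suc i" "c < length \<alpha>" "d < length \<alpha>"
  shows "column_rank \<alpha> (transpose i (Suc i) c) < column_rank \<alpha> (transpose i (Suc i) d) \<longleftrightarrow>
    column_rank (swap_entries i \<alpha>) c < column_rank (swap_entries i \<alpha>) d"
  using assms by (simp add: column_rank_less_iff nth_swap_entries) (auto simp: transpose_def)

text \<open>Renaming by the transposition turns the process of the exchanged composition into one
  with the particles of \<open>\<alpha>\<close>, in which the shorter column starts at
  \<open>i\<close> and the taller one at \<open>Suc i\<close>.\<close>

lemma process_sum_swap_entries:
  assumes tb: "tall_bound \<alpha> B" and i: "Suc i < length \<alpha>" and gt: "\<alpha> ! i > \<alpha> ! Suc i"
  shows "process_sum x (column_rank (swap_entries i \<alpha>)) (actions (swap_entries i \<alpha>) B 1 0) id =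
    process_sum x (column_rank \<alpha>) (actions \<alpha> B 1 0) id +
    process_sum x (column_rank \<alpha>) (actions \<alpha> B 1 0) (transpose i (Suc i))"
proof -
  let ?t = "transpose i (Suc i)" and ?L = "actions \<alpha> B 1 0"
  let ?L' = "actions (swap_entries i \<alpha>) B 1 0"
  have tb': "tall_bound (swap_entries i \<alpha>) B"
    using tb i by (auto simp: tall_bound_def nth_swap_entries)
  have "process_sum x (column_rank (swap_entries i \<alpha>)) ?L' id =
    process_sum x (column_rank \<alpha>) (map ?t ?L') ?t"
  proof -
    have "process_sum x (column_rank \<alpha>) (map ?t ?L') ?t =
      process_sum x (column_rank (swap_entries i \<alpha>)) ?L' (?t \<circ> ?t)"
      by (rule process_sum_rename, simp, rule column_rank_swap_entries)
        (use i gt in \<open>auto simp: in_set_actions[OF tb']\<close>)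
    then show ?thesis by simp
  qed
  moreover have t1: "?t = id(Suc i := i, i := Suc i)"
    and t2: "id(Suc i := Suc i, i := i) = (id :: nat \<Rightarrow> nat)"
    by (auto simp: fun_eq_iff transpose_def)
  moreover have "process_sum x (column_rank \<alpha>) (map ?t ?L') (id(Suc i := i, i := Suc i)) =
      process_sum x (column_rank \<alpha>) ?L (id(Suc i := i, i := Suc i)) +
      (if medium_between (column_rank \<alpha>) (set ?L) (Suc i) i id i (Suc i) then 0
       else process_sum x (column_rank \<alpha>) ?L (id(Suc i := Suc i, i := i)))"
  proof (rule process_sum_round_swap)
    show "round_swap (column_rank \<alpha>) (Suc i) i ?L (map ?t ?L')"
      by (rule round_swap_actions[OF tb i gt]) auto
    show "column_rank \<alpha> (Suc i) < column_rank \<alpha> i"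
      using i gt by (simp add: column_rank_less_iff)
    show "inj_on (column_rank \<alpha>) (set ?L)"
      by (rule cyclic_schedule_inj, rule cyclic_schedule_actions[OF tb]) simp
  qed auto
  \<comment> \<open>There is no site strictly between \<open>i\<close> and
    \<open>Suc i\<close>.\<close>
  moreover have "\<not> medium_between (column_rank \<alpha>) (set ?L) (Suc i) i id i (Suc i)"
    by (auto simp: medium_between_def)
  ultimately show ?thesis by (simp add: add.commute)
qed

lemma (in variable_swap) xi_process_sum_actions:
  assumes tb: "tall_bound \<alpha> B" and i: "Suc a < length \<alpha>" and gt: "\<alpha> ! a > \<alpha> ! Suc a"
  shows "(x a - x b) * process_sum x (column_rank (swap_entries a \<alpha>)) (actions (swap_entries a \<alpha>) B 1 0) id =
    x a * process_sum x (column_rank \<alpha>) (actions \<alpha> B 1 0) id -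
    x b * s (process_sum x (column_rank \<alpha>) (actions \<alpha> B 1 0) id)"
proof -
  let ?L = "actions \<alpha> B 1 0"
  have t1: "transpose a b = id(b := a, a := b)" and t2: "id(b := b, a := a) = (id :: nat \<Rightarrow> nat)"
    by (auto simp: fun_eq_iff transpose_def)
  have m: "a \<in> set ?L" "b \<in> set ?L" using i by (simp_all add: in_set_actions[OF tb] b_def)
  have "acts_before a b ?L"
    using acts_before_actions[OF tb _ _ m] by (simp add: b_def)
  then show ?thesis
    using xi_process_sum[OF cyclic_schedule_actions[OF tb, of 0 1] m(2,1), of id] i gt
    unfolding process_sum_swap_entries[OF tb i gt]
    by (simp add: column_rank_less_iff b_def t1[unfolded b_def] t2[unfolded b_def] del: fun_upd_apply)
qed

section \<open>Fillings\<close>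

text \<open>The move in column \<open>c\<close> from row \<open>j - 1\<close> to row \<open>j\<close> is legal when the columns to the left have
  already reached row \<open>j\<close> and those to the right have not.\<close>

definition step_ok :: "nat list \<Rightarrow> (box \<Rightarrow> 'a::linorder) \<Rightarrow> nat \<Rightarrow> nat \<Rightarrow> bool" where
  "step_ok \<mu> \<tau> c j \<longleftrightarrow> \<tau> (c, j) \<le> \<tau> (c, j - 1) \<and>
     (\<forall>d<length \<mu>. d \<noteq> c \<and> (if c < d then j \<le> Suc (\<mu> ! d) else j \<le> \<mu> ! d) \<longrightarrow>
        \<tau> (d, if d < c then j else j - 1) \<noteq> \<tau> (c, j) \<and>
        (\<mu> ! d < \<mu> ! c \<or> \<mu> ! d = \<mu> ! c \<and> d < c \<longrightarrow>
          \<not> (\<tau> (c, j) \<le> \<tau> (d, if d < c then j else j - 1) \<and>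
             \<tau> (d, if d < c then j else j - 1) \<le> \<tau> (c, j - 1))))"

lemma dg_iff: "(c, j) \<in> dg \<mu> \<longleftrightarrow> c < length \<mu> \<and> 1 \<le> j \<and> j \<le> \<mu> ! c"
  by (simp add: dg_def)

lemma dg_hat_iff: "(c, j) \<in> dg_hat \<mu> \<longleftrightarrow> c < length \<mu> \<and> j \<le> \<mu> ! c"
  by (auto simp: dg_hat_def dg_iff)

lemma step_ok_distinct:
  assumes "step_ok \<mu> \<tau> c j" "d < length \<mu>" "d \<noteq> c" "if c < d then j \<le> Suc (\<mu> ! d) else j \<le> \<mu> ! d"
  shows "\<tau> (d, if d < c then j else j - 1) \<noteq> \<tau> (c, j)"
  using assms unfolding step_ok_def by blast

text \<open>The box compared with the move of column \<open>c\<close> attacks both ends of the move,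
  so weak and strict betweenness coincide. The rank condition merges the height conditions of both
  triple types. Distinctness within row 0 has to be assumed, as no move ends there.\<close>

lemma valid_iff_step_ok:
  assumes inj: "inj_on (\<lambda>c. \<tau> (c, 0)) {..<length \<mu>}"
  shows "non_attacking \<mu> \<tau> \<and> column_decreasing \<mu> \<tau> \<and> (\<nexists>u v w. coinversion_triple \<mu> \<tau> u v w) \<longleftrightarrow>
    (\<forall>(c, j)\<in>dg \<mu>. step_ok \<mu> \<tau> c j)"
proof (intro iffI; (elim conjE)?)
  assume na: "non_attacking \<mu> \<tau>" and cd: "column_decreasing \<mu> \<tau>"
    and tr: "\<nexists>u v w. coinversion_triple \<mu> \<tau> u v w"
  show "\<forall>(c, j)\<in>dg \<mu>. step_ok \<mu> \<tau> c j"
  proof (clarify)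
    fix c j assume cj: "(c, j) \<in> dg \<mu>"
    then have cj': "c < length \<mu>" "1 \<le> j" "j \<le> \<mu> ! c" by (auto simp: dg_iff)
    have le: "\<tau> (c, j) \<le> \<tau> (c, j - 1)" using cd cj by (auto simp: column_decreasing_def)
    show "step_ok \<mu> \<tau> c j"
      unfolding step_ok_def
    proof (intro conjI le allI impI; elim conjE)
      fix d assume d: "d < length \<mu>" "d \<noteq> c" "if c < d then j \<le> Suc (\<mu> ! d) else j \<le> \<mu> ! d"
      let ?y = "(d, if d < c then j else j - 1)"
      have y: "?y \<in> dg_hat \<mu>" using d cj' by (auto simp: dg_hat_iff)
      have cj1: "(c, j) \<in> dg_hat \<mu>" "(c, j - 1) \<in> dg_hat \<mu>" using cj' by (auto simp: dg_hat_iff)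
      have "attack (c, j) ?y" using d cj' by (cases "d < c") auto
      then show ne: "\<tau> ?y \<noteq> \<tau> (c, j)" using na y cj1 unfolding non_attacking_def by metis
      have "attack ?y (c, j - 1)" using d cj' by (cases "d < c") auto
      then have ne': "\<tau> ?y \<noteq> \<tau> (c, j - 1)" using na y cj1 unfolding non_attacking_def by blast
      assume low: "\<mu> ! d < \<mu> ! c \<or> \<mu> ! d = \<mu> ! c \<and> d < c"
      show "\<not> (\<tau> (c, j) \<le> \<tau> ?y \<and> \<tau> ?y \<le> \<tau> (c, j - 1))"
      proof
        assume "\<tau> (c, j) \<le> \<tau> ?y \<and> \<tau> ?y \<le> \<tau> (c, j - 1)"
        then have lt: "\<tau> (c, j) < \<tau> ?y" "\<tau> ?y < \<tau> (c, j - 1)" using ne ne' by auto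
        have "\<exists>i j0 i'. 1 \<le> j0 \<and> (c, j) = (i, j0) \<and> (c, j - 1) = (i, j0 - 1) \<and>
          (?y = (i', j0 - 1) \<and> i < i' \<and> \<mu> ! i' < \<mu> ! i \<or>
           ?y = (i', j0) \<and> i' < i \<and> \<mu> ! i' \<le> \<mu> ! i)"
          by (rule exI[of _ c], rule exI[of _ j], rule exI[of _ d]) (use d low cj' in auto)
        then have "coinversion_triple \<mu> \<tau> (c, j) ?y (c, j - 1)"
          unfolding coinversion_triple_def using y cj1 lt by blast
        then show False using tr by blast
      qed
    qed
  qed
next
  assume ok: "\<forall>(c, j)\<in>dg \<mu>. step_ok \<mu> \<tau> c j"
  then have ok': "step_ok \<mu> \<tau> c j" if "c < length \<mu>" "1 \<le> j" "j \<le> \<mu> ! c" for c j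
    using that by (auto simp: dg_iff)
  have le: "\<tau> (c, j) \<le> \<tau> (c, j - 1)" if "(c, j) \<in> dg \<mu>" for c j
    using ok that unfolding step_ok_def by blast
  have row: "\<tau> (c, j) \<noteq> \<tau> (d, j)"
    if "c < d" "(c, j) \<in> dg_hat \<mu>" "(d, j) \<in> dg_hat \<mu>" for c d j
  proof (cases "j = 0")
    case True
    then show ?thesis using inj_onD[OF inj, of c d] that by (auto simp: dg_hat_iff)
  next
    case False
    then show ?thesis
      using step_ok_distinct[of \<mu> \<tau> d j c] ok'[of d j] that by (auto simp: dg_hat_iff)
  qed
  have diag: "\<tau> (c, Suc j) \<noteq> \<tau> (d, j)"
    if "c < d" "(c, Suc j) \<in> dg_hat \<mu>" "(d, j) \<in> dg_hat \<mu>" for c d j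
    using step_ok_distinct[of \<mu> \<tau> c "Suc j" d] ok'[of c "Suc j"] that by (auto simp: dg_hat_iff)
  have "non_attacking \<mu> \<tau>"
    unfolding non_attacking_def
  proof (intro ballI impI)
    fix u v assume uv: "u \<in> dg_hat \<mu>" "v \<in> dg_hat \<mu>" "attack u v"
    obtain c j d k where [simp]: "u = (c, j)" "v = (d, k)" by (cases u, cases v)
    consider "j = k" "c < d" | "j = k" "d < c" | "j = Suc k" "c < d" | "k = Suc j" "d < c"
      using uv(3) by fastforce
    then show "\<tau> u \<noteq> \<tau> v"
      using row[of c d j] row[of d c j] diag[of c d k] diag[of d c j] uv by cases auto
  qed
  moreover have "column_decreasing \<mu> \<tau>" using le by (auto simp: column_decreasing_def)
  moreover have "\<not> coinversion_triple \<mu> \<tau> u v w" for u v w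
  proof
    assume t: "coinversion_triple \<mu> \<tau> u v w"
    then obtain i j i' where ij: "1 \<le> j" "u = (i, j)" "w = (i, j - 1)"
      and v: "v = (i', j - 1) \<and> i < i' \<and> \<mu> ! i' < \<mu> ! i \<or> v = (i', j) \<and> i' < i \<and> \<mu> ! i' \<le> \<mu> ! i"
      unfolding coinversion_triple_def by blast
    have mem: "u \<in> dg_hat \<mu>" "v \<in> dg_hat \<mu>"
      and ord: "\<tau> u < \<tau> v \<and> \<tau> v < \<tau> w \<or> \<tau> v < \<tau> w \<and> \<tau> w < \<tau> u \<or> \<tau> w < \<tau> u \<and> \<tau> u < \<tau> v"
      using t unfolding coinversion_triple_def by blast+
    have dgu: "(i, j) \<in> dg \<mu>" using mem ij by (auto simp: dg_iff dg_hat_iff)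
    \<comment> \<open>Monotonicity of columns excludes two of the three cyclic orders of a
      triple.\<close>
    have "\<tau> u \<le> \<tau> w" using le[OF dgu] ij by simp
    then have lt: "\<tau> u < \<tau> v" "\<tau> v < \<tau> w" using ord by auto
    have v': "v = (i', if i' < i then j else j - 1)" "i' \<noteq> i" "i' < length \<mu>"
      "if i < i' then j \<le> Suc (\<mu> ! i') else j \<le> \<mu> ! i'" "\<mu> ! i' < \<mu> ! i \<or> \<mu> ! i' = \<mu> ! i \<and> i' < i"
      using v mem by (auto simp: dg_hat_iff)
    have "step_ok \<mu> \<tau> i j" using ok dgu by blast
    then have "\<not> (\<tau> u \<le> \<tau> v \<and> \<tau> v \<le> \<tau> w)"
      using v' unfolding step_ok_def ij v'(1) by blast
    then show False using lt by auto
  qed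
  ultimately show "non_attacking \<mu> \<tau> \<and> column_decreasing \<mu> \<tau> \<and> (\<nexists>u v w. coinversion_triple \<mu> \<tau> u v w)"
    by blast
qed

section \<open>Fillings as runs of the process\<close>

definition boxes_from :: "nat list \<Rightarrow> nat \<Rightarrow> nat \<Rightarrow> box set" where
  "boxes_from \<mu> j c = {(d, k) \<in> dg \<mu>. j < k \<or> j = k \<and> c \<le> d}"

definition completions :: "nat list \<Rightarrow> nat \<Rightarrow> nat \<Rightarrow> (box \<Rightarrow> nat) \<Rightarrow> (box \<Rightarrow> nat) set" where
  "completions \<mu> j c \<tau> = {\<tau>'. (\<forall>b. b \<notin> boxes_from \<mu> j c \<longrightarrow> \<tau>' b = \<tau> b) \<and>
     (\<forall>(d, k)\<in>boxes_from \<mu> j c. step_ok \<mu> \<tau>' d k)}"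

lemma finite_dg [simp]: "finite (dg \<mu>)"
proof -
  have "dg \<mu> = Sigma {..<length \<mu>} (\<lambda>c. {1..\<mu> ! c})" by (auto simp: dg_def)
  then show ?thesis by simp
qed

lemma finite_boxes_from [simp]: "finite (boxes_from \<mu> j c)"
  by (rule finite_subset[OF _ finite_dg[of \<mu>]]) (auto simp: boxes_from_def)

text \<open>The positions record the current label of each active column: row \<open>j\<close> to
  the left of \<open>c\<close>, row \<open>j - 1\<close> from \<open>c\<close> on. Summing over the
  move of \<open>c\<close> sorts the completions by their value at \<open>(c, j)\<close>.\<close>

lemma process_sum_completions:
  assumes tb: "tall_bound \<mu> B" and "c \<le> length \<mu>" "1 \<le> j"
    "\<And>d. d \<in> set (actions \<mu> B j c) \<Longrightarrow> p d = \<tau> (d, if d < c then j else j - 1)"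
  shows "finite (completions \<mu> j c \<tau>) \<and>
    process_sum x (column_rank \<mu>) (actions \<mu> B j c) p =
      (\<Sum>\<tau>'\<in>completions \<mu> j c \<tau>. \<Prod>b\<in>boxes_from \<mu> j c. x (\<tau>' b))"
  using assms(2-)
proof (induction j c arbitrary: p \<tau> rule: position_induct[where B = B])
  case (stop j c)
  have "boxes_from \<mu> j c = {}"
  proof -
    have "k < j" if "(d, k) \<in> dg \<mu>" for d k
    proof -
      have "Suc (\<mu> ! d) < B" using that tb by (simp add: dg_iff tall_bound_def)
      then show ?thesis using that stop.hyps by (simp add: dg_iff)
    qed
    then show ?thesis unfolding boxes_from_def by (auto dest: less_asym)
  qed
  moreover from this have "completions \<mu> j c \<tau> = {\<tau>}" by (auto simp: completions_def)
  ultimately show ?case using stop.hyps by (simp add: actions_stop)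
next
  case (round j)
  have bf: "boxes_from \<mu> j (length \<mu>) = boxes_from \<mu> (Suc j) 0"
    by (auto simp: boxes_from_def dg_iff)
  then have "completions \<mu> j (length \<mu>) \<tau> = completions \<mu> (Suc j) 0 \<tau>"
    by (simp add: completions_def)
  moreover have "p d = \<tau> (d, j)" if "d \<in> set (actions \<mu> B (Suc j) 0)" for d
    using round.prems(2)[of d] that round.hyps
    by (simp add: actions_round in_set_actions[OF tb])
  ultimately show ?case
    using round.IH[of p \<tau>] round.hyps bf by (simp add: actions_round)
next
  case (column j c)
  let ?R = "actions \<mu> B j (Suc c)"
  have mem: "d \<in> set ?R \<longleftrightarrow> d < length \<mu> \<and> (if Suc c \<le> d then j \<le> Suc (\<mu> ! d) else j \<le> \<mu> ! d)" for d
    by (rule in_set_actions[OF tb]) (use column.hyps in simp)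
  have L: "actions \<mu> B j c = (if j \<le> Suc (\<mu> ! c) then c # ?R else ?R)"
    using column.hyps by (simp add: actions_column)
  have pR: "p d = \<tau> (d, if d < c then j else j - 1)" if "d \<in> set ?R" for d
    using column.prems(2)[of d] that unfolding L by (auto split: if_splits)
  show ?case
  proof (cases "j \<le> \<mu> ! c")
    \<comment> \<open>Column \<open>c\<close> has no box in row \<open>j\<close>: it is either
      removed right now or was removed before.\<close>
    case False
    then have cR: "c \<notin> set ?R" by (simp add: mem)
    have bf: "boxes_from \<mu> j c = boxes_from \<mu> j (Suc c)"
    proof -
      have "(d, k) \<in> boxes_from \<mu> j c \<longleftrightarrow> (d, k) \<in> boxes_from \<mu> j (Suc c)" for d k
        using False by (cases "d = c") (auto simp: boxes_from_def dg_iff)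
      then show ?thesis by (intro set_eqI) (simp only: split_paired_all)
    qed
    then have "completions \<mu> j c \<tau> = completions \<mu> j (Suc c) \<tau>"
      by (simp add: completions_def)
    moreover have "p d = \<tau> (d, if d < Suc c then j else j - 1)" if "d \<in> set ?R" for d
    proof -
      have "d < Suc c \<longleftrightarrow> d < c" using that cR by (metis less_Suc_eq)
      then show ?thesis using pR[OF that] by simp
    qed
    ultimately show ?thesis
      using column.IH[of p \<tau>] column.prems(1) bf cR unfolding L by simp
  next
    case True
    then have cR: "c \<in> set ?R" using column.hyps by (simp add: mem)
    have pc: "p c = \<tau> (c, j - 1)" using pR[OF cR] by simp
    have bf: "boxes_from \<mu> j c = insert (c, j) (boxes_from \<mu> j (Suc c))"
    proof -
      have "(d, k) \<in> boxes_from \<mu> j c \<longleftrightarrow> (d, k) = (c, j) \<or> (d, k) \<in> boxes_from \<mu> j (Suc c)" for d k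
        using True column.hyps(1) column.prems(1)
        by (cases "d = c") (auto simp: boxes_from_def dg_iff)
      then show ?thesis by (intro set_eqI) (simp only: split_paired_all insert_iff)
    qed
    have nbf: "(c, j) \<notin> boxes_from \<mu> j (Suc c)" by (auto simp: boxes_from_def)
    define U where "U = {u. may_move (column_rank \<mu>) (set ?R) p c u}"
    have finU: "finite U" by (simp add: U_def)
    let ?C = "\<lambda>u. completions \<mu> j (Suc c) (\<tau>((c, j) := u))"
    have Ciff: "\<tau>' \<in> completions \<mu> j c \<tau> \<longleftrightarrow> \<tau>' (c, j) \<in> U \<and> \<tau>' \<in> ?C (\<tau>' (c, j))" for \<tau>'
    proof (cases "\<forall>b. b \<notin> boxes_from \<mu> j c \<longrightarrow> \<tau>' b = \<tau> b")
      case False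
      then show ?thesis using bf by (auto simp: completions_def)
    next
      case agree: True
      have fr: "\<tau>' (d, if d < c then j else j - 1) = p d" if "d \<in> set ?R" "d \<noteq> c" for d
      proof -
        have "(d, if d < c then j else j - 1) \<notin> boxes_from \<mu> j c"
          using that column.prems(1) by (auto simp: boxes_from_def)
        then show ?thesis using agree pR[OF that(1)] by simp
      qed
      have base: "\<tau>' (c, j - 1) = p c"
      proof -
        have "(c, j - 1) \<notin> boxes_from \<mu> j c" using column.prems(1) by (auto simp: boxes_from_def)
        then show ?thesis using agree pc by simp
      qed
      have "step_ok \<mu> \<tau>' c j \<longleftrightarrow> \<tau>' (c, j) \<in> U"
      proof -
        have lo: "column_rank \<mu> d < column_rank \<mu> c \<longleftrightarrow> \<mu> ! d < \<mu> ! c \<or> \<mu> ! d = \<mu> ! c \<and> d < c"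
          if "d < length \<mu>" for d
          using that column.hyps by (simp add: column_rank_less_iff)
        have memR: "d \<in> set ?R - {c} \<longleftrightarrow>
          d < length \<mu> \<and> d \<noteq> c \<and> (if c < d then j \<le> Suc (\<mu> ! d) else j \<le> \<mu> ! d)" for d
          by (auto simp: mem Suc_le_eq)
        have "step_ok \<mu> \<tau>' c j \<longleftrightarrow> \<tau>' (c, j) \<le> \<tau>' (c, j - 1) \<and>
          (\<forall>d\<in>set ?R - {c}. \<tau>' (d, if d < c then j else j - 1) \<noteq> \<tau>' (c, j) \<and>
            (column_rank \<mu> d < column_rank \<mu> c \<longrightarrow>
              \<not> (\<tau>' (c, j) \<le> \<tau>' (d, if d < c then j else j - 1) \<and>
                 \<tau>' (d, if d < c then j else j - 1) \<le> \<tau>' (c, j - 1))))"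
          unfolding step_ok_def Ball_def memR using lo by blast
        also have "\<dots> \<longleftrightarrow> may_move (column_rank \<mu>) (set ?R) p c (\<tau>' (c, j))"
          unfolding may_move_def base
          by (intro conj_cong refl ball_cong) (use fr in auto)
        finally show ?thesis by (simp add: U_def)
      qed
      then show ?thesis using bf nbf agree unfolding completions_def by auto
    qed
    have IH: "finite (?C u) \<and> process_sum x (column_rank \<mu>) ?R (p(c := u)) =
        (\<Sum>\<tau>'\<in>?C u. \<Prod>b\<in>boxes_from \<mu> j (Suc c). x (\<tau>' b))" for u
    proof (rule column.IH[OF column.prems(1)])
      fix d assume d: "d \<in> set ?R"
      show "(p(c := u)) d = (\<tau>((c, j) := u)) (d, if d < Suc c then j else j - 1)"
        using pR[OF d] column.prems(1) by (auto simp: less_Suc_eq)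
    qed
    have Cc: "\<tau>' (c, j) = u" if "\<tau>' \<in> ?C u" for \<tau>' u
      using that nbf by (auto simp: completions_def)
    have un: "completions \<mu> j c \<tau> = (\<Union>u\<in>U. ?C u)"
    proof (rule set_eqI)
      fix \<tau>'
      show "\<tau>' \<in> completions \<mu> j c \<tau> \<longleftrightarrow> \<tau>' \<in> (\<Union>u\<in>U. ?C u)"
        unfolding Ciff using Cc by fastforce
    qed
    have "process_sum x (column_rank \<mu>) (actions \<mu> B j c) p =
      (\<Sum>u\<in>U. x u * process_sum x (column_rank \<mu>) ?R (p(c := u)))"
      unfolding L using True cR by (simp add: U_def)
    also have "\<dots> = (\<Sum>u\<in>U. \<Sum>\<tau>'\<in>?C u. \<Prod>b\<in>boxes_from \<mu> j c. x (\<tau>' b))"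
    proof (rule sum.cong[OF refl])
      fix u assume "u \<in> U"
      have "x u * (\<Sum>\<tau>'\<in>?C u. \<Prod>b\<in>boxes_from \<mu> j (Suc c). x (\<tau>' b)) =
        (\<Sum>\<tau>'\<in>?C u. x (\<tau>' (c, j)) * (\<Prod>b\<in>boxes_from \<mu> j (Suc c). x (\<tau>' b)))"
        unfolding sum_distrib_left by (rule sum.cong) (auto simp: Cc)
      then show "x u * process_sum x (column_rank \<mu>) ?R (p(c := u)) =
        (\<Sum>\<tau>'\<in>?C u. \<Prod>b\<in>boxes_from \<mu> j c. x (\<tau>' b))"
        unfolding bf using IH[of u] nbf by simp
    qed
    also have "\<dots> = (\<Sum>\<tau>'\<in>completions \<mu> j c \<tau>. \<Prod>b\<in>boxes_from \<mu> j c. x (\<tau>' b))"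
      unfolding un by (rule sum.UNION_disjoint[symmetric]) (use finU IH Cc in blast)+
    finally show ?thesis using un finU IH by simp
  qed
qed

text \<open>Outside the diagram, and in particular in the basement, a filling takes the column number as its
  value.\<close>

definition key_fillings :: "nat list \<Rightarrow> (box \<Rightarrow> nat) set" where
  "key_fillings \<mu> = {\<tau>. (\<forall>b. b \<notin> dg \<mu> \<longrightarrow> \<tau> b = fst b) \<and> (\<forall>(c, j)\<in>dg \<mu>. step_ok \<mu> \<tau> c j)}"

lemma process_sum_key_fillings:
  assumes "tall_bound \<mu> B"
  shows "finite (key_fillings \<mu>)"
    and "process_sum x (column_rank \<mu>) (actions \<mu> B 1 0) id =
      (\<Sum>\<tau>\<in>key_fillings \<mu>. \<Prod>b\<in>dg \<mu>. x (\<tau> b))"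
proof -
  have bf: "boxes_from \<mu> 1 0 = dg \<mu>" by (auto simp: boxes_from_def dg_iff)
  then have "completions \<mu> 1 0 fst = key_fillings \<mu>"
    unfolding completions_def key_fillings_def by simp
  then show "finite (key_fillings \<mu>)"
    "process_sum x (column_rank \<mu>) (actions \<mu> B 1 0) id =
      (\<Sum>\<tau>\<in>key_fillings \<mu>. \<Prod>b\<in>dg \<mu>. x (\<tau> b))"
    using process_sum_completions[OF assms, of 0 1 id fst x] bf by simp_all
qed

lemma tall_bound_exists: "\<exists>B. tall_bound \<mu> B"
proof
  show "tall_bound \<mu> (Suc (Suc (sum_list \<mu>)))"
    by (auto simp: tall_bound_def less_Suc_eq_le elem_le_sum_list)
qed

text \<open>In each row the columns to the left are at least as tall and already occupy all smaller
  values, while monotonicity forbids larger ones; no label can move.\<close>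

lemma key_fillings_sorted:
  assumes "sorted_wrt (\<ge>) \<mu>"
  shows "key_fillings \<mu> = {fst}"
proof (intro set_eqI iffI)
  fix \<tau> assume t: "\<tau> \<in> key_fillings \<mu>"
  have ok: "step_ok \<mu> \<tau> c j" if "(c, j) \<in> dg \<mu>" for c j
    using t that by (auto simp: key_fillings_def)
  have off: "\<tau> b = fst b" if "b \<notin> dg \<mu>" for b
    using t that unfolding key_fillings_def by blast
  have "\<tau> (c, j) = c" for c j
  proof (induction j arbitrary: c)
    case 0
    then show ?case by (simp add: off dg_iff)
  next
    case (Suc j)
    show ?case
    proof (induction c rule: less_induct)
      case (less c)
      show ?case
      proof (cases "(c, Suc j) \<in> dg \<mu>")
        case False
        then show ?thesis by (simp add: off)
      next
        case True
        have "\<tau> (c, Suc j) \<le> c"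
          using ok[OF True] Suc.IH[of c] by (simp add: step_ok_def)
        moreover have "\<tau> (c, Suc j) \<noteq> d" if "d < c" for d
        proof -
          have "\<mu> ! d \<ge> \<mu> ! c"
            using assms that True by (auto simp: sorted_wrt_iff_nth_less dg_iff)
          then have "\<tau> (d, Suc j) \<noteq> \<tau> (c, Suc j)"
            using step_ok_distinct[OF ok[OF True], of d] that True by (auto simp: dg_iff)
          then show ?thesis using less.IH[OF that] by simp
        qed
        ultimately show ?thesis using nat_less_le by blast
      qed
    qed
  qed
  then show "\<tau> \<in> {fst}" by (auto simp: fun_eq_iff)
next
  fix \<tau> :: "box \<Rightarrow> nat" assume "\<tau> \<in> {fst}"
  then show "\<tau> \<in> key_fillings \<mu>" by (auto simp: key_fillings_def step_ok_def)
qed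

lemma prod_dg_columns: "(\<Prod>b\<in>dg \<mu>. f (fst b)) = (\<Prod>c<length \<mu>. f c ^ (\<mu> ! c))"
  for f :: "nat \<Rightarrow> 'r::comm_ring_1"
proof -
  have "dg \<mu> = Sigma {..<length \<mu>} (\<lambda>c. {1..\<mu> ! c})" by (auto simp: dg_def)
  moreover have "(\<Prod>c<length \<mu>. \<Prod>j\<in>{1..\<mu> ! c}. f c) =
    (\<Prod>(c, j)\<in>Sigma {..<length \<mu>} (\<lambda>c. {1..\<mu> ! c}). f c)"
    by (rule prod.Sigma) auto
  ultimately show ?thesis by (simp add: split_def)
qed

section \<open>Polynomials\<close>

lemma subst_superset:
  assumes "finite A" "Poly_Mapping.keys f \<subseteq> A"
  shows "subst \<phi> f = (\<Sum>m\<in>A. Poly_Mapping.single 0 (coeff f m) *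
     (\<Prod>v\<in>Poly_Mapping.keys m. \<phi> v ^ Poly_Mapping.lookup m v))"
  unfolding subst_def
  by (rule sum.mono_neutral_left) (use assms in \<open>auto simp: coeff_def in_keys_iff\<close>)

lemma subst_add: "subst \<phi> (f + g) = subst \<phi> f + subst \<phi> g"
proof -
  let ?A = "Poly_Mapping.keys f \<union> Poly_Mapping.keys g"
  have "subst \<phi> h = (\<Sum>m\<in>?A. Poly_Mapping.single 0 (coeff h m) *
     (\<Prod>v\<in>Poly_Mapping.keys m. \<phi> v ^ Poly_Mapping.lookup m v))" if "h \<in> {f, g, f + g}" for h
    by (rule subst_superset) (use that keys_add[of f g] in auto)
  then show ?thesis
    by (simp add: coeff_def lookup_add single_add algebra_simps sum.distrib)
qed

lemma subst_zero: "subst \<phi> 0 = 0"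
  by (simp add: subst_def)

lemma subst_sum: "subst \<phi> (sum f A) = (\<Sum>i\<in>A. subst \<phi> (f i))"
  by (induction A rule: infinite_finite_induct) (simp_all add: subst_add subst_zero)

lemma subst_single:
  "subst \<phi> (Poly_Mapping.single m c) = Poly_Mapping.single 0 c *
     (\<Prod>v\<in>Poly_Mapping.keys m. \<phi> v ^ Poly_Mapping.lookup m v)"
  by (subst subst_superset[of "{m}"]) (auto simp: coeff_def)

lemma monomial_expansion:
  "(\<Sum>m\<in>Poly_Mapping.keys f. Poly_Mapping.single m (Poly_Mapping.lookup f m)) = f"
proof (rule poly_mapping_eqI)
  fix k
  show "Poly_Mapping.lookup (\<Sum>m\<in>Poly_Mapping.keys f. Poly_Mapping.single m (Poly_Mapping.lookup f m)) k =
    Poly_Mapping.lookup f k"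
    by (simp add: lookup_sum lookup_single when_def in_keys_iff)
qed

lemma prod_keys_add:
  fixes \<phi> :: "'v \<Rightarrow> 'r::comm_semiring_1"
  shows "(\<Prod>v\<in>Poly_Mapping.keys (m + n). \<phi> v ^ Poly_Mapping.lookup (m + n) v) =
    (\<Prod>v\<in>Poly_Mapping.keys m. \<phi> v ^ Poly_Mapping.lookup m v) *
    (\<Prod>v\<in>Poly_Mapping.keys n. \<phi> v ^ Poly_Mapping.lookup (n :: 'v \<Rightarrow>\<^sub>0 nat) v)"
proof -
  let ?A = "Poly_Mapping.keys m \<union> Poly_Mapping.keys n"
  have "(\<Prod>v\<in>Poly_Mapping.keys k. \<phi> v ^ Poly_Mapping.lookup k v) =
    (\<Prod>v\<in>?A. \<phi> v ^ Poly_Mapping.lookup k v)" if "k = m \<or> k = n \<or> k = m + n" for k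
    by (rule prod.mono_neutral_left)
      (use that keys_add[of m n] in \<open>auto simp: in_keys_iff\<close>)
  from this[of m] this[of n] this[of "m + n"] show ?thesis
    by (simp only: simp_thms prod.distrib[symmetric] power_add[symmetric] lookup_add)
qed

lemma subst_mult:
  fixes \<phi> :: "'v \<Rightarrow> 'w mpoly"
  shows "subst \<phi> (f * g) = subst \<phi> f * subst \<phi> g"
proof -
  let ?t = "\<lambda>h m. Poly_Mapping.single m (Poly_Mapping.lookup h m)"
  have "f * g = (\<Sum>m\<in>Poly_Mapping.keys f. ?t f m) * (\<Sum>n\<in>Poly_Mapping.keys g. ?t g n)"
    by (simp only: monomial_expansion)
  also have "\<dots> = (\<Sum>m\<in>Poly_Mapping.keys f. \<Sum>n\<in>Poly_Mapping.keys g. ?t f m * ?t g n)"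
    by (rule sum_product)
  finally have "f * g = (\<Sum>m\<in>Poly_Mapping.keys f. \<Sum>n\<in>Poly_Mapping.keys g. ?t f m * ?t g n)" .
  then have "subst \<phi> (f * g) =
    (\<Sum>m\<in>Poly_Mapping.keys f. \<Sum>n\<in>Poly_Mapping.keys g. subst \<phi> (?t f m * ?t g n))"
    by (simp only: subst_sum)
  also have "\<dots> = (\<Sum>m\<in>Poly_Mapping.keys f. \<Sum>n\<in>Poly_Mapping.keys g. subst \<phi> (?t f m) * subst \<phi> (?t g n))"
  proof (intro sum.cong refl)
    fix m n
    show "subst \<phi> (?t f m * ?t g n) = subst \<phi> (?t f m) * subst \<phi> (?t g n)"
    proof -
      have s: "Poly_Mapping.single 0 (c * d) =
        (Poly_Mapping.single 0 c * Poly_Mapping.single 0 d :: 'w mpoly)" for c d :: rat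
        by (simp add: mult_single)
      show ?thesis
        unfolding mult_single subst_single prod_keys_add by (simp only: s ac_simps)
    qed
  qed
  also have "\<dots> = (\<Sum>m\<in>Poly_Mapping.keys f. subst \<phi> (?t f m)) * (\<Sum>n\<in>Poly_Mapping.keys g. subst \<phi> (?t g n))"
    by (simp add: sum_product)
  also have "\<dots> = subst \<phi> f * subst \<phi> g"
    by (simp add: subst_sum[symmetric] monomial_expansion)
  finally show ?thesis .
qed

lemma subst_one: "subst \<phi> 1 = 1"
  using subst_single[of \<phi> 0 1] by simp

lemma subst_var: "subst \<phi> (var v) = \<phi> v"
  by (simp add: var_def subst_single)

lemma subst_prod: "subst \<phi> (prod f A) = (\<Prod>i\<in>A. subst \<phi> (f i))"
  by (induction A rule: infinite_finite_induct) (simp_all add: subst_mult subst_one)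

lemma var_neq: "v \<noteq> w \<Longrightarrow> var v \<noteq> (var w :: 'v mpoly)"
proof
  assume "v \<noteq> w" "var v = (var w :: 'v mpoly)"
  then have "Poly_Mapping.lookup (var v :: 'v mpoly) (Poly_Mapping.single v 1) =
    Poly_Mapping.lookup (var w :: 'v mpoly) (Poly_Mapping.single v 1)" by simp
  moreover have "Poly_Mapping.single w (1::nat) \<noteq> Poly_Mapping.single v 1"
    using \<open>v \<noteq> w\<close> by (metis lookup_single_eq lookup_single_not_eq zero_neq_one)
  ultimately show False by (simp add: var_def lookup_single when_def)
qed

text \<open>The description in \<open>xi_vars\<close> determines its value because polynomials form
  an integral domain and the two variables differ.\<close>

lemma xi_eqI:
  assumes "(var i - var (Suc i)) * g =
     var i * f - var (Suc i) * subst (\<lambda>v. var (transpose i (Suc i) v)) f"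
  shows "xi i f = g"
  unfolding xi_def xi_vars_def
proof (rule the_equality[where a = g])
  fix h assume h: "(var i - var (Suc i)) * h =
     var i * f - var (Suc i) * subst (\<lambda>v. var (transpose i (Suc i) v)) f"
  have "var i - var (Suc i) \<noteq> (0 :: nat mpoly)" using var_neq[of i "Suc i"] by simp
  then show "h = g" using h assms by (metis mult_cancel_left)
qed (rule assms)

lemma prod_var:
  "finite A \<Longrightarrow> (\<Prod>b\<in>A. var (f b)) =
    Poly_Mapping.single (\<Sum>b\<in>A. Poly_Mapping.single (f b) 1) (1::rat)"
  by (induction A rule: finite_induct) (simp_all add: var_def mult_single)

interpretation var_swap: variable_swap var "subst (\<lambda>v. var (transpose i (Suc i) v))" i "Suc i" for i :: nat
  by unfold_locales (simp_all add: subst_add subst_mult subst_one subst_var transpose_apply_other)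

lemma xi_process_sum_var:
  assumes "tall_bound \<alpha> B" "Suc i < length \<alpha>" "\<alpha> ! i > \<alpha> ! Suc i"
  shows "xi i (process_sum var (column_rank \<alpha>) (actions \<alpha> B 1 0) id) =
    process_sum var (column_rank (swap_entries i \<alpha>)) (actions (swap_entries i \<alpha>) B 1 0) id"
  by (rule xi_eqI, rule var_swap.xi_process_sum_actions[OF assms])

section \<open>Key polynomials\<close>

definition key_gf :: "nat list \<Rightarrow> nat mpoly" where
  "key_gf \<mu> = (\<Sum>\<tau>\<in>key_fillings \<mu>. \<Prod>b\<in>dg \<mu>. var (\<tau> b))"

lemma swap_entries_swap_entries [simp]:
  "Suc i < length \<alpha> \<Longrightarrow> swap_entries i (swap_entries i \<alpha>) = \<alpha>"
  by (rule nth_equalityI) (simp_all add: nth_swap_entries)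

lemma is_key_family_key_gf: "is_key_family key_gf"
  unfolding is_key_family_def
proof (intro conjI allI impI; (elim conjE)?)
  fix \<alpha> :: "nat list" assume "sorted_wrt (\<ge>) \<alpha>"
  then show "key_gf \<alpha> = (\<Prod>i<length \<alpha>. var i ^ (\<alpha> ! i))"
    by (simp add: key_gf_def key_fillings_sorted prod_dg_columns)
next
  fix \<alpha> :: "nat list" and i assume i: "Suc i < length \<alpha>" "\<alpha> ! Suc i < \<alpha> ! i"
  obtain B where B: "tall_bound \<alpha> B" using tall_bound_exists by blast
  have B': "tall_bound (swap_entries i \<alpha>) B"
    using B i by (auto simp: tall_bound_def nth_swap_entries)
  show "key_gf (swap_entries i \<alpha>) = xi i (key_gf \<alpha>)"
    unfolding key_gf_def process_sum_key_fillings(2)[OF B, symmetric]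
      process_sum_key_fillings(2)[OF B', symmetric]
    by (rule xi_process_sum_var[OF B i, symmetric])
qed

text \<open>Undoing an ascent moves the larger entry to the smaller index and lowers the sum of
  \<open>k * \<alpha> ! k\<close>, so every composition is reached from a weakly decreasing
  one.\<close>

lemma is_key_family_unique:
  assumes "is_key_family K" "is_key_family K'"
  shows "K \<alpha> = K' \<alpha>"
proof (induction "\<Sum>k<length \<alpha>. k * \<alpha> ! k" arbitrary: \<alpha> rule: less_induct)
  case less
  show ?case
  proof (cases "sorted_wrt (\<ge>) \<alpha>")
    case True
    then show ?thesis using assms by (simp add: is_key_family_def)
  next
    case False
    have "transp ((\<ge>) :: nat \<Rightarrow> nat \<Rightarrow> bool)" by (auto simp: transp_def)
    then obtain i where i: "Suc i < length \<alpha>" "\<alpha> ! i < \<alpha> ! Suc i"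
      using False by (auto simp: sorted_wrt_iff_nth_Suc_transp not_le)
    define \<beta> where "\<beta> = swap_entries i \<alpha>"
    have \<beta>: "\<beta> ! i = \<alpha> ! Suc i" "\<beta> ! Suc i = \<alpha> ! i" "length \<beta> = length \<alpha>" "swap_entries i \<beta> = \<alpha>"
      using i by (simp_all add: \<beta>_def nth_swap_entries)
    have split: "(\<Sum>k<length \<alpha>. k * \<gamma> ! k) = i * \<gamma> ! i + Suc i * \<gamma> ! Suc i +
        (\<Sum>k\<in>{..<length \<alpha>} - {i} - {Suc i}. k * \<gamma> ! k)" for \<gamma> :: "nat list"
    proof -
      have "(\<Sum>k<length \<alpha>. k * \<gamma> ! k) = i * \<gamma> ! i + (\<Sum>k\<in>{..<length \<alpha>} - {i}. k * \<gamma> ! k)"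
        using i by (intro sum.remove) auto
      also have "(\<Sum>k\<in>{..<length \<alpha>} - {i}. k * \<gamma> ! k) = Suc i * \<gamma> ! Suc i +
        (\<Sum>k\<in>{..<length \<alpha>} - {i} - {Suc i}. k * \<gamma> ! k)"
        using i by (intro sum.remove) auto
      finally show ?thesis by simp
    qed
    have "(\<Sum>k\<in>{..<length \<alpha>} - {i} - {Suc i}. k * \<beta> ! k) =
        (\<Sum>k\<in>{..<length \<alpha>} - {i} - {Suc i}. k * \<alpha> ! k)"
      using i by (intro sum.cong refl) (simp add: \<beta>_def nth_swap_entries transpose_apply_other)
    then have "(\<Sum>k<length \<beta>. k * \<beta> ! k) < (\<Sum>k<length \<alpha>. k * \<alpha> ! k)"
      unfolding \<beta>(3) split using i \<beta> by simp
    then have "K \<beta> = K' \<beta>" by (rule less)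
    moreover have "K \<alpha> = xi i (K \<beta>)" "K' \<alpha> = xi i (K' \<beta>)"
      using assms i \<beta> unfolding is_key_family_def by metis+
    ultimately show ?thesis by simp
  qed
qed

theorem key_poly_eq_key_gf: "key_poly = key_gf"
  unfolding key_poly_def
  by (rule the_equality)
    (use is_key_family_key_gf is_key_family_unique in \<open>auto simp: fun_eq_iff\<close>)

text \<open>Legality of a move depends only on the relative order of labels and columns, so it
  survives order embeddings of both. Inserted empty columns are harmless.\<close>

lemma step_ok_transfer:
  assumes mono_e: "strict_mono_on {..<length \<mu>} e"
    and e: "\<And>c. c < length \<mu> \<Longrightarrow> e c < length \<gamma> \<and> \<gamma> ! e c = \<mu> ! c \<and> \<tau> (e c, 0) = e c"
    and zero: "\<And>d. d < length \<gamma> \<Longrightarrow> d \<notin> e ` {..<length \<mu>} \<Longrightarrow> \<gamma> ! d = 0 \<and> \<tau> (d, 0) = d"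
    and \<tau>: "\<And>b. b \<in> dg_hat \<mu> \<Longrightarrow> \<tau> (e (fst b), snd b) = \<phi> (\<rho> b)"
    and mono_\<phi>: "\<And>b b'. b \<in> dg_hat \<mu> \<Longrightarrow> b' \<in> dg_hat \<mu> \<Longrightarrow> \<phi> (\<rho> b) \<le> \<phi> (\<rho> b') \<longleftrightarrow> \<rho> b \<le> \<rho> b'"
    and cj: "(c, j) \<in> dg \<mu>"
  shows "step_ok \<gamma> \<tau> (e c) j \<longleftrightarrow> step_ok \<mu> (\<rho> :: box \<Rightarrow> 'a::linorder) c j"
proof -
  have c: "c < length \<mu>" "1 \<le> j" "j \<le> \<mu> ! c" using cj by (auto simp: dg_iff)
  have less_e: "e d < e d' \<longleftrightarrow> d < d'" if "d < length \<mu>" "d' < length \<mu>" for d d'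
    using strict_mono_on_less[OF mono_e] that by simp
  have le: "\<tau> (e d, k) \<le> \<tau> (e d', k') \<longleftrightarrow> \<rho> (d, k) \<le> \<rho> (d', k')"
    if "(d, k) \<in> dg_hat \<mu>" "(d', k') \<in> dg_hat \<mu>" for d k d' k'
    using \<tau>[of "(d, k)"] \<tau>[of "(d', k')"] mono_\<phi> that by simp
  have eq: "\<tau> (e d, k) = \<tau> (e d', k') \<longleftrightarrow> \<rho> (d, k) = \<rho> (d', k')"
    if "(d, k) \<in> dg_hat \<mu>" "(d', k') \<in> dg_hat \<mu>" for d k d' k'
    using le[OF that] le[OF that(2,1)] by (metis order_antisym order_refl)
  define A where "A = (\<lambda>d. d \<noteq> c \<and> (if c < d then j \<le> Suc (\<mu> ! d) else j \<le> \<mu> ! d))"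
  define Q where "Q = (\<lambda>d. \<rho> (d, if d < c then j else j - 1) \<noteq> \<rho> (c, j) \<and>
        (\<mu> ! d < \<mu> ! c \<or> \<mu> ! d = \<mu> ! c \<and> d < c \<longrightarrow>
          \<not> (\<rho> (c, j) \<le> \<rho> (d, if d < c then j else j - 1) \<and>
             \<rho> (d, if d < c then j else j - 1) \<le> \<rho> (c, j - 1))))"
  define A' where "A' = (\<lambda>d. d \<noteq> e c \<and> (if e c < d then j \<le> Suc (\<gamma> ! d) else j \<le> \<gamma> ! d))"
  define Q' where "Q' = (\<lambda>d. \<tau> (d, if d < e c then j else j - 1) \<noteq> \<tau> (e c, j) \<and>
        (\<gamma> ! d < \<gamma> ! e c \<or> \<gamma> ! d = \<gamma> ! e c \<and> d < e c \<longrightarrow>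
          \<not> (\<tau> (e c, j) \<le> \<tau> (d, if d < e c then j else j - 1) \<and>
             \<tau> (d, if d < e c then j else j - 1) \<le> \<tau> (e c, j - 1))))"
  have hat: "(c, j) \<in> dg_hat \<mu>" "(c, j - 1) \<in> dg_hat \<mu>" using c by (auto simp: dg_hat_iff)
  have AQ: "(A' (e d) \<longrightarrow> Q' (e d)) \<longleftrightarrow> (A d \<longrightarrow> Q d)" if d: "d < length \<mu>" for d
  proof -
    have A: "A' (e d) \<longleftrightarrow> A d"
      using less_e[OF d c(1)] less_e[OF c(1) d] e[OF d] unfolding A_def A'_def
      by (metis less_irrefl linorder_neqE_nat)
    have "Q' (e d) \<longleftrightarrow> Q d" if "A d"
    proof -
      have y: "(d, if d < c then j else j - 1) \<in> dg_hat \<mu>"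
        using that d by (auto simp: A_def dg_hat_iff split: if_splits)
      show ?thesis
        unfolding Q_def Q'_def less_e[OF d c(1)] eq[OF y hat(1)] le[OF hat(1) y] le[OF y hat(2)]
        using e[OF d] e[OF c(1)] by simp
    qed
    then show ?thesis using A by blast
  qed
  have zQ: "Q' d" if "d < length \<gamma>" "d \<notin> e ` {..<length \<mu>}" "A' d" "\<tau> (e c, j) \<le> \<tau> (e c, j - 1)" for d
  proof -
    \<comment> \<open>An empty column is present only for the columns to its left in row 1. There it
      carries the label \<open>d\<close>, which exceeds the starting value \<open>e c\<close> of the
      move.\<close>
    have "e c < d" "j = 1" using that zero[OF that(1,2)] c by (auto simp: A'_def split: if_splits)
    then show ?thesis using that(4) zero[OF that(1,2)] e[OF c(1)] by (auto simp: Q'_def)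
  qed
  have "step_ok \<gamma> \<tau> (e c) j \<longleftrightarrow> \<tau> (e c, j) \<le> \<tau> (e c, j - 1) \<and> (\<forall>d<length \<gamma>. A' d \<longrightarrow> Q' d)"
    unfolding step_ok_def A'_def Q'_def by blast
  also have "\<dots> \<longleftrightarrow> \<tau> (e c, j) \<le> \<tau> (e c, j - 1) \<and> (\<forall>d<length \<mu>. A' (e d) \<longrightarrow> Q' (e d))"
  proof -
    have "d < length \<gamma> \<and> (d \<in> e ` {..<length \<mu>} \<longleftrightarrow> (\<exists>d'<length \<mu>. d = e d')) \<or> \<not> d < length \<gamma>" for d
      by auto
    then show ?thesis using zQ e by (metis (no_types, lifting))
  qed
  also have "\<dots> \<longleftrightarrow> \<rho> (c, j) \<le> \<rho> (c, j - 1) \<and> (\<forall>d<length \<mu>. A d \<longrightarrow> Q d)"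
    using AQ le[OF hat] by auto
  also have "\<dots> \<longleftrightarrow> step_ok \<mu> \<rho> c j"
    unfolding step_ok_def A_def Q_def by blast
  finally show ?thesis .
qed

section \<open>Large alphabets\<close>

definition offset :: "nat list \<Rightarrow> nat \<Rightarrow> nat" where
  "offset xs j = sum_list (take j xs)"

lemma offset_Suc: "j < length xs \<Longrightarrow> offset xs (Suc j) = offset xs j + xs ! j"
  by (simp add: offset_def take_Suc_conv_app_nth)

lemma offset_less:
  assumes "j < j'" "j' \<le> length xs"
  shows "offset xs j + xs ! j \<le> offset xs j'"
  using assms
proof (induction j')
  case (Suc j')
  then show ?case by (cases "j = j'") (auto simp: offset_Suc)
qed simp

lemma nth_concat_offset:
  assumes "j < length xss" "k < length (xss ! j)"
  shows "offset (map length xss) j + k < length (concat xss)"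
    and "concat xss ! (offset (map length xss) j + k) = xss ! j ! k"
  using assms
proof (induction xss arbitrary: j)
  case (Cons xs xss)
  {
    case 1
    then show ?case using Cons.IH(1)[of "j - 1"] by (cases j) (auto simp: offset_def)
  next
    case 2
    then show ?case using Cons.IH(2)[of "j - 1"]
      by (cases j) (auto simp: offset_def nth_append add.assoc)
  }
qed simp_all

lemma concat_index_cases:
  assumes "i < length (concat xss)"
  obtains j k where "j < length xss" "k < length (xss ! j)" "i = offset (map length xss) j + k"
  using assms
proof (induction xss arbitrary: i thesis)
  case (Cons xs xss)
  show ?case
  proof (cases "i < length xs")
    case True
    then show ?thesis using Cons.prems(1)[of 0 i] by (simp add: offset_def)
  next
    case False
    then have "i - length xs < length (concat xss)" using Cons.prems(2) by simp
    then obtain j k where "j < length xss" "k < length (xss ! j)"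
      "i - length xs = offset (map length xss) j + k"
      using Cons.IH by blast
    then show ?thesis using Cons.prems(1)[of "Suc j" k] False by (simp add: offset_def)
  qed
qed simp

lemma length_prev: "length (prev lam) = plength lam"
  using length_filter_le[of "\<lambda>p. p \<noteq> 0" lam] by (simp add: prev_def plength_def)

section \<open>Coefficients on both sides as cardinalities\<close>

definition monomial_of :: "'b set \<Rightarrow> ('b \<Rightarrow> 'v) \<Rightarrow> 'v \<Rightarrow>\<^sub>0 nat" where
  "monomial_of S f = (\<Sum>b\<in>S. Poly_Mapping.single (f b) 1)"

lemma in_keys_monomial_of:
  assumes "finite S" "b \<in> S"
  shows "f b \<in> Poly_Mapping.keys (monomial_of S f)"
proof -
  have "1 \<le> (\<Sum>c\<in>S. Poly_Mapping.lookup (Poly_Mapping.single (f c) (1::nat)) (f b))"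
    using member_le_sum[of b S "\<lambda>c. Poly_Mapping.lookup (Poly_Mapping.single (f c) (1::nat)) (f b)"] assms
    by simp
  then show ?thesis by (simp add: monomial_of_def in_keys_iff lookup_sum)
qed

fun entry_var :: "entry \<Rightarrow> mvar" where
  "entry_var (Lab j k) = (j, k)"
| "entry_var (Base j k) = (j, k)"

lemma labelings_Lab:
  assumes "\<sigma> \<in> labelings lams" "b \<in> dg (shape lams)"
  shows "\<exists>j k. \<sigma> b = Lab j k \<and> j < length lams"
proof -
  have "\<sigma> \<in> dg (shape lams) \<rightarrow>\<^sub>E {Lab j k | j k. j < length lams}"
    using assms(1) unfolding labelings_def by blast
  from PiE_mem[OF this assms(2)] show ?thesis by blast
qed

text \<open>Regroups the product over boxes by the fibres of the label map.\<close>

lemma weight_eq: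
  assumes "\<sigma> \<in> labelings lams"
  shows "weight lams \<sigma> = Poly_Mapping.single (monomial_of (dg (shape lams)) (entry_var \<circ> \<sigma>)) 1"
proof -
  let ?S = "dg (shape lams)"
  have lab: "\<exists>j k. \<sigma> b = Lab j k" if "b \<in> ?S" for b
    using labelings_Lab[OF assms that] by blast
  have iff: "entry_var (\<sigma> b) = (j, k) \<longleftrightarrow> \<sigma> b = Lab j k" if "b \<in> ?S" for b j k
    using lab[OF that] by auto
  have im: "{(j, k). Lab j k \<in> \<sigma> ` ?S} = (entry_var \<circ> \<sigma>) ` ?S"
  proof (rule set_eqI)
    fix z :: mvar
    obtain j k where z: "z = (j, k)" by (cases z)
    show "z \<in> {(j, k). Lab j k \<in> \<sigma> ` ?S} \<longleftrightarrow> z \<in> (entry_var \<circ> \<sigma>) ` ?S"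
    proof -
      have "z \<in> (entry_var \<circ> \<sigma>) ` ?S \<longleftrightarrow> (\<exists>b\<in>?S. entry_var (\<sigma> b) = (j, k))"
        unfolding z image_iff comp_def by (auto simp: eq_commute)
      also have "\<dots> \<longleftrightarrow> (\<exists>b\<in>?S. \<sigma> b = Lab j k)"
        by (rule bex_cong[OF refl iff])
      finally show ?thesis unfolding z by (auto simp: image_iff eq_commute)
    qed
  qed
  have "Poly_Mapping.single (monomial_of ?S (entry_var \<circ> \<sigma>)) 1 = (\<Prod>b\<in>?S. var ((entry_var \<circ> \<sigma>) b))"
    unfolding monomial_of_def by (rule prod_var[symmetric]) simp
  also have "\<dots> = (\<Prod>z\<in>(entry_var \<circ> \<sigma>) ` ?S. \<Prod>b\<in>{b \<in> ?S. (entry_var \<circ> \<sigma>) b = z}. var ((entry_var \<circ> \<sigma>) b))"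
    by (rule prod.image_gen) simp
  also have "\<dots> = (\<Prod>z\<in>(entry_var \<circ> \<sigma>) ` ?S. case z of (j, k) \<Rightarrow> var (j, k) ^ card {b \<in> ?S. \<sigma> b = Lab j k})"
  proof (rule prod.cong[OF refl])
    fix z :: mvar
    obtain j k where z: "z = (j, k)" by (cases z)
    have "{b \<in> ?S. (entry_var \<circ> \<sigma>) b = z} = {b \<in> ?S. \<sigma> b = Lab j k}" using iff z by auto
    then show "(\<Prod>b\<in>{b \<in> ?S. (entry_var \<circ> \<sigma>) b = z}. var ((entry_var \<circ> \<sigma>) b)) =
        (case z of (j, k) \<Rightarrow> var (j, k) ^ card {b \<in> ?S. \<sigma> b = Lab j k})"
      using z iff by simp
  qed
  finally show ?thesis unfolding weight_def im by simp
qed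

lemma series_sum_weight:
  "series_sum (labelings lams) (weight lams) m =
     of_nat (card {\<sigma> \<in> labelings lams. monomial_of (dg (shape lams)) (entry_var \<circ> \<sigma>) = m})"
proof -
  let ?A = "{\<sigma> \<in> labelings lams. monomial_of (dg (shape lams)) (entry_var \<circ> \<sigma>) = m}"
  have c: "coeff (weight lams \<sigma>) m =
      (if monomial_of (dg (shape lams)) (entry_var \<circ> \<sigma>) = m then 1 else 0)"
    if "\<sigma> \<in> labelings lams" for \<sigma>
    unfolding weight_eq[OF that] by (simp add: coeff_def lookup_single when_def)
  have "{\<sigma> \<in> labelings lams. coeff (weight lams \<sigma>) m \<noteq> 0} = ?A"
    using c by (auto split: if_splits)
  then have "series_sum (labelings lams) (weight lams) m = (\<Sum>\<sigma>\<in>?A. coeff (weight lams \<sigma>) m)"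
    by (simp only: series_sum_def)
  also have "\<dots> = (\<Sum>\<sigma>\<in>?A. 1)" by (rule sum.cong) (use c in auto)
  finally show ?thesis by simp
qed

lemma coeff_multi_schur_poly:
  "coeff (multi_schur_poly lams ns) m = of_nat (card {\<tau> \<in> key_fillings (padded_comp lams ns).
     monomial_of (dg (padded_comp lams ns)) (\<lambda>b. block_vars ns ! \<tau> b) = m})"
proof -
  let ?\<gamma> = "padded_comp lams ns"
  have fin: "finite (key_fillings ?\<gamma>)"
    using process_sum_key_fillings(1) tall_bound_exists by blast
  have "multi_schur_poly lams ns = (\<Sum>\<tau>\<in>key_fillings ?\<gamma>. \<Prod>b\<in>dg ?\<gamma>. var (block_vars ns ! \<tau> b))"
    unfolding multi_schur_poly_def key_poly_eq_key_gf key_gf_def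
    by (simp add: subst_sum subst_prod subst_var)
  also have "\<dots> = (\<Sum>\<tau>\<in>key_fillings ?\<gamma>. Poly_Mapping.single (monomial_of (dg ?\<gamma>) (\<lambda>b. block_vars ns ! \<tau> b)) 1)"
    unfolding monomial_of_def by (simp add: prod_var)
  finally have "coeff (multi_schur_poly lams ns) m = (\<Sum>\<tau>\<in>key_fillings ?\<gamma>.
      if monomial_of (dg ?\<gamma>) (\<lambda>b. block_vars ns ! \<tau> b) = m then 1 else 0)"
    by (simp add: coeff_def lookup_sum lookup_single when_def)
  also have "\<dots> = (\<Sum>\<tau>\<in>{\<tau> \<in> key_fillings ?\<gamma>. monomial_of (dg ?\<gamma>) (\<lambda>b. block_vars ns ! \<tau> b) = m}. 1)"
    by (rule sum.inter_filter[OF fin, symmetric])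
  finally show ?thesis by simp
qed

text \<open>Alphabets so large that the labels in the support of \<open>m\<close> lie below the positions of the nonzero
  columns of each block.\<close>

locale large_alphabets =
  fixes lams :: "nat list list" and ns :: "nat list" and m :: "mvar \<Rightarrow>\<^sub>0 nat"
  assumes length_ns: "length ns = length lams"
    and plength_le: "\<And>j. j < length lams \<Longrightarrow> plength (lams ! j) \<le> ns ! j"
    and large: "\<And>j j' k. j < length lams \<Longrightarrow> (j', k) \<in> Poly_Mapping.keys m \<Longrightarrow>
      k + plength (lams ! j) < ns ! j"
begin

abbreviation \<mu> where "\<mu> \<equiv> shape lams"
abbreviation \<gamma> where "\<gamma> \<equiv> padded_comp lams ns"
abbreviation ls where "ls \<equiv> map plength lams"

text \<open>A basement symbol is sent to the column of the padded composition holding the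
  corresponding nonzero part, so that it agrees with the basement value of that column.\<close>

fun embed :: "entry \<Rightarrow> nat" where
  "embed (Lab j k) = offset ns j + k"
| "embed (Base j k) = offset ns j + (ns ! j - plength (lams ! j)) + k"

text \<open>On these entries \<open>embed\<close> respects the order: within a block the labels stay
  below the columns of the nonzero parts, and distinct blocks do not overlap.\<close>

fun small :: "entry \<Rightarrow> bool" where
  "small (Lab j k) \<longleftrightarrow> j < length lams \<and> k + plength (lams ! j) < ns ! j"
| "small (Base j k) \<longleftrightarrow> j < length lams \<and> k < plength (lams ! j)"

definition pos :: "nat \<Rightarrow> nat" where
  "pos c = embed (basement lams ! c)"

lemma embed_less:
  assumes "small x" "small y" "x < y"
  shows "embed x < embed y"
proof -
  have 1: "offset ns j + ns ! j \<le> offset ns j'" if "j < j'" "j' < length lams" for j j'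
    by (rule offset_less) (use that length_ns in auto)
  show ?thesis
    using assms
  proof (cases x; cases y)
    fix j k j' k' assume "x = Lab j k" "y = Lab j' k'"
    then show ?thesis using assms 1[of j j'] by fastforce
  next
    fix j k j' k' assume "x = Lab j k" "y = Base j' k'"
    then show ?thesis using assms 1[of j j'] by fastforce
  next
    fix j k j' k' assume "x = Base j k" "y = Lab j' k'"
    then show ?thesis using assms 1[of j j'] plength_le[of j] by fastforce
  next
    fix j k j' k' assume "x = Base j k" "y = Base j' k'"
    then show ?thesis using assms 1[of j j'] plength_le[of j] by fastforce
  qed
qed

lemma embed_le_iff: "small x \<Longrightarrow> small y \<Longrightarrow> embed x \<le> embed y \<longleftrightarrow> x \<le> y"
  using embed_less[of x y] embed_less[of y x] by (cases x y rule: linorder_cases) auto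

lemma map_length_basement:
  "map length (map (\<lambda>i. map (Base i) [0..<plength (lams ! i)]) [0..<length lams]) = ls"
  by (rule nth_equalityI) simp_all

lemma map_length_shape: "map length (map prev lams) = ls"
  by (simp add: length_prev)

lemma map_length_padded:
  "map length (map2 (\<lambda>lam n. replicate (n - plength lam) 0 @ prev lam) lams ns) = ns"
  by (rule nth_equalityI) (use length_ns plength_le in \<open>auto simp: length_prev\<close>)

lemma map_length_block_vars: "map length (map (\<lambda>j. map (Pair j) [0..<ns ! j]) [0..<length ns]) = ns"
  by (rule nth_equalityI) simp_all

lemma nth_basement:
  assumes "j < length lams" "k < plength (lams ! j)"
  shows "basement lams ! (offset ls j + k) = Base j k" "offset ls j + k < length \<mu>"
    "\<mu> ! (offset ls j + k) = prev (lams ! j) ! k"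
proof -
  show "basement lams ! (offset ls j + k) = Base j k"
    using nth_concat_offset(2)[of j "map (\<lambda>i. map (Base i) [0..<plength (lams ! i)]) [0..<length lams]" k]
      assms unfolding map_length_basement basement_def by simp
  show "offset ls j + k < length \<mu>" "\<mu> ! (offset ls j + k) = prev (lams ! j) ! k"
    using nth_concat_offset[of j "map prev lams" k] assms
    unfolding map_length_shape shape_def by (simp_all add: length_prev)
qed

lemma column_cases:
  assumes "c < length \<mu>"
  obtains j k where "j < length lams" "k < plength (lams ! j)" "c = offset ls j + k"
proof -
  obtain j k where "j < length (map prev lams)" "k < length (map prev lams ! j)"
    "c = offset (map length (map prev lams)) j + k"
    using concat_index_cases assms unfolding shape_def by blast
  then show thesis using that unfolding map_length_shape by (simp add: length_prev)
qed

lemma nth_padded: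
  assumes "j < length lams" "t < ns ! j"
  shows "offset ns j + t < length \<gamma>"
    and "\<gamma> ! (offset ns j + t) = (if t < ns ! j - plength (lams ! j) then 0
       else prev (lams ! j) ! (t - (ns ! j - plength (lams ! j))))"
  using nth_concat_offset[of j "map2 (\<lambda>lam n. replicate (n - plength lam) 0 @ prev lam) lams ns" t]
    assms length_ns plength_le[OF assms(1)]
  unfolding map_length_padded padded_comp_def by (simp_all add: nth_append length_prev)

lemma padded_cases:
  assumes "i < length \<gamma>"
  obtains j t where "j < length lams" "t < ns ! j" "i = offset ns j + t"
proof -
  let ?xss = "map2 (\<lambda>lam n. replicate (n - plength lam) 0 @ prev lam) lams ns"
  obtain j t where j: "j < length ?xss" "t < length (?xss ! j)"
    "i = offset (map length ?xss) j + t"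
    using concat_index_cases assms unfolding padded_comp_def by blast
  have jl: "j < length lams" "j < length ns" using j(1) length_ns by simp_all
  then have "length (?xss ! j) = ns ! j"
    using plength_le[of j] by (simp add: length_prev)
  then show thesis using that[of j t] j(2,3) jl(1) unfolding map_length_padded by simp
qed

lemma nth_block_vars:
  assumes "j < length lams" "t < ns ! j"
  shows "block_vars ns ! (offset ns j + t) = (j, t)"
  using nth_concat_offset(2)[of j "map (\<lambda>j. map (Pair j) [0..<ns ! j]) [0..<length ns]" t]
    assms length_ns
  unfolding map_length_block_vars block_vars_def by simp

lemma small_basement: "c < length \<mu> \<Longrightarrow> small (basement lams ! c)"
  by (erule column_cases) (simp add: nth_basement)

lemma basement_less:
  assumes "c < d" "d < length \<mu>"
  shows "basement lams ! c < basement lams ! d"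
proof -
  obtain j k where j: "j < length lams" "k < plength (lams ! j)" "c = offset ls j + k"
    using column_cases[of c] assms by auto
  obtain j' k' where j': "j' < length lams" "k' < plength (lams ! j')" "d = offset ls j' + k'"
    using column_cases[of d] assms by auto
  have "\<not> j' < j"
  proof
    assume "j' < j"
    then have "offset ls j' + ls ! j' \<le> offset ls j" using j by (intro offset_less) auto
    then show False using j j' assms by auto
  qed
  then have "j < j' \<or> j = j' \<and> k < k'" using j j' assms by (cases j j' rule: linorder_cases) auto
  then show ?thesis using j j' by (auto simp: nth_basement)
qed

lemma pos_less: "c < d \<Longrightarrow> d < length \<mu> \<Longrightarrow> pos c < pos d"
  unfolding pos_def by (intro embed_less small_basement basement_less) auto

lemma strict_mono_pos: "strict_mono_on {..<length \<mu>} pos"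
  by (auto simp: strict_mono_on_def pos_less)

lemma inj_pos: "inj_on pos {..<length \<mu>}"
  by (rule strict_mono_on_imp_inj_on[OF strict_mono_pos])

lemma pos_column:
  assumes "j < length lams" "k < plength (lams ! j)"
  shows "pos (offset ls j + k) = offset ns j + (ns ! j - plength (lams ! j) + k)"
  using nth_basement(1)[OF assms] by (simp add: pos_def)

lemma pos_props:
  assumes "c < length \<mu>"
  shows "pos c < length \<gamma>" "\<gamma> ! pos c = \<mu> ! c"
proof -
  obtain j k where j: "j < length lams" "k < plength (lams ! j)" "c = offset ls j + k"
    using column_cases[of c] assms by auto
  have "ns ! j - plength (lams ! j) + k < ns ! j" using j plength_le[of j] by simp
  note n = nth_padded[OF j(1) this]
  show "pos c < length \<gamma>" "\<gamma> ! pos c = \<mu> ! c"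
    using n j by (simp_all add: pos_column nth_basement)
qed

lemma zero_column:
  assumes "d < length \<gamma>" "d \<notin> pos ` {..<length \<mu>}"
  shows "\<gamma> ! d = 0"
proof -
  obtain j t where j: "j < length lams" "t < ns ! j" "d = offset ns j + t"
    using padded_cases assms(1) by blast
  have "t < ns ! j - plength (lams ! j)"
  proof (rule ccontr)
    assume a: "\<not> ?thesis"
    define k where "k = t - (ns ! j - plength (lams ! j))"
    have k: "k < plength (lams ! j)" "ns ! j - plength (lams ! j) + k = t"
      using a j plength_le[of j] by (auto simp: k_def)
    have "pos (offset ls j + k) = d" using pos_column[OF j(1) k(1)] k j by simp
    then show False using assms(2) nth_basement(2)[OF j(1) k(1)] by auto
  qed
  then show ?thesis using nth_padded[OF j(1,2)] j by simp
qed

lemma dg_padded_iff: "c < length \<mu> \<Longrightarrow> (pos c, k) \<in> dg \<gamma> \<longleftrightarrow> (c, k) \<in> dg \<mu>"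
  using pos_props by (simp add: dg_iff)

lemma dg_padded: "dg \<gamma> = (\<lambda>b. (pos (fst b), snd b)) ` dg \<mu>"
proof (intro set_eqI iffI)
  fix b assume b: "b \<in> dg \<gamma>"
  obtain d k where dk: "b = (d, k)" by (cases b)
  have "d < length \<gamma>" "\<gamma> ! d \<noteq> 0" using b dk by (auto simp: dg_iff)
  then have "d \<in> pos ` {..<length \<mu>}" using zero_column[of d] by metis
  then obtain c where c: "c < length \<mu>" "d = pos c" by auto
  then have "(c, k) \<in> dg \<mu>" using b dk dg_padded_iff[of c k] by simp
  then show "b \<in> (\<lambda>b. (pos (fst b), snd b)) ` dg \<mu>"
    using dk c by (intro image_eqI[of _ _ "(c, k)"]) simp_all
next
  fix b assume "b \<in> (\<lambda>b. (pos (fst b), snd b)) ` dg \<mu>"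
  then obtain c k where ck: "(c, k) \<in> dg \<mu>" "b = (pos c, k)" by auto
  then have "c < length \<mu>" by (simp add: dg_iff)
  then show "b \<in> dg \<gamma>" using ck dg_padded_iff[of c k] by simp
qed

lemma inj_on_dg: "inj_on (\<lambda>b. (pos (fst b), snd b)) (dg \<mu>)"
  using inj_pos by (auto simp: inj_on_def dg_iff)

lemma monomial_of_dg_padded:
  "monomial_of (dg \<gamma>) f = monomial_of (dg \<mu>) (\<lambda>b. f (pos (fst b), snd b))"
  unfolding monomial_of_def dg_padded by (subst sum.reindex[OF inj_on_dg]) simp

lemma valid_iff_key_filling:
  assumes \<sigma>: "\<And>b. b \<in> dg \<mu> \<Longrightarrow> small (\<sigma> b)"
    and \<tau>: "\<And>b. b \<in> dg \<mu> \<Longrightarrow> \<tau> (pos (fst b), snd b) = embed (\<sigma> b)"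
    and off: "\<And>b. b \<notin> dg \<gamma> \<Longrightarrow> \<tau> b = fst b"
  shows "non_attacking \<mu> (extend lams \<sigma>) \<and> column_decreasing \<mu> (extend lams \<sigma>) \<and>
      (\<nexists>u v w. coinversion_triple \<mu> (extend lams \<sigma>) u v w) \<longleftrightarrow> \<tau> \<in> key_fillings \<gamma>"
proof -
  let ?\<rho> = "extend lams \<sigma>"
  have base: "\<tau> (d, 0) = d" for d using off[of "(d, 0)"] by (simp add: dg_iff)
  have hat: "small (?\<rho> b) \<and> \<tau> (pos (fst b), snd b) = embed (?\<rho> b)" if "b \<in> dg_hat \<mu>" for b
  proof -
    obtain c k where b: "b = (c, k)" by (cases b)
    show ?thesis
    proof (cases "k = 0")
      case True
      then show ?thesis using that b small_basement base by (simp add: dg_hat_iff pos_def)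
    next
      case False
      then have "(c, k) \<in> dg \<mu>" using that b by (auto simp: dg_iff dg_hat_iff)
      then show ?thesis using \<sigma> \<tau> False b by force
    qed
  qed
  have step: "step_ok \<gamma> \<tau> (pos c) j \<longleftrightarrow> step_ok \<mu> ?\<rho> c j" if "(c, j) \<in> dg \<mu>" for c j
    by (rule step_ok_transfer[where \<phi> = embed])
      (use that strict_mono_pos pos_props zero_column base hat embed_le_iff in auto)
  have inj: "inj_on (\<lambda>c. ?\<rho> (c, 0)) {..<length \<mu>}"
  proof (rule linorder_inj_onI)
    fix c d assume "c < d" "c \<in> {..<length \<mu>}" "d \<in> {..<length \<mu>}"
    then show "?\<rho> (c, 0) \<noteq> ?\<rho> (d, 0)" using basement_less[of c d] by simp
  qed auto
  have "(\<forall>(c, j)\<in>dg \<mu>. step_ok \<mu> ?\<rho> c j) \<longleftrightarrow> (\<forall>(d, j)\<in>dg \<gamma>. step_ok \<gamma> \<tau> d j)"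
    unfolding dg_padded using step by auto
  also have "\<dots> \<longleftrightarrow> \<tau> \<in> key_fillings \<gamma>"
    using off unfolding key_fillings_def by blast
  finally show ?thesis unfolding valid_iff_step_ok[where \<tau> = ?\<rho>, OF inj] .
qed

section \<open>The bijection between labelings and fillings\<close>

definition to_filling :: "(box \<Rightarrow> entry) \<Rightarrow> box \<Rightarrow> nat" where
  "to_filling \<sigma> b = (if b \<in> dg \<gamma> then embed (\<sigma> (the_inv_into {..<length \<mu>} pos (fst b), snd b)) else fst b)"

definition to_labeling :: "(box \<Rightarrow> nat) \<Rightarrow> box \<Rightarrow> entry" where
  "to_labeling \<tau> = restrict (\<lambda>b. case block_vars ns ! \<tau> (pos (fst b), snd b) of (j, t) \<Rightarrow> Lab j t) (dg \<mu>)"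

lemma to_filling_pos:
  assumes "b \<in> dg \<mu>"
  shows "to_filling \<sigma> (pos (fst b), snd b) = embed (\<sigma> b)"
proof -
  have "(pos (fst b), snd b) \<in> dg \<gamma>" using assms dg_padded by blast
  moreover have "the_inv_into {..<length \<mu>} pos (pos (fst b)) = fst b"
    by (rule the_inv_into_f_f[OF inj_pos]) (use assms in \<open>cases b; auto simp: dg_iff\<close>)
  ultimately show ?thesis by (simp add: to_filling_def)
qed

lemma card_labelings_eq_card_fillings:
  "card {\<sigma> \<in> labelings lams. monomial_of (dg \<mu>) (entry_var \<circ> \<sigma>) = m} =
   card {\<tau> \<in> key_fillings \<gamma>. monomial_of (dg \<gamma>) (\<lambda>b. block_vars ns ! \<tau> b) = m}"
  (is "card ?A = card ?T")
proof (rule bij_betw_same_card[OF bij_betw_byWitness[where f' = to_labeling]])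
  have A: "\<exists>j k. \<sigma> b = Lab j k \<and> j < length lams \<and> k + plength (lams ! j) < ns ! j"
    if \<sigma>: "\<sigma> \<in> ?A" "b \<in> dg \<mu>" for \<sigma> b
  proof -
    obtain j k where jk: "\<sigma> b = Lab j k" "j < length lams"
      using labelings_Lab[of \<sigma> lams b] \<sigma> by blast
    \<comment> \<open>Every label that occurs is a variable of \<open>m\<close>, and the alphabets
      exceed all of those.\<close>
    have "(entry_var \<circ> \<sigma>) b \<in> Poly_Mapping.keys m"
      using in_keys_monomial_of[of "dg \<mu>" b "entry_var \<circ> \<sigma>"] \<sigma> by simp
    then show ?thesis using jk large[of j j k] by auto
  qed
  have A_embed: "small (\<sigma> b) \<and> block_vars ns ! embed (\<sigma> b) = entry_var (\<sigma> b)"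
    if \<sigma>: "\<sigma> \<in> ?A" "b \<in> dg \<mu>" for \<sigma> b
    using A[OF \<sigma>] by (auto simp: nth_block_vars)
  have T: "\<exists>j t. j < length lams \<and> t + plength (lams ! j) < ns ! j \<and>
      \<tau> (pos (fst b), snd b) = offset ns j + t" if \<tau>: "\<tau> \<in> ?T" "b \<in> dg \<mu>" for \<tau> b
  proof -
    have ok: "step_ok \<gamma> \<tau> d k" if "(d, k) \<in> dg \<gamma>" for d k
      using \<tau>(1) that by (auto simp: key_fillings_def)
    have le: "\<tau> (d, k) \<le> d" if "d < length \<gamma>" "k \<le> \<gamma> ! d" for d k
      using that(2)
    proof (induction k)
      case 0
      have "(d, 0) \<notin> dg \<gamma>" by (simp add: dg_iff)
      then show ?case using \<tau>(1) by (simp add: key_fillings_def)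
    next
      case (Suc k)
      then have "(d, Suc k) \<in> dg \<gamma>" using that(1) by (simp add: dg_iff)
      then have "\<tau> (d, Suc k) \<le> \<tau> (d, k)" using ok by (force simp: step_ok_def)
      then show ?case using Suc by simp
    qed
    have bd: "(pos (fst b), snd b) \<in> dg \<gamma>" using \<tau>(2) dg_padded by blast
    then have "\<tau> (pos (fst b), snd b) < length \<gamma>"
      using le[of "pos (fst b)" "snd b"] by (simp add: dg_iff)
    then obtain j t where jt: "j < length lams" "t < ns ! j"
      "\<tau> (pos (fst b), snd b) = offset ns j + t"
      using padded_cases by blast
    \<comment> \<open>The value of the box also names a variable of \<open>m\<close>, so it stays
      below the nonzero columns of its block and is the image of a label.\<close>
    have "block_vars ns ! \<tau> (pos (fst b), snd b) \<in> Poly_Mapping.keys m"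
      using in_keys_monomial_of[of "dg \<gamma>" "(pos (fst b), snd b)" "\<lambda>b. block_vars ns ! \<tau> b"] \<tau>(1) bd
      by simp
    then have "(j, t) \<in> Poly_Mapping.keys m" using jt nth_block_vars by simp
    then show ?thesis using jt large by blast
  qed
  have T_embed: "small (to_labeling \<tau> b) \<and> \<tau> (pos (fst b), snd b) = embed (to_labeling \<tau> b) \<and>
      entry_var (to_labeling \<tau> b) = block_vars ns ! \<tau> (pos (fst b), snd b) \<and>
      to_labeling \<tau> b \<in> {Lab j k |j k. j < length lams}"
    if \<tau>: "\<tau> \<in> ?T" "b \<in> dg \<mu>" for \<tau> b
  proof -
    obtain j t where "j < length lams" "t + plength (lams ! j) < ns ! j"
      "\<tau> (pos (fst b), snd b) = offset ns j + t" using T[OF \<tau>] by blast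
    then show ?thesis using \<tau>(2) by (simp add: to_labeling_def nth_block_vars)
  qed
  show "\<forall>\<sigma>\<in>?A. to_labeling (to_filling \<sigma>) = \<sigma>"
  proof (intro ballI ext)
    fix \<sigma> b assume \<sigma>: "\<sigma> \<in> ?A"
    show "to_labeling (to_filling \<sigma>) b = \<sigma> b"
    proof (cases "b \<in> dg \<mu>")
      case True
      obtain j k where "\<sigma> b = Lab j k" using A[OF \<sigma> True] by blast
      then show ?thesis using True A_embed[OF \<sigma> True]
        by (simp add: to_labeling_def to_filling_pos)
    next
      case False
      have "\<sigma> \<in> dg \<mu> \<rightarrow>\<^sub>E {Lab j k | j k. j < length lams}"
        using \<sigma> unfolding labelings_def by blast
      from PiE_arb[OF this False] False show ?thesis by (simp add: to_labeling_def)
    qed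
  qed
  show "\<forall>\<tau>\<in>?T. to_filling (to_labeling \<tau>) = \<tau>"
  proof (intro ballI ext)
    fix \<tau> b assume \<tau>: "\<tau> \<in> ?T"
    show "to_filling (to_labeling \<tau>) b = \<tau> b"
    proof (cases "b \<in> dg \<gamma>")
      case True
      then obtain b' where b': "b' \<in> dg \<mu>" "b = (pos (fst b'), snd b')" using dg_padded by auto
      then show ?thesis using T_embed[OF \<tau> b'(1)] by (simp add: to_filling_pos)
    next
      case False
      then have "\<tau> b = fst b" using \<tau> unfolding key_fillings_def by blast
      then show ?thesis using False by (simp add: to_filling_def)
    qed
  qed
  show "to_filling ` ?A \<subseteq> ?T"
  proof (rule image_subsetI)
    fix \<sigma> assume \<sigma>: "\<sigma> \<in> ?A"
    have "to_filling \<sigma> \<in> key_fillings \<gamma>"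
    proof (rule iffD1[OF valid_iff_key_filling[of \<sigma>]])
      show "non_attacking \<mu> (extend lams \<sigma>) \<and> column_decreasing \<mu> (extend lams \<sigma>) \<and>
        (\<nexists>u v w. coinversion_triple \<mu> (extend lams \<sigma>) u v w)"
        using \<sigma> by (simp add: labelings_def)
    qed (use A_embed[OF \<sigma>] to_filling_pos in \<open>auto simp: to_filling_def\<close>)
    moreover have "monomial_of (dg \<gamma>) (\<lambda>b. block_vars ns ! to_filling \<sigma> b) =
        monomial_of (dg \<mu>) (entry_var \<circ> \<sigma>)"
      unfolding monomial_of_dg_padded unfolding monomial_of_def
      by (rule sum.cong) (use A_embed[OF \<sigma>] in \<open>simp_all add: to_filling_pos\<close>)
    ultimately show "to_filling \<sigma> \<in> ?T" using \<sigma> by simp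
  qed
  show "to_labeling ` ?T \<subseteq> ?A"
  proof (rule image_subsetI)
    fix \<tau> assume \<tau>: "\<tau> \<in> ?T"
    have "non_attacking \<mu> (extend lams (to_labeling \<tau>)) \<and> column_decreasing \<mu> (extend lams (to_labeling \<tau>)) \<and>
        (\<nexists>u v w. coinversion_triple \<mu> (extend lams (to_labeling \<tau>)) u v w)"
    proof (rule iffD2[OF valid_iff_key_filling])
      show "\<tau> \<in> key_fillings \<gamma>" using \<tau> by simp
      show "\<tau> b = fst b" if "b \<notin> dg \<gamma>" for b
        using \<tau> that unfolding key_fillings_def by blast
    qed (use T_embed[OF \<tau>] in auto)
    moreover have "to_labeling \<tau> \<in> dg \<mu> \<rightarrow>\<^sub>E {Lab j k |j k. j < length lams}"
    proof (rule PiE_I)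
      show "to_labeling \<tau> b \<in> {Lab j k |j k. j < length lams}" if "b \<in> dg \<mu>" for b
        using T_embed[OF \<tau> that] by blast
    qed (simp add: to_labeling_def)
    moreover have "monomial_of (dg \<mu>) (entry_var \<circ> to_labeling \<tau>) =
        monomial_of (dg \<gamma>) (\<lambda>b. block_vars ns ! \<tau> b)"
      unfolding monomial_of_dg_padded unfolding monomial_of_def
      by (rule sum.cong) (use T_embed[OF \<tau>] in simp_all)
    ultimately show "to_labeling \<tau> \<in> ?A" using \<tau> by (simp add: labelings_def)
  qed
qed

end

theorem mainTheorem1:
  fixes lams :: "nat list list"
  assumes "\<forall>lam\<in>set lams. is_partition lam"
  shows "multi_schur lams = series_sum (labelings lams) (weight lams)"
proof
  fix m
  let ?c = "series_sum (labelings lams) (weight lams) m"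
  \<comment> \<open>\<open>insert 0\<close> covers the constant monomial.\<close>
  define K where "K = Max (insert 0 (snd ` Poly_Mapping.keys m))"
  \<comment> \<open>The sum bounds each single length, and \<open>Suc\<close> supplies the strict
    inequality required of large alphabets.\<close>
  define N where "N = Suc (K + sum_list (map plength lams))"
  have K: "k \<le> K" if "(j, k) \<in> Poly_Mapping.keys m" for j k
    unfolding K_def by (rule Max_ge) (use that in force)+
  have stable: "coeff (multi_schur_poly lams ns) m = ?c"
    if ns: "length ns = length lams" "\<forall>n\<in>set ns. N \<le> n" for ns
  proof -
    have l: "plength (lams ! j) + K < ns ! j" if "j < length lams" for j
    proof -
      have "plength (lams ! j) \<le> sum_list (map plength lams)"
        using that by (intro member_le_sum_list) auto
      moreover have "N \<le> ns ! j" using that ns by auto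
      ultimately show ?thesis by (simp add: N_def)
    qed
    interpret large_alphabets lams ns m
    proof
      show "k + plength (lams ! j) < ns ! j"
        if "j < length lams" "(j', k) \<in> Poly_Mapping.keys m" for j j' k
        using l[OF that(1)] K[OF that(2)] by simp
      show "plength (lams ! j) \<le> ns ! j" if "j < length lams" for j
        using l[OF that] by simp
    qed (rule ns)
    show ?thesis
      unfolding coeff_multi_schur_poly series_sum_weight card_labelings_eq_card_fillings ..
  qed
  show "multi_schur lams m = ?c"
    unfolding multi_schur_def
  proof (rule the_equality)
    show "stable_coeff (length lams) (multi_schur_poly lams) m ?c"
      unfolding stable_coeff_def using stable by blast
    fix c assume "stable_coeff (length lams) (multi_schur_poly lams) m c"
    then obtain N' where N': "\<And>ns. length ns = length lams \<Longrightarrow> \<forall>n\<in>set ns. N' \<le> n \<Longrightarrow>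
        coeff (multi_schur_poly lams ns) m = c"
      unfolding stable_coeff_def by blast
    \<comment> \<open>Sizes beyond both bounds force the two stable values to agree.\<close>
    have "coeff (multi_schur_poly lams (replicate (length lams) (max N N'))) m = c"
      by (rule N') auto
    moreover have "coeff (multi_schur_poly lams (replicate (length lams) (max N N'))) m = ?c"
      by (rule stable) auto
    ultimately show "c = ?c" by simp
  qed
qed

end
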